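(* Let $\mathfrak{g}=\oplus_t\mathfrak{g}_t$ be an involutive symbolic system of pure order $k\ge1$ on an $n$-dimensional vector space $T$ with values in a finite-dimensional vector space $N$. Let $s_0=\dim N$, let $s_1,\dots,s_n$ be its Cartan characters, and let $h_0=\dim H^{0,0}(\mathfrak{g})=\dim N$ and $h_i=\dim H^{k-1,i}(\mathfrak{g})$ for $1\le i\le n$. Then $h_0=s_0$ and, for $1\le l\le n$, $$h_l=(-1)^l\sum_{j=1}^n s_j\sum_{i=0}^{l-1}(-1)^i\binom{n}{i}\binom{l+j-i-2}{j-1}+(-1)^l s_0\sum_{i=l}^n(-1)^i\binom{n}{i}\binom{k+l+n-i-2}{n-1}.$$
   Context: A symbolic system of order $k$ is a sequence $\mathfrak{g}_i=S^iT^*\otimes N$ for $i<k$, a subspace $\mathfrak{g}_k\subset S^kT^*\otimes N$, and $\mathfrak{g}_i=(\mathfrak{g}_k\otimes S^{i-k}T^* )\cap(S^iT^*\otimes N)$ for $i>k$. The Spencer $\delta$-complex is $$0\to \mathfrak{g}_t\to \mathfrak{g}_{t-1}\otimes T^*\xrightarrow{\delta}\mathfrak{g}_{t-2}\otimes\Lambda^2T^*\xrightarrow{\delta}\cdots,$$ with $\delta(p^i\otimes v\otimes\omega)=i\,p^{i-1}\otimes v\otimes(p\wedge\omega)$ for $p\in T^*$, $v\in N$, $\omega\in\Lambda^jT^*$, and $H^{i,j}(\mathfrak{g})$ is its cohomology at $\mathfrak{g}_i\otimes\Lambda^jT^*$. The system is involutive if $H^{i,j}(\mathfrak{g})=0$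 for all $i\ne k-1$ with $i+j>0$. Cartan characters: for a generic complete flag $0=V_n^*\subset V_{n-1}^*\subset\dots\subset V_0^*=T^*$ (consecutive dimensions differ by 1), $$s_i=\dim(\mathfrak{g}_k\cap S^kV_{i-1}^*\otimes N)-\dim(\mathfrak{g}_k\cap S^kV_i^*\otimes N),\quad 1\le i\le n.$$ It is known that involutivity is equivalent to the Cartan test $\dim\mathfrak{g}_{k+1}=s_1+2s_2+\dots+ns_n$. *)

theory Defs
  imports Complex_Main "HOL-Library.Function_Algebras" "HOL-Library.FuncSet"
begin

definition fscale :: "('k \<Rightarrow> 'b \<Rightarrow> 'b) \<Rightarrow> 'k \<Rightarrow> ('a \<Rightarrow> 'b) \<Rightarrow> 'a \<Rightarrow> 'b"
  where "fscale sc c f = (\<lambda>x. sc c (f x))"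

lemma vector_space_fscale: "vector_space sc \<Longrightarrow> vector_space (fscale sc)"
  unfolding vector_space_def fscale_def by (auto simp: fun_eq_iff)

lemma vector_space_times: "vector_space ((*) :: 'k::field \<Rightarrow> 'k \<Rightarrow> 'k)"
  by unfold_locales (simp_all add: algebra_simps)

definition quotient_space :: "'a::ab_group_add set \<Rightarrow> 'a set \<Rightarrow> 'a set set"
  where "quotient_space Z B = (\<lambda>z. (+) z ` B) ` Z"

text \<open>
  The dimension of \<open>Z / B\<close>: the number \<open>d\<close> for which there are \<open>z\<^sub>0, \<dots>, z\<^bsub>d-1\<^esub>\<close> in \<open>Z\<close> whose
  classes form a basis, i.e. every class is that of exactly one linear combination
  \<open>c\<^sub>0 z\<^sub>0 + \<dots> + c\<^bsub>d-1\<^esub> z\<^bsub>d-1\<^esub>\<close>.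
\<close>

definition quotient_dim ::
    "('k::field \<Rightarrow> 'a::ab_group_add \<Rightarrow> 'a) \<Rightarrow> 'a set \<Rightarrow> 'a set \<Rightarrow> nat"
  where "quotient_dim sc Z B =
    (THE d. \<exists>z. z ` {..<d} \<subseteq> Z \<and>
       bij_betw (\<lambda>c. (+) (\<Sum>a<d. sc (c a) (z a)) ` B) ({..<d} \<rightarrow>\<^sub>E UNIV) (quotient_space Z B))"

text \<open>
  Tensors are realised as multilinear maps on lists of vectors (with value 0 on lists of the wrong
  length). The symmetric power \<open>S\<^sup>r T\<^sup>*\<close> is spanned by the powers \<open>p\<^sup>r\<close>, where \<open>p\<^sup>r\<close> is the map
  \<open>(x\<^sub>1, \<dots>, x\<^sub>r) \<mapsto> p(x\<^sub>1) \<cdots> p(x\<^sub>r)\<close>; this is the full symmetric power since the characteristic is 0.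
\<close>

definition power_form :: "nat \<Rightarrow> ('t \<Rightarrow> 'k::field) \<Rightarrow> 't list \<Rightarrow> 'k"
  where "power_form r p xs = (if length xs = r then prod_list (map p xs) else 0)"

definition omit :: "nat \<Rightarrow> 'a list \<Rightarrow> 'a list"
  where "omit a ys = take a ys @ drop (Suc a) ys"

text \<open>The product \<open>p \<and> \<omega>\<close>; iterated, it gives \<open>(q\<^sub>1 \<and> \<dots> \<and> q\<^sub>j)(y\<^sub>1, \<dots>, y\<^sub>j) = det (q\<^sub>a (y\<^sub>b))\<close>.\<close>

definition wedge :: "('t \<Rightarrow> 'k::field) \<Rightarrow> ('t list \<Rightarrow> 'k) \<Rightarrow> 't list \<Rightarrow> 'k"
  where "wedge p \<omega> ys = (\<Sum>a<length ys. (- 1) ^ a * p (ys ! a) * \<omega> (omit a ys))"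

definition wedge_list :: "('t \<Rightarrow> 'k::field) list \<Rightarrow> 't list \<Rightarrow> 'k"
  where "wedge_list qs = foldr wedge qs (\<lambda>ys. if ys = [] then 1 else 0)"

text \<open>\<open>sT\<close> and \<open>sN\<close> are the scalar multiplications of \<open>T\<close> (type \<open>'t\<close>) and \<open>N\<close> (type \<open>'v\<close>).\<close>

locale symbol_spaces =
  T: vector_space sT + N: vector_space sN
  for sT :: "'k::field_char_0 \<Rightarrow> 't::ab_group_add \<Rightarrow> 't"
    and sN :: "'k \<Rightarrow> 'v::ab_group_add \<Rightarrow> 'v" +
  assumes finite_dim_T: "\<exists>B. finite B \<and> T.span B = UNIV"
    and finite_dim_N: "\<exists>B. finite B \<and> N.span B = UNIV"
begin

sublocale D: vector_space "fscale (*) :: 'k \<Rightarrow> ('t \<Rightarrow> 'k) \<Rightarrow> 't \<Rightarrow> 'k"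
  by (rule vector_space_fscale[OF vector_space_times])

sublocale F: vector_space "fscale (*) :: 'k \<Rightarrow> ('t list \<Rightarrow> 'k) \<Rightarrow> 't list \<Rightarrow> 'k"
  by (rule vector_space_fscale[OF vector_space_times])

sublocale G: vector_space "fscale sN :: 'k \<Rightarrow> ('t list \<Rightarrow> 'v) \<Rightarrow> 't list \<Rightarrow> 'v"
  by (rule vector_space_fscale[OF N.vector_space_axioms])

sublocale C: vector_space
    "fscale (fscale sN) :: 'k \<Rightarrow> ('t list \<Rightarrow> 't list \<Rightarrow> 'v) \<Rightarrow> 't list \<Rightarrow> 't list \<Rightarrow> 'v"
  by (rule vector_space_fscale[OF G.vector_space_axioms])

definition dual :: "('t \<Rightarrow> 'k) set"
  where "dual = {p. Vector_Spaces.linear sT (*) p}"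

definition Sym :: "nat \<Rightarrow> ('t \<Rightarrow> 'k) set \<Rightarrow> ('t list \<Rightarrow> 'k) set"
  where "Sym r V = F.span (power_form r ` V)"

definition Ext :: "nat \<Rightarrow> ('t list \<Rightarrow> 'k) set"
  where "Ext j = F.span {wedge_list qs | qs. length qs = j \<and> set qs \<subseteq> dual}"

text \<open>\<open>S\<^sup>r V \<otimes> N\<close> for a subspace \<open>V\<close> of \<open>T\<^sup>*\<close>.\<close>

definition SymN :: "nat \<Rightarrow> ('t \<Rightarrow> 'k) set \<Rightarrow> ('t list \<Rightarrow> 'v) set"
  where "SymN r V = G.span {(\<lambda>xs. sN (\<phi> xs) v) | \<phi> v. \<phi> \<in> Sym r V}"

text \<open>
  \<open>W \<otimes> S\<^sup>r T\<^sup>*\<close> for \<open>W \<subseteq> S\<^sup>k T\<^sup>* \<otimes> N\<close>, inside the \<open>N\<close>-valued multilinear maps in \<open>k + r\<close> arguments,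
  the first \<open>k\<close> of which are those of \<open>W\<close>.
\<close>

definition tensor_Sym ::
    "nat \<Rightarrow> ('t list \<Rightarrow> 'v) set \<Rightarrow> nat \<Rightarrow> ('t list \<Rightarrow> 'v) set"
  where "tensor_Sym k W r =
    G.span {(\<lambda>xs. sN (\<phi> (drop k xs)) (f (take k xs))) | f \<phi>. f \<in> W \<and> \<phi> \<in> Sym r dual}"

definition tensor_form :: "('t list \<Rightarrow> 'v) \<Rightarrow> ('t list \<Rightarrow> 'k) \<Rightarrow> 't list \<Rightarrow> 't list \<Rightarrow> 'v"
  where "tensor_form f \<omega> = (\<lambda>xs ys. sN (\<omega> ys) (f xs))"

definition tensor_Ext :: "('t list \<Rightarrow> 'v) set \<Rightarrow> nat \<Rightarrow> ('t list \<Rightarrow> 't list \<Rightarrow> 'v) set"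
  where "tensor_Ext W j = C.span {tensor_form f \<omega> | f \<omega>. f \<in> W \<and> \<omega> \<in> Ext j}"

definition symbolic_system :: "nat \<Rightarrow> (nat \<Rightarrow> ('t list \<Rightarrow> 'v) set) \<Rightarrow> bool"
  where "symbolic_system k g \<longleftrightarrow>
    (\<forall>i<k. g i = SymN i dual) \<and>
    G.subspace (g k) \<and> g k \<subseteq> SymN k dual \<and>
    (\<forall>i>k. g i = tensor_Sym k (g k) (i - k) \<inter> SymN i dual)"

text \<open>
  The factor \<open>Suc (length xs)\<close> is the polynomial degree \<open>i\<close>, since an element of
  \<open>S\<^sup>i T\<^sup>* \<otimes> N \<otimes> \<Lambda>\<^sup>j T\<^sup>*\<close> is nonzero only on pairs of lists of lengths \<open>i\<close> and \<open>j\<close>.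
\<close>

definition spencer_delta :: "('t list \<Rightarrow> 't list \<Rightarrow> 'v) \<Rightarrow> 't list \<Rightarrow> 't list \<Rightarrow> 'v"
  where "spencer_delta f = (\<lambda>xs ys. sN (of_nat (Suc (length xs)))
    (\<Sum>a<length ys. sN ((- 1) ^ a) (f (ys ! a # xs) (omit a ys))))"

lemma spencer_delta_Suc:
  "spencer_delta (tensor_form (\<lambda>xs. sN (power_form (Suc i) p xs) v) \<omega>) =
    fscale (fscale sN) (of_nat (Suc i)) (tensor_form (\<lambda>xs. sN (power_form i p xs) v) (wedge p \<omega>))"
proof (intro ext)
  fix xs ys
  show "spencer_delta (tensor_form (\<lambda>xs. sN (power_form (Suc i) p xs) v) \<omega>) xs ys =
    fscale (fscale sN) (of_nat (Suc i)) (tensor_form (\<lambda>xs. sN (power_form i p xs) v) (wedge p \<omega>)) xs ys"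
  proof (cases "length xs = i")
    case True
    then show ?thesis
      by (simp add: spencer_delta_def tensor_form_def fscale_def power_form_def wedge_def
          N.scale_sum_left sum_distrib_left sum_distrib_right N.scale_sum_right mult_ac)
  next
    case False
    then show ?thesis
      by (simp add: spencer_delta_def tensor_form_def fscale_def power_form_def)
  qed
qed

lemma spencer_delta_0:
  "spencer_delta (tensor_form (\<lambda>xs. sN (power_form 0 p xs) v) \<omega>) = 0"
  by (simp add: spencer_delta_def tensor_form_def power_form_def fun_eq_iff)

definition cocycles :: "(nat \<Rightarrow> ('t list \<Rightarrow> 'v) set) \<Rightarrow> nat \<Rightarrow> nat \<Rightarrow> ('t list \<Rightarrow> 't list \<Rightarrow> 'v) set"
  where "cocycles g i j = {f \<in> tensor_Ext (g i) j. spencer_delta f = 0}"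

definition coboundaries :: "(nat \<Rightarrow> ('t list \<Rightarrow> 'v) set) \<Rightarrow> nat \<Rightarrow> nat \<Rightarrow> ('t list \<Rightarrow> 't list \<Rightarrow> 'v) set"
  where "coboundaries g i j =
    (case j of 0 \<Rightarrow> {0} | Suc j' \<Rightarrow> spencer_delta ` tensor_Ext (g (Suc i)) j')"

definition cohomology ::
    "(nat \<Rightarrow> ('t list \<Rightarrow> 'v) set) \<Rightarrow> nat \<Rightarrow> nat \<Rightarrow> ('t list \<Rightarrow> 't list \<Rightarrow> 'v) set set"
  where "cohomology g i j = quotient_space (cocycles g i j) (coboundaries g i j)"

definition cohomology_dim :: "(nat \<Rightarrow> ('t list \<Rightarrow> 'v) set) \<Rightarrow> nat \<Rightarrow> nat \<Rightarrow> nat"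
  where "cohomology_dim g i j =
    quotient_dim (fscale (fscale sN)) (cocycles g i j) (coboundaries g i j)"

text \<open>A quotient space vanishes iff its only element is the class of 0.\<close>

definition involutive :: "nat \<Rightarrow> (nat \<Rightarrow> ('t list \<Rightarrow> 'v) set) \<Rightarrow> bool"
  where "involutive k g \<longleftrightarrow>
    (\<forall>i j. i \<noteq> k - 1 \<and> i + j > 0 \<longrightarrow> cohomology g i j = {coboundaries g i j})"

text \<open>
  A complete flag of \<open>T\<^sup>*\<close> is given by a basis \<open>b\<^sub>0, \<dots>, b\<^bsub>n-1\<^esub>\<close> of \<open>T\<^sup>*\<close>, with \<open>V\<^sub>i\<^sup>*\<close> the
  \<open>(n - i)\<close>-dimensional span of \<open>b\<^sub>i, \<dots>, b\<^bsub>n-1\<^esub>\<close>. A property holds for the generic flag if it holds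
  on a nonempty Zariski open set, here described by the nonvanishing of a polynomial in the
  coordinates of the basis (the flag variety carries the quotient topology of the set of bases).
\<close>

definition is_coframe :: "(nat \<Rightarrow> 't \<Rightarrow> 'k) \<Rightarrow> bool"
  where "is_coframe b \<longleftrightarrow> inj_on b {..<T.dim UNIV} \<and>
    D.independent (b ` {..<T.dim UNIV}) \<and> D.span (b ` {..<T.dim UNIV}) = dual"

definition flag_of :: "(nat \<Rightarrow> 't \<Rightarrow> 'k) \<Rightarrow> nat \<Rightarrow> ('t \<Rightarrow> 'k) set"
  where "flag_of b i = D.span (b ` {i..<T.dim UNIV})"

inductive polynomial_in_coframe :: "((nat \<Rightarrow> 't \<Rightarrow> 'k) \<Rightarrow> 'k) \<Rightarrow> bool" where
  const: "polynomial_in_coframe (\<lambda>b. c)"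
| coordinate: "a < T.dim UNIV \<Longrightarrow> polynomial_in_coframe (\<lambda>b. b a x)"
| add: "polynomial_in_coframe P \<Longrightarrow> polynomial_in_coframe Q \<Longrightarrow> polynomial_in_coframe (\<lambda>b. P b + Q b)"
| mult: "polynomial_in_coframe P \<Longrightarrow> polynomial_in_coframe Q \<Longrightarrow> polynomial_in_coframe (\<lambda>b. P b * Q b)"

definition for_generic_flag :: "((nat \<Rightarrow> ('t \<Rightarrow> 'k) set) \<Rightarrow> bool) \<Rightarrow> bool"
  where "for_generic_flag Q \<longleftrightarrow>
    (\<exists>P. polynomial_in_coframe P \<and> (\<exists>b. is_coframe b \<and> P b \<noteq> 0) \<and>
      (\<forall>b. is_coframe b \<and> P b \<noteq> 0 \<longrightarrow> Q (flag_of b)))"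

text \<open>
  This determines \<open>s\<^sub>1, \<dots>, s\<^sub>n\<close>, as any two nonempty Zariski open sets of flags meet; the value of
  \<open>s\<close> at other indices is unconstrained.
\<close>

definition cartan_characters ::
    "nat \<Rightarrow> (nat \<Rightarrow> ('t list \<Rightarrow> 'v) set) \<Rightarrow> (nat \<Rightarrow> int) \<Rightarrow> bool"
  where "cartan_characters k g s \<longleftrightarrow>
    for_generic_flag (\<lambda>V. \<forall>i\<in>{1..T.dim UNIV}.
      s i = int (G.dim (g k \<inter> SymN k (V (i - 1)))) - int (G.dim (g k \<inter> SymN k (V i))))"

end

end

theory Submission
  imports Defs "HOL-Computational_Algebra.Polynomial" "HOL-Computational_Algebra.Formal_Power_Series"
begin

text \<open>
  In total degree \<open>t \<ge> 1\<close> the \<open>\<delta>\<close>-complex of an involutive system has at most one nonzero cohomology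
  space, \<open>H\<^bsup>k-1,t+1-k\<^esup>\<close>. Hence its Euler characteristic gives both the \<open>h\<^sub>l\<close> in terms of the
  \<open>dim g\<^sub>t\<close> and, for \<open>t < k\<close>, a recursion that forces \<open>dim g\<^sub>t = s\<^sub>0 (t+n-1 choose n-1)\<close>.

  What remains is \<open>dim g\<^bsub>k+r\<^esub> = \<Sum>\<^sub>j s\<^sub>j (r+j-1 choose j-1)\<close>. For a flag with dual frame
  \<open>e\<^sub>0, e\<^sub>1, \<dots>\<close> of \<open>T\<close>, the space \<open>g\<^sub>t \<inter> (S\<^sup>t V\<^sub>i\<^sup>* \<otimes> N)\<close> is the joint kernel of the contractions with
  \<open>e\<^sub>a\<close>, \<open>a < i\<close>, and the formula follows if the contraction with \<open>e\<^sub>i\<close> maps the \<open>i\<close>-th kernel in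
  degree \<open>t + 1\<close> onto the one in degree \<open>t\<close>. Such a frame is found by modifying one vector at a time:
  \<open>e\<^sub>m\<close> is replaced by \<open>\<Sum>\<^sub>i x\<^sup>i e\<^bsub>m+i\<^esub>\<close>. If this failed to be surjective for infinitely many \<open>x\<close>, there
  would be a polynomial family of functionals killed by it, which exactness of the Koszul complex of
  the remaining contractions excludes. The dual coframe stays polynomial in \<open>x\<close>, so the genericity
  condition defining the Cartan characters is preserved for almost all \<open>x\<close>.
\<close>

section \<open>Dimensions of quotients, kernels and images\<close>

text \<open>Surjectivity of a contraction is dual to injectivity of multiplication by a vector of
  \<open>T\<close> on the graded dual. Instead of avoiding associated primes, a vector moves along a
  single curve, so that each condition excludes finitely many \<open>x\<close> of an infinite field.
  That field may be countable, hence only finitely many degrees can be treated at once: a frame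
  depends on a bound \<open>R\<close>, and the dimension formula uses a frame chosen for the degree
  in question. Two losses fix the bookkeeping. Exactness on the next kernels in degree
  \<open>t\<close> consumes surjectivity in degree \<open>t + 1\<close>. Excluding a polynomial
  family climbs one degree for each of its possible coefficients, and elimination over polynomials
  doubles degree bounds once per dimension; this is the margin \<open>2 ^ d * Suc T_dim\<close>. The
  parameter \<open>x = 0\<close> returns the old frame, so the genericity polynomial restricted to
  the curve is nonzero. In a frame, the Spencer differential is the Koszul differential up to the
  factor \<open>Suc i\<close>, invertible in characteristic 0; this is how involutivity becomes
  Koszul exactness in degrees from \<open>k\<close> on.\<close>

context vector_space
begin

text \<open>The spaces of functions on lists of vectors need not be finite-dimensional, so
  dimensions are counted inside finitely generated spans; the generators \<open>M\<close> may lie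
  outside \<open>S\<close>.\<close>

definition fin_dim :: "'b set \<Rightarrow> bool"
  where "fin_dim S \<longleftrightarrow> (\<exists>M. finite M \<and> S \<subseteq> local.span M)"

lemma fin_dim_subset: "local.fin_dim T \<Longrightarrow> S \<subseteq> T \<Longrightarrow> local.fin_dim S"
  unfolding fin_dim_def by blast

lemma fin_dim_basis:
  assumes "local.fin_dim S"
  obtains B where "finite B" "B \<subseteq> S" "local.independent B" "S \<subseteq> local.span B" "card B = local.dim S"
proof -
  obtain M where M: "finite M" "S \<subseteq> local.span M" using assms unfolding fin_dim_def by blast
  obtain B where B: "B \<subseteq> S" "local.independent B" "S \<subseteq> local.span B" "card B = local.dim S" by (rule basis_exists)
  moreover have "finite B" using independent_span_bound[of M B] M B by blast
  ultimately show ?thesis using that by blast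
qed

lemma dim_mono_fin_dim:
  assumes "local.fin_dim T" "S \<subseteq> T" shows "local.dim S \<le> local.dim T"
proof -
  obtain B where "finite B" "T \<subseteq> local.span B" "card B = local.dim T"
    using fin_dim_basis[OF assms(1)] by metis
  then show ?thesis using dim_le_card[of S B] assms(2) by auto
qed

lemma independent_family:
  assumes "finite I"
    and indep: "\<And>c. (\<Sum>i\<in>I. c i *s f i) = 0 \<Longrightarrow> \<forall>i\<in>I. c i = 0"
  shows "inj_on f I" and "local.independent (f ` I)"
proof -
  show inj: "inj_on f I"
  proof (rule inj_onI, rule ccontr)
    fix i j assume ij: "i \<in> I" "j \<in> I" "f i = f j" "i \<noteq> j"
    define c where "c l = (if l = i then 1 else if l = j then -1 else (0::'a))" for l
    have "(\<Sum>l\<in>I. c l *s f l) = (\<Sum>l\<in>{i,j}. c l *s f l)"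
      by (rule sum.mono_neutral_right) (use assms(1) ij in \<open>auto simp: c_def\<close>)
    also have "\<dots> = 0" using ij by (simp add: c_def)
    finally have "c i = 0" using indep ij by blast
    then show False by (simp add: c_def)
  qed
  show "local.independent (f ` I)"
  proof (rule independent_if_scalars_zero)
    fix u x assume u: "(\<Sum>x\<in>f ` I. u x *s x) = 0" and x: "x \<in> f ` I"
    have "(\<Sum>i\<in>I. u (f i) *s f i) = 0" using u by (simp add: sum.reindex[OF inj])
    then show "u x = 0" using indep[of "\<lambda>i. u (f i)"] x by blast
  qed (use assms in simp)
qed

lemma dim_family:
  assumes "finite I"
    and "\<And>c. (\<Sum>i\<in>I. c i *s f i) = 0 \<Longrightarrow> \<forall>i\<in>I. c i = 0"
    and "f ` I \<subseteq> S" and "S \<subseteq> local.span (f ` I)"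
  shows "local.dim S = card I"
  using independent_family[where f = f, OF assms(1,2)] assms(3,4)
  by (intro dim_unique[of "f ` I"]) (auto intro: card_image)

lemma independent_sum_zero:
  assumes "finite B" "local.independent B" "(\<Sum>b\<in>B. c b *s b) = 0" "b \<in> B"
  shows "c b = 0"
  using independentD[OF assms(2,1) subset_refl assms(3,4)] .

text \<open>This makes the \<open>THE\<close> in \<open>quotient_dim\<close> unambiguous:
  representatives \<open>z\<close> of a basis of the quotient, together with a basis of
  \<open>B\<close>, form a basis of \<open>Z\<close>. Indexing by a disjoint sum spares a separate
  proof that \<open>z\<close> is injective and misses the basis of \<open>B\<close>.\<close>

lemma quotient_basis_dim:
  assumes Z: "local.subspace Z" "local.fin_dim Z" and B: "local.subspace B" "B \<subseteq> Z"
    and z: "z ` {..<d} \<subseteq> Z"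
    and bij: "bij_betw (\<lambda>c. (+) (\<Sum>a<d. c a *s z a) ` B) ({..<d} \<rightarrow>\<^sub>E UNIV) (quotient_space Z B)"
  shows "local.dim Z = d + local.dim B"
proof -
  have "local.fin_dim B" using fin_dim_subset Z B by blast
  then obtain C where C: "finite C" "C \<subseteq> B" "local.independent C" "B \<subseteq> local.span C" "card C = local.dim B"
    by (rule fin_dim_basis)
  define f where "f = case_sum z (\<lambda>x::'b. x)"
  have sum_f: "(\<Sum>i\<in>{..<d} <+> C. c i *s f i) = (\<Sum>a<d. c (Inl a) *s z a) + (\<Sum>x\<in>C. c (Inr x) *s x)" for c
    using C(1) by (simp add: f_def sum.Plus)
  have coset: "(+) x ` B = B" if "x \<in> B" for x
  proof -
    have "y \<in> (+) x ` B" if "y \<in> B" for y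
      using subspace_diff[OF B(1) that \<open>x \<in> B\<close>] by (intro image_eqI[of _ _ "y - x"]) auto
    then show ?thesis using subspace_add[OF B(1) that] by auto
  qed
  have "local.dim Z = card ({..<d} <+> C)"
  proof (rule dim_family[where f = f])
    show "finite ({..<d} <+> C)" using C by simp
  next
    fix c assume 0: "(\<Sum>i\<in>{..<d} <+> C. c i *s f i) = 0"
    \<comment> \<open>A vanishing combination puts its \<open>z\<close>-part into \<open>B\<close>,
      so that part has the same coset as the zero coefficients; injectivity of the coset map then
      kills the coefficients.\<close>
    let ?c = "restrict (\<lambda>a. - c (Inl a)) {..<d}" and ?o = "restrict (\<lambda>a. 0::'a) {..<d}"
    have "(\<Sum>a<d. ?c a *s z a) = - (\<Sum>a<d. c (Inl a) *s z a)"
      by (subst sum_negf[symmetric], intro sum.cong) auto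
    also have "\<dots> = (\<Sum>x\<in>C. c (Inr x) *s x)" using 0 by (simp add: sum_f minus_unique)
    also have "\<dots> \<in> B" using C(2) B(1) by (auto intro!: subspace_sum subspace_scale)
    finally have c_B: "(\<Sum>a<d. ?c a *s z a) \<in> B" .
    have o_B: "(\<Sum>a<d. ?o a *s z a) \<in> B"
      using subspace_0[OF B(1)] by (simp add: sum.neutral)
    have "(+) (\<Sum>a<d. ?c a *s z a) ` B = (+) (\<Sum>a<d. ?o a *s z a) ` B"
      by (rule trans[OF coset[OF c_B] coset[OF o_B, symmetric]])
    then have "?c = ?o"
      by (rule inj_onD[OF bij_betw_imp_inj_on[OF bij]]) (auto simp: PiE_def extensional_def)
    then have l: "c (Inl a) = 0" if "a < d" for a
      using that by (auto simp: fun_eq_iff restrict_def split: if_splits)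
    then have "(\<Sum>x\<in>C. c (Inr x) *s x) = 0" using 0 by (simp add: sum_f)
    then have "c (Inr x) = 0" if "x \<in> C" for x
      using independent_sum_zero[OF C(1,3), of "\<lambda>x. c (Inr x)"] that by auto
    with l show "\<forall>i\<in>{..<d} <+> C. c i = 0" by auto
  next
    show "f ` ({..<d} <+> C) \<subseteq> Z" using z B C by (auto simp: f_def)
  next
    show "Z \<subseteq> local.span (f ` ({..<d} <+> C))"
    proof
      fix x assume "x \<in> Z"
      then have "(+) x ` B \<in> quotient_space Z B" by (auto simp: quotient_space_def)
      then obtain c where c: "(+) x ` B = (+) (\<Sum>a<d. c a *s z a) ` B"
        using bij unfolding bij_betw_def by (metis (no_types, lifting) imageE)
      have "x \<in> (+) x ` B" using subspace_0[OF B(1)] by force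
      then obtain y where y: "y \<in> B" "x = (\<Sum>a<d. c a *s z a) + y" using c by auto
      have "z a \<in> local.span (f ` ({..<d} <+> C))" if "a < d" for a
        using that by (intro span_base image_eqI[of _ _ "Inl a"]) (auto simp: f_def)
      moreover have "C \<subseteq> f ` ({..<d} <+> C)" by (force simp: f_def)
      then have "y \<in> local.span (f ` ({..<d} <+> C))" using y C span_mono by blast
      ultimately show "x \<in> local.span (f ` ({..<d} <+> C))"
        unfolding y(2) by (intro span_add span_sum span_scale) auto
    qed
  qed
  also have "\<dots> = d + local.dim B" using C by (simp add: card_Plus)
  finally show ?thesis .
qed

text \<open>Existence for the \<open>THE\<close>: a basis \<open>C\<close> of \<open>B\<close>
  extends to a basis \<open>E\<close> of \<open>Z\<close>, and the classes of \<open>E - C\<close>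
  form a basis of the quotient. The additive form avoids truncated subtraction.\<close>

lemma quotient_dim_eq:
  assumes Z: "local.subspace Z" "local.fin_dim Z" and B: "local.subspace B" "B \<subseteq> Z"
  shows "local.dim Z = quotient_dim scale Z B + local.dim B"
proof -
  have "local.fin_dim B" using fin_dim_subset Z B by blast
  then obtain C where C: "finite C" "C \<subseteq> B" "local.independent C" "B \<subseteq> local.span C" "card C = local.dim B"
    by (rule fin_dim_basis)
  obtain E where E: "C \<subseteq> E" "E \<subseteq> Z" "local.independent E" "Z \<subseteq> local.span E"
    using maximal_independent_subset_extend[of C Z] C B by blast
  obtain M where M: "finite M" "Z \<subseteq> local.span M" using Z unfolding fin_dim_def by blast
  have finE: "finite E" using independent_span_bound[of M E] M E by blast
  define d where "d = card (E - C)"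
  obtain z where z: "bij_betw z {..<d} (E - C)"
    using ex_bij_betw_nat_finite[of "E - C"] finE by (auto simp: d_def atLeast0LessThan)
  have sum_z: "(\<Sum>a<d. c a *s z a) = (\<Sum>e\<in>E - C. c (the_inv_into {..<d} z e) *s e)" for c
    by (rule sum.reindex_bij_betw[OF z, symmetric, THEN trans, symmetric])
      (use z in \<open>auto simp: bij_betw_def the_inv_into_f_f intro!: sum.cong\<close>)
  have coset: "x - y \<in> B" if "(+) x ` B = (+) y ` B" for x y
  proof -
    have "x \<in> (+) x ` B" using subspace_0[OF B(1)] by force
    then show ?thesis using that by auto
  qed
  have coset': "(+) x ` B = (+) y ` B" if "x - y \<in> B" for x y
  proof -
    have "u \<in> (+) y ` B" if u: "u \<in> (+) x ` B" "x - y \<in> B" for u x y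
    proof -
      obtain w where "w \<in> B" "u = x + w" using u by auto
      then show ?thesis using subspace_add[OF B(1) u(2)]
        by (intro image_eqI[of _ _ "(x - y) + w"]) auto
    qed
    moreover have "y - x \<in> B" using subspace_neg[OF B(1) that] by simp
    ultimately show ?thesis using that by blast
  qed
  have "bij_betw (\<lambda>c. (+) (\<Sum>a<d. c a *s z a) ` B) ({..<d} \<rightarrow>\<^sub>E UNIV) (quotient_space Z B)"
    unfolding bij_betw_def
  proof
    show "inj_on (\<lambda>c. (+) (\<Sum>a<d. c a *s z a) ` B) ({..<d} \<rightarrow>\<^sub>E UNIV)"
    proof (rule inj_onI)
      fix c c' assume cc: "c \<in> {..<d} \<rightarrow>\<^sub>E UNIV" "c' \<in> {..<d} \<rightarrow>\<^sub>E UNIV"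
        "(+) (\<Sum>a<d. c a *s z a) ` B = (+) (\<Sum>a<d. c' a *s z a) ` B"
      let ?u = "\<lambda>e. c (the_inv_into {..<d} z e) - c' (the_inv_into {..<d} z e)"
      have "(\<Sum>a<d. c a *s z a) - (\<Sum>a<d. c' a *s z a) \<in> local.span C" using coset[OF cc(3)] C by blast
      then have "(\<Sum>e\<in>E - C. ?u e *s e) \<in> local.span C"
        by (simp add: sum_z sum_subtractf scale_left_diff_distrib)
      then obtain v where v: "(\<Sum>e\<in>E - C. ?u e *s e) = (\<Sum>x\<in>C. v x *s x)"
        using span_finite[OF C(1)] by auto
      let ?w = "\<lambda>e. if e \<in> C then - v e else ?u e"
      have "(\<Sum>e\<in>E. ?w e *s e) = (\<Sum>e\<in>E - C. ?w e *s e) + (\<Sum>e\<in>C. ?w e *s e)"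
        by (rule sum.subset_diff) (use E finE in auto)
      also have "\<dots> = 0" using v by (simp add: sum_negf)
      finally have w0: "?w e = 0" if "e \<in> E" for e
        using independent_sum_zero[OF finE E(3), of ?w] that by blast
      have "c a = c' a" if "a < d" for a
      proof -
        have "z a \<in> E - C" using z that by (auto simp: bij_betw_def)
        then have "?u (z a) = 0" using w0[of "z a"] by auto
        then show ?thesis using z that by (simp add: bij_betw_def the_inv_into_f_f)
      qed
      then show "c = c'" using cc by (intro PiE_ext[OF cc(1,2)]) auto
    qed
    show "(\<lambda>c. (+) (\<Sum>a<d. c a *s z a) ` B) ` ({..<d} \<rightarrow>\<^sub>E UNIV) = quotient_space Z B"
    proof
      have "(\<Sum>a<d. c a *s z a) \<in> Z" for c
        using z E Z by (intro subspace_sum subspace_scale) (auto simp: bij_betw_def)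
      then show "(\<lambda>c. (+) (\<Sum>a<d. c a *s z a) ` B) ` ({..<d} \<rightarrow>\<^sub>E UNIV) \<subseteq> quotient_space Z B"
        by (auto simp: quotient_space_def)
      show "quotient_space Z B \<subseteq> (\<lambda>c. (+) (\<Sum>a<d. c a *s z a) ` B) ` ({..<d} \<rightarrow>\<^sub>E UNIV)"
      proof
        fix X assume "X \<in> quotient_space Z B"
        then obtain x where x: "x \<in> Z" "X = (+) x ` B" by (auto simp: quotient_space_def)
        then obtain v where v: "x = (\<Sum>e\<in>E. v e *s e)" using E(4) span_finite[OF finE] by auto
        let ?c = "restrict (\<lambda>a. v (z a)) {..<d}"
        have "(\<Sum>a<d. ?c a *s z a) = (\<Sum>e\<in>E - C. v e *s e)"
          by (rule trans[OF sum.cong sum.reindex_bij_betw[OF z]]) auto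
        moreover have "x = (\<Sum>e\<in>E - C. v e *s e) + (\<Sum>e\<in>C. v e *s e)"
          unfolding v by (rule sum.subset_diff) (use E finE in auto)
        moreover have "(\<Sum>e\<in>C. v e *s e) \<in> B"
          using C(2) B(1) by (auto intro!: subspace_sum subspace_scale)
        ultimately have "(+) x ` B = (+) (\<Sum>a<d. ?c a *s z a) ` B" by (intro coset') simp
        then show "X \<in> (\<lambda>c. (+) (\<Sum>a<d. c a *s z a) ` B) ` ({..<d} \<rightarrow>\<^sub>E UNIV)"
          using x by (intro image_eqI[of _ _ ?c]) (auto simp del: restrict_apply)
      qed
    qed
  qed
  moreover have "z ` {..<d} \<subseteq> Z" using z E by (auto simp: bij_betw_def)
  ultimately have ex: "\<exists>z. z ` {..<d} \<subseteq> Z \<and>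
      bij_betw (\<lambda>c. (+) (\<Sum>a<d. c a *s z a) ` B) ({..<d} \<rightarrow>\<^sub>E UNIV) (quotient_space Z B)"
    by blast
  have uniq: "d' = local.dim Z - local.dim B" if "\<exists>z. z ` {..<d'} \<subseteq> Z \<and>
      bij_betw (\<lambda>c. (+) (\<Sum>a<d'. c a *s z a) ` B) ({..<d'} \<rightarrow>\<^sub>E UNIV) (quotient_space Z B)" for d'
    using that quotient_basis_dim[OF Z B] by fastforce
  have "quotient_dim scale Z B = d"
    unfolding quotient_dim_def
  proof (rule the_equality)
    fix d' :: nat assume "\<exists>z. z ` {..<d'} \<subseteq> Z \<and>
      bij_betw (\<lambda>c. (+) (\<Sum>a<d'. c a *s z a) ` B) ({..<d'} \<rightarrow>\<^sub>E UNIV) (quotient_space Z B)"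
    then show "d' = d" by (rule trans[OF uniq uniq[OF ex, symmetric]])
  qed (rule ex)
  then show ?thesis using ex quotient_basis_dim[OF Z B] by blast
qed

lemma separating_functional:
  assumes "local.subspace U" "w \<notin> U"
  obtains \<phi> where "Vector_Spaces.linear scale (*) \<phi>" "\<And>u. u \<in> U \<Longrightarrow> \<phi> u = 0" "\<phi> w = 1"
proof -
  interpret vector_space_pair scale "(*) :: 'a \<Rightarrow> 'a \<Rightarrow> 'a"
    by (intro vector_space_pair.intro vector_space_axioms vector_space_times)
  obtain B where B: "B \<subseteq> U" "local.independent B" "U \<subseteq> local.span B" by (rule basis_exists)
  have "local.span B \<subseteq> U" using B assms span_minimal by blast
  then have "w \<notin> local.span B" using assms by blast
  then have "local.independent (insert w B)" using B independent_insertI by blast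
  then obtain \<phi> where \<phi>: "Vector_Spaces.linear scale (*) \<phi>"
      "\<forall>x\<in>insert w B. \<phi> x = (if x = w then 1 else 0)"
    using linear_independent_extend[of "insert w B" "\<lambda>x. if x = w then 1 else 0"] by blast
  have "w \<notin> B" using \<open>w \<notin> span B\<close> span_base by blast
  then have "\<phi> b = 0" if "b \<in> B" for b using \<phi>(2) that by auto
  then have "\<phi> u = 0" if "u \<in> U" for u
    using linear_eq_0_on_span[OF \<phi>(1)] B that by blast
  with \<phi> show ?thesis using that by auto
qed

end

context vector_space_pair
begin

lemma rank_nullity:
  assumes f: "Vector_Spaces.linear s1 s2 f" and S: "vs1.subspace S" "vs1.fin_dim S"
  shows "vs1.dim S = vs1.dim {x \<in> S. f x = 0} + vs2.dim (f ` S)"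
proof -
  let ?K = "{x \<in> S. f x = 0}"
  interpret f: Vector_Spaces.linear s1 s2 f by (rule f)
  have "vs1.fin_dim ?K" by (rule vs1.fin_dim_subset[OF S(2)]) simp
  then obtain C where C: "finite C" "C \<subseteq> ?K" "vs1.independent C" "?K \<subseteq> vs1.span C" "card C = vs1.dim ?K"
    by (rule vs1.fin_dim_basis)
  obtain E where E: "C \<subseteq> E" "E \<subseteq> S" "vs1.independent E" "S \<subseteq> vs1.span E"
    using vs1.maximal_independent_subset_extend[of C S] C by blast
  obtain M where M: "finite M" "S \<subseteq> vs1.span M" using S unfolding vs1.fin_dim_def by blast
  have "E \<subseteq> vs1.span M" using E(2) M(2) by (rule subset_trans)
  then have finE: "finite E" using vs1.independent_span_bound[of M E] M E by simp
  have sub: "(\<Sum>e\<in>E. v e) = (\<Sum>e\<in>E - C. v e) + (\<Sum>e\<in>C. v e)" for v :: "'b \<Rightarrow> 'b"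
    by (rule sum.subset_diff) (use E finE in auto)
  have "vs2.dim (f ` S) = card (E - C)"
  proof (rule vs2.dim_family[where f = f])
    show "finite (E - C)" using finE by simp
    fix c assume "(\<Sum>i\<in>E - C. s2 (c i) (f i)) = 0"
    then have "f (\<Sum>i\<in>E - C. s1 (c i) i) = 0" by (simp add: f.sum f.scale)
    moreover have "(\<Sum>i\<in>E - C. s1 (c i) i) \<in> S"
      using E S by (intro vs1.subspace_sum vs1.subspace_scale) auto
    ultimately have "(\<Sum>i\<in>E - C. s1 (c i) i) \<in> vs1.span C" using C by blast
    then obtain v where v: "(\<Sum>e\<in>E - C. s1 (c e) e) = (\<Sum>x\<in>C. s1 (v x) x)"
      using vs1.span_finite[OF C(1)] by auto
    let ?w = "\<lambda>e. if e \<in> C then - v e else c e"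
    have "(\<Sum>e\<in>E. s1 (?w e) e) = 0" using v by (simp add: sub sum_negf)
    then have "?w e = 0" if "e \<in> E" for e
      using vs1.independent_sum_zero[OF finE E(3), of ?w] that by blast
    then show "\<forall>i\<in>E - C. c i = 0" by (metis DiffE)
  next
    show "f ` (E - C) \<subseteq> f ` S" using E by auto
    show "f ` S \<subseteq> vs2.span (f ` (E - C))"
    proof
      fix y assume "y \<in> f ` S"
      then obtain x where x: "x \<in> S" "y = f x" by blast
      obtain v where v: "x = (\<Sum>e\<in>E. s1 (v e) e)" using x E(4) vs1.span_finite[OF finE] by auto
      have "f (\<Sum>e\<in>C. s1 (v e) e) = 0" using C(2) by (auto simp: f.sum f.scale intro!: sum.neutral)
      then have "y = (\<Sum>e\<in>E - C. s2 (v e) (f e))"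
        unfolding x v sub by (simp add: f.add f.sum f.scale)
      then show "y \<in> vs2.span (f ` (E - C))"
        by (simp only:) (intro vs2.span_sum vs2.span_scale vs2.span_base imageI)
    qed
  qed
  moreover have "vs1.dim S = card E" using E vs1.basis_card_eq_dim by metis
  moreover have "card E = card (E - C) + card C"
    using E finE by (metis C(1) card_Diff_subset card_mono le_add_diff_inverse2)
  ultimately show ?thesis using C(5) by simp
qed

end

section \<open>Degenerate families of polynomial vectors\<close>

text \<open>Fraction-free Gaussian elimination: cross-multiplying with a pivot in row
  \<open>p\<close> removes that row and doubles the degree bound, whence \<open>2 ^ p\<close>. The
  summand \<open>d\<close> beside \<open>degree (u i)\<close> leaves room for one more factor when a
  relation is lifted back. The column set \<open>A\<close> may be infinite, since only the number of
  rows enters.\<close>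

lemma polynomial_kernel:
  fixes c :: "nat \<Rightarrow> 'a \<Rightarrow> 'k::field poly"
  assumes "\<And>i a. i < p \<Longrightarrow> a \<in> A \<Longrightarrow> degree (c i a) \<le> d"
    and "infinite {x. \<exists>y. (\<exists>i<p. y i \<noteq> 0) \<and> (\<forall>a\<in>A. (\<Sum>i<p. y i * poly (c i a) x) = 0)}"
  shows "\<exists>u. (\<exists>i<p. u i \<noteq> 0) \<and> (\<forall>i<p. degree (u i) + d \<le> 2 ^ p * d) \<and>
    (\<forall>a\<in>A. (\<Sum>i<p. u i * c i a) = 0)"
  using assms
proof (induction p arbitrary: c d)
  case 0
  then show ?case by simp
next
  case (Suc p)
  show ?case
  proof (cases "\<forall>a\<in>A. c p a = 0")
    case True
    then show ?thesis
      by (intro exI[of _ "\<lambda>i. if i = p then 1 else 0"]) (auto simp: if_distrib cong: if_cong)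
  next
    case False
    then obtain a0 where a0: "a0 \<in> A" "c p a0 \<noteq> 0" by blast
    define f where "f = c p a0"
    define c' where "c' i a = f * c i a - c i a0 * c p a" for i a
    let ?bad = "\<lambda>p c. {x. \<exists>y. (\<exists>i<p. y i \<noteq> 0) \<and> (\<forall>a\<in>A. (\<Sum>i<p. y i * poly (c i a) x) = 0)}"
    have deg: "degree (c' i a) \<le> 2 * d" if "i < p" "a \<in> A" for i a
    proof -
      have "degree (f * c i a) \<le> d + d" "degree (c i a0 * c p a) \<le> d + d"
        using that a0 Suc.prems(1) unfolding f_def
        by (auto intro!: order_trans[OF degree_mult_le] add_mono)
      then show ?thesis unfolding c'_def by (intro degree_diff_le) auto
    qed
    \<comment> \<open>Away from the roots of the pivot \<open>f\<close>, a dependency of the old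
      rows restricts to a nontrivial dependency of the reduced ones: if only row \<open>p\<close>
      had a nonzero coefficient, column \<open>a0\<close> would force \<open>f\<close> to vanish at
      \<open>x\<close>.\<close>
    have "?bad (Suc p) c - {x. poly f x = 0} \<subseteq> ?bad p c'"
    proof
      fix x assume x: "x \<in> ?bad (Suc p) c - {x. poly f x = 0}"
      then obtain y where y: "\<exists>i<Suc p. y i \<noteq> 0"
          "\<And>a. a \<in> A \<Longrightarrow> (\<Sum>i<p. y i * poly (c i a) x) = - (y p * poly (c p a) x)"
        by (auto simp: eq_neg_iff_add_eq_0)
      have "\<exists>i<p. y i \<noteq> 0"
      proof (rule ccontr)
        assume "\<not> (\<exists>i<p. y i \<noteq> 0)"
        then show False using y(1) y(2)[OF a0(1)] x by (auto simp: f_def less_Suc_eq)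
      qed
      moreover have "(\<Sum>i<p. y i * poly (c' i a) x) = 0" if "a \<in> A" for a
      proof -
        have "(\<Sum>i<p. y i * poly (c' i a) x) =
            poly f x * (\<Sum>i<p. y i * poly (c i a) x) - poly (c p a) x * (\<Sum>i<p. y i * poly (c i a0) x)"
          by (simp add: c'_def sum_distrib_left right_diff_distrib sum_subtractf mult_ac)
        also have "\<dots> = 0" using y(2)[OF that] y(2)[OF a0(1)] by (simp add: f_def)
        finally show ?thesis .
      qed
      ultimately show "x \<in> ?bad p c'" by blast
    qed
    moreover have "finite {x. poly f x = 0}" using a0 by (simp add: f_def poly_roots_finite)
    ultimately have "infinite (?bad p c')"
      using Suc.prems(2) by (meson Diff_infinite_finite finite_subset)
    then obtain u where u: "\<exists>i<p. u i \<noteq> 0" "\<And>i. i < p \<Longrightarrow> degree (u i) + 2 * d \<le> 2 ^ p * (2 * d)"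
        "\<And>a. a \<in> A \<Longrightarrow> (\<Sum>i<p. u i * c' i a) = 0"
      using Suc.IH[of c' "2 * d"] deg by blast
    \<comment> \<open>Back substitution: the relation is scaled by the pivot, and the coefficient of
      row \<open>p\<close> is then forced by column \<open>a0\<close> without any division.\<close>
    define v where "v i = (if i < p then f * u i else - (\<Sum>i<p. u i * c i a0))" for i
    have f: "f \<noteq> 0" "degree f \<le> d" using a0 Suc.prems(1) by (auto simp: f_def)
    have "degree (v i) + d \<le> 2 ^ Suc p * d" if "i < Suc p" for i
    proof (cases "i < p")
      case True
      then have "degree (v i) \<le> degree f + degree (u i)" by (simp add: v_def degree_mult_le)
      then show ?thesis using u(2)[OF True] f by simp
    next
      case False
      have "degree (u j * c j a0) \<le> 2 ^ Suc p * d - d" if "j < p" for j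
      proof -
        have "degree (u j * c j a0) \<le> degree (u j) + degree (c j a0)" by (rule degree_mult_le)
        moreover have "degree (c j a0) \<le> d" using Suc.prems(1) a0 that by simp
        ultimately show ?thesis using u(2)[OF that] by simp
      qed
      then have "degree (v i) \<le> 2 ^ Suc p * d - d"
        using False by (auto simp: v_def intro: degree_sum_le)
      moreover have "d \<le> 2 ^ Suc p * d" using mult_le_mono1[of 1 "2 ^ Suc p" d] by simp
      ultimately show ?thesis by linarith
    qed
    moreover have "\<exists>i<Suc p. v i \<noteq> 0" using u(1) f by (auto simp: v_def less_Suc_eq)
    moreover have "(\<Sum>i<Suc p. v i * c i a) = 0" if "a \<in> A" for a
    proof -
      have "(\<Sum>i<Suc p. v i * c i a) = (\<Sum>i<p. u i * c' i a)"
        by (simp add: v_def c'_def f_def sum_distrib_left sum_distrib_right right_diff_distrib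
            sum_subtractf mult_ac)
      then show ?thesis using u(3)[OF that] by simp
    qed
    ultimately show ?thesis by blast
  qed
qed

section \<open>Koszul complexes of commuting operators\<close>

text \<open>These lists label the standard basis of an exterior algebra.\<close>

definition chains :: "nat \<Rightarrow> nat \<Rightarrow> nat list set"
  where "chains m n = {as. sorted_wrt (<) as \<and> set as \<subseteq> {m..<n}}"

lemma Nil_in_chains [simp]: "[] \<in> chains m n"
  by (simp add: chains_def)

lemma Cons_in_chains [simp]: "a # as \<in> chains m n \<longleftrightarrow> m \<le> a \<and> a < n \<and> as \<in> chains (Suc a) n"
  by (auto simp: chains_def Suc_le_eq)

lemma chains_mono: "as \<in> chains m' n \<Longrightarrow> m \<le> m' \<Longrightarrow> as \<in> chains m n"
  by (force simp: chains_def)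

lemma chains_SucD: "as \<in> chains (Suc a) n \<Longrightarrow> m \<le> a \<Longrightarrow> as \<in> chains m n"
  by (erule chains_mono) simp

lemma chains_Suc: "as \<in> chains (Suc m) n \<longleftrightarrow> as \<in> chains m n \<and> m \<notin> set as"
  by (auto simp: chains_def Suc_le_eq order_less_le)

text \<open>An abstraction of the contractions with \<open>n\<close> vectors on the spaces
  \<open>g t\<close>; dually, a graded module over polynomials in \<open>n\<close> variables.
  Commutation is asked only on \<open>W t\<close>, since contractions of functions that are not
  symmetric do not commute in general.\<close>

locale koszul_system = vector_space scale
  for scale :: "'k::field \<Rightarrow> 'm::ab_group_add \<Rightarrow> 'm" +
  fixes D :: "nat \<Rightarrow> 'm \<Rightarrow> 'm" and W :: "nat \<Rightarrow> 'm set" and n :: nat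
  assumes subspace_W: "local.subspace (W t)"
    and fin_dim_W: "local.fin_dim (W t)"
    and linear_D: "a < n \<Longrightarrow> Vector_Spaces.linear scale scale (D a)"
    and D_in_W: "a < n \<Longrightarrow> w \<in> W (Suc t) \<Longrightarrow> D a w \<in> W t"
    and D_commute: "a < n \<Longrightarrow> b < n \<Longrightarrow> w \<in> W t \<Longrightarrow> D a (D b w) = D b (D a w)"
begin

lemma D_0: "a < n \<Longrightarrow> D a 0 = 0"
  and D_diff: "a < n \<Longrightarrow> D a (x - y) = D a x - D a y"
  and D_add: "a < n \<Longrightarrow> D a (x + y) = D a x + D a y"
  and D_scale: "a < n \<Longrightarrow> D a (scale r x) = scale r (D a x)"
  using linear_D[of a] module_hom.zero module_hom.diff module_hom.add module_hom.scale
  by (auto simp: module_hom_iff_linear[symmetric] simp del: module_hom_iff_linear)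

text \<open>
  The recursion unfolds to the alternating sum over \<open>l\<close> of \<open>(-1)\<^sup>l\<close> times \<open>D (as ! l)\<close>, applied to the
  value of \<open>c\<close> at \<open>as\<close> without its \<open>l\<close>-th entry.
\<close>

fun koszul :: "(nat list \<Rightarrow> 'm) \<Rightarrow> nat list \<Rightarrow> 'm" where
  "koszul c [] = 0"
| "koszul c (a # as) = D a (c as) - koszul (\<lambda>bs. c (a # bs)) as"

text \<open>The free choice of \<open>U\<close> and \<open>V\<close> lets one induction serve for
  the graded pieces, for the successive kernels and for the kernel of a functional.\<close>

lemma koszul_mem:
  assumes "local.subspace U" and "\<And>a w. m \<le> a \<Longrightarrow> a < n \<Longrightarrow> w \<in> V \<Longrightarrow> D a w \<in> U"
    and "as \<in> chains m n" and "\<And>bs. bs \<in> chains m n \<Longrightarrow> Suc (length bs) = length as \<Longrightarrow> c bs \<in> V"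
  shows "koszul c as \<in> U"
  using assms(2-)
proof (induction as arbitrary: m c)
  case Nil
  then show ?case using assms(1) subspace_0 by simp
next
  case (Cons a as)
  have "koszul (\<lambda>bs. c (a # bs)) as \<in> U"
    using Cons.prems by (intro Cons.IH[of "Suc a"]) auto
  moreover have "D a (c as) \<in> U"
    using Cons.prems(2) by (intro Cons.prems(1) Cons.prems(3)) (auto intro: chains_mono)
  ultimately show ?case using assms(1) subspace_diff by simp
qed

lemma koszul_cong:
  assumes "as \<in> chains m n" and "\<And>bs. bs \<in> chains m n \<Longrightarrow> Suc (length bs) = length as \<Longrightarrow> c bs = c' bs"
  shows "koszul c as = koszul c' as"
  using assms
proof (induction as arbitrary: m c c')
  case (Cons a as)
  have "koszul (\<lambda>bs. c (a # bs)) as = koszul (\<lambda>bs. c' (a # bs)) as"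
    using Cons.prems by (intro Cons.IH[of "Suc a"]) auto
  moreover have "c as = c' as" using Cons.prems by (auto dest: chains_SucD)
  ultimately show ?case by simp
qed simp

lemma koszul_diff:
  "as \<in> chains m n \<Longrightarrow> koszul (\<lambda>bs. c bs - c' bs) as = koszul c as - koszul c' as"
  by (induction as arbitrary: m c c') (auto simp: D_diff)

lemma koszul_zero: "as \<in> chains m n \<Longrightarrow> koszul (\<lambda>bs. 0) as = 0"
  by (induction as arbitrary: m) (auto simp: D_0)

lemma koszul_scale:
  "as \<in> chains m n \<Longrightarrow> koszul (\<lambda>bs. scale r (c bs)) as = scale r (koszul c as)"
  by (induction as arbitrary: m c) (auto simp: D_scale scale_right_diff_distrib)

lemma koszul_D:
  assumes "b < n" "as \<in> chains m n"
    and "\<And>bs. bs \<in> chains m n \<Longrightarrow> Suc (length bs) = length as \<Longrightarrow> c bs \<in> W t"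
  shows "koszul (\<lambda>bs. D b (c bs)) as = D b (koszul c as)"
  using assms(2-)
proof (induction as arbitrary: m c)
  case (Cons a as)
  have "koszul (\<lambda>bs. D b (c (a # bs))) as = D b (koszul (\<lambda>bs. c (a # bs)) as)"
    using Cons.prems by (intro Cons.IH[of "Suc a"]) auto
  moreover have "D a (D b (c as)) = D b (D a (c as))"
    using Cons.prems assms(1) by (intro D_commute[of _ _ _ t]) (auto dest: chains_SucD)
  ultimately show ?case using assms(1) by (simp add: D_diff)
qed (use assms(1) in \<open>simp add: D_0\<close>)

text \<open>Unfolding both differentials at the head \<open>a\<close> gives the term
  \<open>D a (koszul c as)\<close> twice, once through \<open>koszul_D\<close>; the two cancel and
  leave the double differential of \<open>\<lambda>bs. c (a # bs)\<close> on a shorter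
  chain.\<close>

lemma koszul_koszul:
  assumes "as \<in> chains m n"
    and "\<And>bs. bs \<in> chains m n \<Longrightarrow> Suc (Suc (length bs)) = length as \<Longrightarrow> c bs \<in> W t"
  shows "koszul (koszul c) as = 0"
  using assms
proof (induction as arbitrary: m c)
  case (Cons a as)
  have as: "as \<in> chains (Suc a) n" "a < n" using Cons.prems by auto
  have "koszul (koszul (\<lambda>bs. c (a # bs))) as = 0"
    using Cons.prems by (intro Cons.IH[of "Suc a"]) auto
  moreover have "koszul (\<lambda>bs. D a (c bs)) as = D a (koszul c as)"
    using Cons.prems by (intro koszul_D[of _ _ "Suc a" _ t]) (auto dest: chains_SucD)
  ultimately show ?case by (simp add: koszul_diff[OF as(1)])
qed simp

section \<open>Successive kernels and exactness of the remaining Koszul complexes\<close>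

definition ker_upto :: "nat \<Rightarrow> nat \<Rightarrow> 'm set"
  where "ker_upto m t = {w \<in> W t. \<forall>a<m. D a w = 0}"

text \<open>This is exactness for the operators \<open>D m\<close>, ..., \<open>D (n - 1)\<close> in
  positive exterior degree \<open>Suc j\<close>. In the top degree \<open>Suc j = n - m\<close> the
  closedness condition is vacuous, so exactness there says that the images of these operators
  together span the kernel in degree \<open>t\<close>.\<close>

definition exact_at :: "nat \<Rightarrow> nat \<Rightarrow> bool"
  where "exact_at m t \<longleftrightarrow> (\<forall>j c.
    (\<forall>as\<in>chains m n. length as = Suc j \<longrightarrow> c as \<in> ker_upto m t) \<longrightarrow>
    (\<forall>as\<in>chains m n. length as = Suc (Suc j) \<longrightarrow> koszul c as = 0) \<longrightarrow>
    (\<exists>c'. (\<forall>as\<in>chains m n. length as = j \<longrightarrow> c' as \<in> ker_upto m (Suc t)) \<and>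
      (\<forall>as\<in>chains m n. length as = Suc j \<longrightarrow> koszul c' as = c as)))"

definition surj_at :: "nat \<Rightarrow> nat \<Rightarrow> bool"
  where "surj_at m t \<longleftrightarrow> ker_upto m t \<subseteq> D m ` ker_upto m (Suc t)"

lemma subspace_ker_upto: "m \<le> n \<Longrightarrow> local.subspace (ker_upto m t)"
  using subspace_W[of t] unfolding subspace_def ker_upto_def
  by (auto simp: D_0 D_add D_scale)

lemma fin_dim_ker_upto: "local.fin_dim (ker_upto m t)"
  by (rule fin_dim_subset[OF fin_dim_W[of t]]) (auto simp: ker_upto_def)

lemma D_in_ker_upto:
  assumes "m \<le> n" "a < n" "w \<in> ker_upto m (Suc t)"
  shows "D a w \<in> ker_upto m t"
proof -
  have "D b (D a w) = 0" if "b < m" for b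
    using assms that D_commute[of b a w "Suc t"] D_0[of a] by (auto simp: ker_upto_def)
  then show ?thesis using assms D_in_W by (auto simp: ker_upto_def)
qed

lemma ker_upto_subset: "ker_upto m t \<subseteq> W t"
  by (auto simp: ker_upto_def)

lemma ker_upto_Suc: "w \<in> ker_upto (Suc m) t \<longleftrightarrow> w \<in> ker_upto m t \<and> D m w = 0"
  by (auto simp: ker_upto_def less_Suc_eq)

text \<open>The classical passage to the kernel of a surjective operator. A cochain on the smaller
  kernels, extended by zero, has a primitive \<open>\<eta>\<close> on the larger ones; surjectivity
  of \<open>D m\<close> corrects \<open>\<eta>\<close> to a primitive with values killed by
  \<open>D m\<close>. The values of \<open>\<eta>\<close> have degree \<open>Suc t\<close> and must
  be lifted through \<open>D m\<close>, which is why surjectivity is assumed there.\<close>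

lemma exact_at_Suc:
  assumes "m < n" and exact: "exact_at m t" and surj: "surj_at m (Suc t)"
  shows "exact_at (Suc m) t"
  unfolding exact_at_def
proof (intro allI impI)
  fix j c
  assume c: "\<forall>as\<in>chains (Suc m) n. length as = Suc j \<longrightarrow> c as \<in> ker_upto (Suc m) t"
    and closed: "\<forall>as\<in>chains (Suc m) n. length as = Suc (Suc j) \<longrightarrow> koszul c as = 0"
  \<comment> \<open>The extension by zero stays closed: on chains starting with \<open>m\<close> the
    only term that could survive is \<open>D m\<close> of a value of \<open>c\<close>, which is
    zero.\<close>
  define c0 where "c0 as = (if m \<in> set as then 0 else c as)" for as
  have ker_0: "0 \<in> ker_upto m t" for t
    using subspace_ker_upto[of m t] \<open>m < n\<close> subspace_0 by simp
  have c0_ker: "c0 as \<in> ker_upto m t" if "as \<in> chains m n" "length as = Suc j" for as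
    using that c ker_0 by (auto simp: c0_def chains_Suc ker_upto_Suc)
  have c0_eq: "koszul c0 as = koszul c as" if "as \<in> chains (Suc m) n" for as
    by (rule koszul_cong[OF that]) (auto simp: c0_def chains_Suc)
  have c0_closed: "koszul c0 as = 0" if as: "as \<in> chains m n" "length as = Suc (Suc j)" for as
  proof (cases "m \<in> set as")
    case False
    then have "as \<in> chains (Suc m) n" using as by (simp add: chains_Suc)
    then show ?thesis using c0_eq closed as by simp
  next
    case True
    then obtain as' where [simp]: "as = m # as'"
      using as by (cases as) (auto simp: chains_def)
    have "as' \<in> chains (Suc m) n" using as by simp
    then have "c0 as' \<in> ker_upto (Suc m) t" using c as by (simp add: c0_def chains_Suc)
    then show ?thesis using as koszul_zero[OF \<open>as' \<in> chains (Suc m) n\<close>]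
      by (simp add: ker_upto_Suc) (simp add: c0_def)
  qed
  from exact[unfolded exact_at_def, rule_format, of j c0] c0_ker c0_closed
  obtain \<eta> where \<eta>: "\<And>as. as \<in> chains m n \<Longrightarrow> length as = j \<Longrightarrow> \<eta> as \<in> ker_upto m (Suc t)"
    "\<And>as. as \<in> chains m n \<Longrightarrow> length as = Suc j \<Longrightarrow> koszul \<eta> as = c0 as" by blast
  \<comment> \<open>\<open>\<zeta>\<close> lifts through \<open>D m\<close> the components of
    \<open>\<eta>\<close> on chains that start with \<open>m\<close>.\<close>
  define \<zeta> where "\<zeta> as = (SOME w. w \<in> ker_upto m (Suc (Suc t)) \<and> D m w = \<eta> (m # as))" for as
  have \<zeta>: "\<zeta> as \<in> ker_upto m (Suc (Suc t)) \<and> D m (\<zeta> as) = \<eta> (m # as)"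
    if "as \<in> chains (Suc m) n" "Suc (length as) = j" for as
  proof -
    have "\<eta> (m # as) \<in> ker_upto m (Suc t)" using \<eta>(1) that \<open>m < n\<close> by simp
    then have "\<exists>w. w \<in> ker_upto m (Suc (Suc t)) \<and> D m w = \<eta> (m # as)"
      using surj unfolding surj_at_def by force
    then show ?thesis unfolding \<zeta>_def by (rule someI_ex)
  qed
  have \<zeta>_W: "\<zeta> as \<in> W (Suc (Suc t))" if "as \<in> chains (Suc m) n" "Suc (length as) = j" for as
    using \<zeta>[OF that] ker_upto_subset by blast
  \<comment> \<open>Since \<open>koszul \<eta>\<close> vanishes on chains starting with
    \<open>m\<close>, \<open>D m (\<eta> as)\<close> is the differential of those components.
    Subtracting the exact term \<open>koszul \<zeta>\<close> cancels it and does not change the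
    differential of \<open>\<eta>\<close>.\<close>
  define \<eta>' where "\<eta>' as = \<eta> as - koszul \<zeta> as" for as
  have "\<eta>' as \<in> ker_upto (Suc m) (Suc t)" if as: "as \<in> chains (Suc m) n" "length as = j" for as
  proof -
    have as_m: "as \<in> chains m n" using as chains_mono by force
    have "koszul \<zeta> as \<in> ker_upto m (Suc t)"
      using \<zeta> as \<open>m < n\<close>
      by (intro koszul_mem[where V = "ker_upto m (Suc (Suc t))", OF _ _ as(1)])
        (auto intro: subspace_ker_upto D_in_ker_upto)
    then have "\<eta>' as \<in> ker_upto m (Suc t)"
      using \<eta>(1) as as_m subspace_ker_upto[of m "Suc t"] \<open>m < n\<close> subspace_diff by (simp add: \<eta>'_def)
    moreover have "D m (koszul \<zeta> as) = koszul (\<lambda>bs. D m (\<zeta> bs)) as"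
      by (rule koszul_D[symmetric, OF _ as(1)]) (use \<open>m < n\<close> \<zeta>_W as in auto)
    moreover have "\<dots> = koszul (\<lambda>bs. \<eta> (m # bs)) as"
      by (rule koszul_cong[OF as(1)]) (use \<zeta> as in simp)
    moreover have "koszul \<eta> (m # as) = 0"
      using \<eta>(2)[of "m # as"] as \<open>m < n\<close> by (simp add: c0_def)
    ultimately show ?thesis using \<open>m < n\<close> by (simp add: ker_upto_Suc \<eta>'_def D_diff)
  qed
  moreover have "koszul \<eta>' as = c as" if as: "as \<in> chains (Suc m) n" "length as = Suc j" for as
  proof -
    have "koszul \<eta>' as = koszul \<eta> as - koszul (koszul \<zeta>) as"
      unfolding \<eta>'_def by (rule koszul_diff[OF as(1)])
    also have "koszul (koszul \<zeta>) as = 0" by (rule koszul_koszul[OF as(1)]) (use \<zeta>_W as in auto)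
    also have "koszul \<eta> as = c as" using \<eta>(2)[of as] as by (simp add: c0_def chains_Suc)
    finally show ?thesis by simp
  qed
  ultimately show "\<exists>c'. (\<forall>as\<in>chains (Suc m) n. length as = j \<longrightarrow> c' as \<in> ker_upto (Suc m) (Suc t)) \<and>
      (\<forall>as\<in>chains (Suc m) n. length as = Suc j \<longrightarrow> koszul c' as = c as)" by blast
qed

text \<open>Exactness in the top exterior degree \<open>n - m\<close> writes each element of the
  kernel as a signed sum of values \<open>D a u\<close> with \<open>m \<le> a\<close> and
  \<open>a < n\<close>, and \<open>\<phi>\<close> kills all of them.\<close>

lemma functional_zero:
  assumes "m < n" "exact_at m t" and \<phi>: "Vector_Spaces.linear scale (*) \<phi>"
    and kill: "\<And>a w. m \<le> a \<Longrightarrow> a < n \<Longrightarrow> w \<in> ker_upto m (Suc t) \<Longrightarrow> \<phi> (D a w) = 0"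
    and "w \<in> ker_upto m t"
  shows "\<phi> w = 0"
proof -
  interpret \<phi>: Vector_Spaces.linear scale "(*)" \<phi> by (rule \<phi>)
  have long: "length as \<le> n - m" if "as \<in> chains m n" for as
  proof -
    have "length as = card (set as)"
      using that by (simp add: chains_def strict_sorted_iff distinct_card)
    also have "\<dots> \<le> card {m..<n}" using that by (intro card_mono) (auto simp: chains_def)
    finally show ?thesis by simp
  qed
  \<comment> \<open>No chain has length \<open>n - m + 1\<close>, so the constant cochain
    \<open>w\<close> in top degree is closed.\<close>
  have no_long: "length as \<noteq> Suc (Suc (n - m - 1))" if "as \<in> chains m n" for as
    using long[OF that] \<open>m < n\<close> by linarith
  have "\<exists>c'. (\<forall>as\<in>chains m n. length as = n - m - 1 \<longrightarrow> c' as \<in> ker_upto m (Suc t)) \<and>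
      (\<forall>as\<in>chains m n. length as = Suc (n - m - 1) \<longrightarrow> koszul c' as = w)"
    by (rule assms(2)[unfolded exact_at_def, rule_format]) (use assms(5) no_long in blast)+
  moreover have "Suc (n - m - 1) = n - m" using \<open>m < n\<close> by simp
  ultimately obtain c' where
    c': "\<And>as. as \<in> chains m n \<Longrightarrow> length as = n - m - 1 \<Longrightarrow> c' as \<in> ker_upto m (Suc t)"
      "\<And>as. as \<in> chains m n \<Longrightarrow> length as = n - m \<Longrightarrow> koszul c' as = w" by metis
  have top: "[m..<n] \<in> chains m n" by (simp add: chains_def)
  have "koszul c' [m..<n] \<in> {x. \<phi> x = 0}"
    using kill c' by (intro koszul_mem[OF _ _ top, where V = "ker_upto m (Suc t)"])
      (auto simp: subspace_def \<phi>.add \<phi>.scale)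
  then show ?thesis using c'(2)[OF top] by simp
qed

text \<open>
  A polynomial family \<open>\<Sum>\<^sub>l x\<^sup>l \<phi>\<^sub>l\<close> killed by \<open>\<Sum>\<^sub>i x\<^sup>i D\<^bsub>m+i\<^esub>\<close> vanishes (as in McCoy's theorem on
  zero divisors): if \<open>i\<close> is minimal such that \<open>D\<^bsub>m+i\<^esub>\<close> does not kill the family, then composing with
  \<open>D\<^bsub>m+i\<^esub>\<close> kills its lowest coefficient, so the order \<open>v\<close> in \<open>x\<close> increases.
\<close>

lemma functional_family_zero:
  assumes "m < n" and "\<And>l. Vector_Spaces.linear scale (*) (\<phi> l)"
    and "\<And>l w. l < v \<Longrightarrow> w \<in> ker_upto m t \<Longrightarrow> \<phi> l w = 0"
    and "\<And>l w. d \<le> l \<Longrightarrow> w \<in> ker_upto m t \<Longrightarrow> \<phi> l w = 0"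
    and "\<And>s w. w \<in> ker_upto m (Suc t) \<Longrightarrow>
      (\<Sum>i\<le>s. if m + i < n then \<phi> (s - i) (D (m + i) w) else 0) = 0"
    and "\<And>t'. t \<le> t' \<Longrightarrow> t' < t + (d - v) \<Longrightarrow> exact_at m t'"
    and "w \<in> ker_upto m t"
  shows "\<phi> l w = 0"
  using assms(2-)
proof (induction "d - v" arbitrary: \<phi> v t l w)
  case 0
  show ?case
  proof (cases "l < v")
    case True
    then show ?thesis by (rule "0.prems"(2)) (rule "0.prems"(6))
  next
    case False
    then have "d \<le> l" using "0.hyps" by simp
    then show ?thesis by (rule "0.prems"(3)) (rule "0.prems"(6))
  qed
next
  case (Suc r)
  have "v < d" using Suc.hyps(2) by simp
  \<comment> \<open>The indices \<open>i\<close> are treated in increasing order, so that the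
    \<open>D (m + j)\<close> with \<open>j < i\<close> already kill the whole family.\<close>
  have kill: "\<phi> l (D (m + i) w) = 0" if "m + i < n" "w \<in> ker_upto m (Suc t)" for i l w
    using that
  proof (induction i arbitrary: l w rule: less_induct)
    case (less i)
    have lin: "Vector_Spaces.linear scale (*) (\<lambda>w. \<phi> l (D (m + i) w))" for l
      using Vector_Spaces.linear_compose[OF linear_D[OF less.prems(1)] Suc.prems(1)] by (simp add: o_def)
    have low: "\<phi> l (D (m + i) w) = 0" if "l < Suc v" "w \<in> ker_upto m (Suc t)" for l w
    proof (cases "l < v")
      case True
      then show ?thesis using Suc.prems(2) D_in_ker_upto less.prems(1) that by simp
    next
      case False
      \<comment> \<open>In the relation of index \<open>v + i\<close>, terms with
        \<open>j < i\<close> vanish by the inner induction, and those with \<open>j > i\<close>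
        involve a functional of index below \<open>v\<close>; only
        \<open>\<phi> v (D (m + i) w)\<close> remains.\<close>
      have "0 = (\<Sum>j\<le>v + i. if m + j < n then \<phi> (v + i - j) (D (m + j) w) else 0)"
        using Suc.prems(4) that by simp
      also have "\<dots> = (\<Sum>j\<in>{i}. if m + j < n then \<phi> (v + i - j) (D (m + j) w) else 0)"
      proof (rule sum.mono_neutral_right, goal_cases)
        case 3
        show ?case
        proof
          fix j assume j: "j \<in> {..v + i} - {i}"
          show "(if m + j < n then \<phi> (v + i - j) (D (m + j) w) else 0) = 0"
          proof (cases "j < i")
            case True
            then show ?thesis using less.IH[of j] that by simp
          next
            case False
            then have "v + i - j < v" using j by auto
            then show ?thesis using Suc.prems(2) D_in_ker_upto[of m "m + j" w t] that \<open>m < n\<close> by simp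
          qed
        qed
      qed auto
      also have "\<dots> = \<phi> l (D (m + i) w)" using less.prems(1) False that by (simp add: less_Suc_eq)
      finally show ?thesis by simp
    qed
    \<comment> \<open>Composed with \<open>D (m + i)\<close>, the family acts one degree higher but
      starts at index \<open>v + 1\<close>. Thus \<open>d - v\<close> drops by one, and the degrees
      in which exactness is needed stay within the given range.\<close>
    show ?case
    proof (rule Suc.hyps(1)[where \<phi> = "\<lambda>l w. \<phi> l (D (m + i) w)" and v = "Suc v" and t = "Suc t"])
      show "r = d - Suc v" using Suc.hyps(2) by simp
      show "\<phi> l (D (m + i) w) = 0" if "d \<le> l" "w \<in> ker_upto m (Suc t)" for l w
        using Suc.prems(3) D_in_ker_upto less.prems(1) that by simp
      show "(\<Sum>j\<le>s. if m + j < n then \<phi> (s - j) (D (m + i) (D (m + j) w)) else 0) = 0"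
        if "w \<in> ker_upto m (Suc (Suc t))" for s w
      proof -
        have "D (m + i) (D (m + j) w) = D (m + j) (D (m + i) w)" if "m + j < n" for j
          using D_commute[of "m + i" "m + j"] \<open>w \<in> _\<close> ker_upto_subset less.prems(1) that by blast
        then show ?thesis using Suc.prems(4)[of "D (m + i) w" s] D_in_ker_upto[of m "m + i" w "Suc t"]
          less.prems(1) that by (simp cong: if_cong)
      qed
      show "exact_at m t'" if "Suc t \<le> t'" "t' < Suc t + (d - Suc v)" for t'
        using Suc.prems(5)[of t'] that \<open>v < d\<close> by simp
    qed (use lin low less.prems in auto)
  qed
  have "exact_at m t" using Suc.prems(5)[of t] \<open>v < d\<close> by simp
  then show ?case
  proof (rule functional_zero[OF \<open>m < n\<close> _ Suc.prems(1) _ Suc.prems(6)])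
    show "\<phi> l (D a w) = 0" if "m \<le> a" "a < n" "w \<in> ker_upto m (Suc t)" for a w
      using kill[of "a - m"] that by simp
  qed
qed

text \<open>The rows for \<open>polynomial_kernel\<close> are indexed by a basis of the kernel in
  degree \<open>t\<close>, the columns by the elements of the kernel in degree \<open>Suc t\<close>.
  The range of \<open>t'\<close> allows one degree for each possible coefficient of the resulting
  family.\<close>

lemma finite_not_surjective:
  assumes "m < n" and exact: "\<And>t'. t \<le> t' \<Longrightarrow> t' < t + 2 ^ local.dim (ker_upto m t) * Suc n \<Longrightarrow> exact_at m t'"
  shows "finite {x. \<not> ker_upto m t \<subseteq>
    (\<lambda>w. \<Sum>i<n - m. scale (x ^ i) (D (m + i) w)) ` ker_upto m (Suc t)}" (is "finite ?bad")
proof (rule ccontr)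
  assume inf: "infinite ?bad"
  interpret pair: vector_space_pair scale "(*) :: 'k \<Rightarrow> 'k \<Rightarrow> 'k"
    by (intro vector_space_pair.intro vector_space_axioms vector_space_times)
  let ?V = "ker_upto m t" and ?V' = "ker_upto m (Suc t)"
  define p where "p = local.dim ?V"
  define Dx where "Dx x w = (\<Sum>i<n - m. scale (x ^ i) (D (m + i) w))" for x w
  obtain B where B: "finite B" "B \<subseteq> ?V" "local.independent B" "?V \<subseteq> local.span B" "card B = p"
    using fin_dim_basis[OF fin_dim_ker_upto[of m t]] unfolding p_def by metis
  obtain f where f: "bij_betw f {..<p} B"
    using ex_bij_betw_nat_finite[OF B(1)] B(5) by (auto simp: atLeast0LessThan)
  have "\<exists>\<kappa>. Vector_Spaces.linear scale (*) \<kappa> \<and> (\<forall>b\<in>B. \<kappa> b = (if b = f i then 1 else 0))" for i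
    using pair.linear_independent_extend[OF B(3)] .
  then obtain \<kappa> where \<kappa>_lin: "\<And>i. Vector_Spaces.linear scale (*) (\<kappa> i)"
    and \<kappa>: "\<And>i b. b \<in> B \<Longrightarrow> \<kappa> i b = (if b = f i then 1 else 0)" by metis
  have \<kappa>_f: "\<kappa> i (f j) = (if i = j then 1 else 0)" if "i < p" "j < p" for i j
    using f that by (auto simp: \<kappa> bij_betw_def inj_on_def)
  have f_V: "f i \<in> ?V" if "i < p" for i using f B that by (auto simp: bij_betw_def)
  have expand: "w = (\<Sum>i<p. scale (\<kappa> i w) (f i))" if "w \<in> ?V" for w
  proof -
    obtain v where "w = (\<Sum>b\<in>B. scale (v b) b)"
      using \<open>w \<in> ?V\<close> B(4) span_finite[OF B(1)] by auto
    then have v: "w = (\<Sum>i<p. scale (v (f i)) (f i))"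
      using sum.reindex_bij_betw[OF f, of "\<lambda>b. scale (v b) b"] by simp
    have "\<kappa> i w = v (f i)" if "i < p" for i
    proof -
      interpret \<kappa>: Vector_Spaces.linear scale "(*)" "\<kappa> i" by (rule \<kappa>_lin)
      have "\<kappa> i w = (\<Sum>j<p. v (f j) * (if i = j then 1 else 0))"
        unfolding v using that by (simp add: \<kappa>.sum \<kappa>.scale \<kappa>_f)
      then show ?thesis using that by (simp add: if_distrib cong: if_cong)
    qed
    then show ?thesis using v by simp
  qed
  have Dx_V: "Dx x w \<in> ?V" if "w \<in> ?V'" for x w
    using subspace_ker_upto[of m t] D_in_ker_upto[of m] that \<open>m < n\<close> unfolding Dx_def
    by (intro subspace_sum subspace_scale) auto
  have Dx_sub: "local.subspace (Dx x ` ?V')" for x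
  proof -
    have "Dx x (v + w) = Dx x v + Dx x w" "Dx x (scale r w) = scale r (Dx x w)" for v w r
      by (simp_all add: Dx_def D_add D_scale scale_right_distrib sum.distrib scale_sum_right mult.commute)
    moreover have "Dx x 0 = 0" by (simp add: Dx_def D_0)
    ultimately show ?thesis
      using subspace_ker_upto[of m "Suc t"] \<open>m < n\<close> unfolding subspace_def
      by (auto simp: image_iff) metis+
  qed
  \<comment> \<open>The value of \<open>c i w\<close> at \<open>x\<close> is the \<open>i\<close>-th
    coordinate of \<open>Dx x w\<close>, so a functional that kills the image of \<open>Dx x\<close>
    is a dependency of the rows at \<open>x\<close>.\<close>
  define c where "c i w = (\<Sum>j<n - m. monom (\<kappa> i (D (m + j) w)) j)" for i w
  have coeff_c: "coeff (c i w) j = (if m + j < n then \<kappa> i (D (m + j) w) else 0)" for i w j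
    by (auto simp: c_def coeff_sum less_diff_conv add.commute)
  have poly_c: "poly (c i w) x = \<kappa> i (Dx x w)" for i w x
  proof -
    interpret \<kappa>: Vector_Spaces.linear scale "(*)" "\<kappa> i" by (rule \<kappa>_lin)
    show ?thesis by (simp add: c_def Dx_def poly_sum poly_monom \<kappa>.sum \<kappa>.scale mult.commute)
  qed
  have "?bad \<subseteq> {x. \<exists>y. (\<exists>i<p. y i \<noteq> 0) \<and> (\<forall>w\<in>?V'. (\<Sum>i<p. y i * poly (c i w) x) = 0)}"
  proof
    fix x assume "x \<in> ?bad"
    then obtain w0 where w0: "w0 \<in> ?V" "w0 \<notin> Dx x ` ?V'" unfolding Dx_def by blast
    obtain \<phi> where \<phi>: "Vector_Spaces.linear scale (*) \<phi>" "\<And>u. u \<in> Dx x ` ?V' \<Longrightarrow> \<phi> u = 0" "\<phi> w0 = 1"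
      using separating_functional[OF Dx_sub w0(2)] by blast
    interpret \<phi>: Vector_Spaces.linear scale "(*)" \<phi> by (rule \<phi>(1))
    have \<phi>_eq: "\<phi> w = (\<Sum>i<p. \<phi> (f i) * \<kappa> i w)" if "w \<in> ?V" for w
      by (subst expand[OF that]) (simp add: \<phi>.sum \<phi>.scale mult.commute)
    have "\<exists>i<p. \<phi> (f i) \<noteq> 0"
    proof (rule ccontr)
      assume "\<not> (\<exists>i<p. \<phi> (f i) \<noteq> 0)"
      then have "\<phi> w0 = 0" using \<phi>_eq[OF w0(1)] by simp
      then show False using \<phi>(3) by simp
    qed
    moreover have "(\<Sum>i<p. \<phi> (f i) * poly (c i w) x) = 0" if "w \<in> ?V'" for w
      using \<phi>_eq[OF Dx_V[OF that], of x, symmetric] \<phi>(2)[OF imageI[OF that]] by (simp add: poly_c)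
    ultimately show "x \<in> {x. \<exists>y. (\<exists>i<p. y i \<noteq> 0) \<and> (\<forall>w\<in>?V'. (\<Sum>i<p. y i * poly (c i w) x) = 0)}"
      by (intro CollectI exI[of _ "\<lambda>i. \<phi> (f i)"]) blast
  qed
  then have inf': "infinite {x. \<exists>y. (\<exists>i<p. y i \<noteq> 0) \<and> (\<forall>w\<in>?V'. (\<Sum>i<p. y i * poly (c i w) x) = 0)}"
    using inf finite_subset by blast
  have "degree (c i w) \<le> n" for i w
    unfolding c_def by (intro degree_sum_le order_trans[OF degree_monom_le]) auto
  from polynomial_kernel[OF this inf']
  obtain u where u: "\<exists>i<p. u i \<noteq> 0" "\<And>i. i < p \<Longrightarrow> degree (u i) + n \<le> 2 ^ p * n"
      "\<And>w. w \<in> ?V' \<Longrightarrow> (\<Sum>i<p. u i * c i w) = 0" by blast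
  \<comment> \<open>The coefficients, by powers of the parameter, of the polynomial functional with
    coordinates \<open>u i\<close>. As \<open>degree (u i) + n \<le> 2 ^ p * n\<close>, they vanish
    from index \<open>?d\<close> on.\<close>
  define \<phi> where "\<phi> l w = (\<Sum>i<p. coeff (u i) l * \<kappa> i w)" for l w
  let ?d = "2 ^ p * Suc n"
  have \<phi>_zero: "\<phi> l w = 0" if "w \<in> ?V" for l w
  proof (rule functional_family_zero[OF \<open>m < n\<close>, where v = 0 and d = ?d])
    show "Vector_Spaces.linear scale (*) (\<phi> l)" for l
    proof -
      have \<kappa>_add: "\<kappa> i (x + y) = \<kappa> i x + \<kappa> i y"
        and \<kappa>_scale: "\<kappa> i (scale r x) = r * \<kappa> i x" for i x y r
        using \<kappa>_lin[of i] unfolding Vector_Spaces.linear_iff by blast+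
      have "\<phi> l (x + y) = \<phi> l x + \<phi> l y" for x y
        by (simp add: \<phi>_def \<kappa>_add distrib_left sum.distrib)
      moreover have "\<phi> l (scale r x) = r * \<phi> l x" for r x
        by (simp only: \<phi>_def \<kappa>_scale sum_distrib_left mult.left_commute)
      ultimately show ?thesis
        unfolding Vector_Spaces.linear_iff by (blast intro: vector_space_axioms vector_space_times)
    qed
    show "\<phi> l w = 0" if "?d \<le> l" for l w
    proof -
      have "coeff (u i) l = 0" if "i < p" for i
        using u(2)[OF that] \<open>?d \<le> l\<close> zero_less_power[of "2::nat" p]
        unfolding mult_Suc_right by (intro coeff_eq_0) linarith
      then show ?thesis by (simp add: \<phi>_def)
    qed
    show "(\<Sum>i\<le>s. if m + i < n then \<phi> (s - i) (D (m + i) w) else 0) = 0" if "w \<in> ?V'" for s w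
    proof -
      have "0 = coeff (\<Sum>i<p. c i w * u i) s" using u(3)[OF that] by (simp add: mult.commute)
      also have "\<dots> = (\<Sum>i<p. \<Sum>j\<le>s. coeff (c i w) j * coeff (u i) (s - j))"
        by (simp add: coeff_sum coeff_mult)
      also have "\<dots> = (\<Sum>j\<le>s. \<Sum>i<p. coeff (c i w) j * coeff (u i) (s - j))"
        by (rule sum.swap)
      also have "\<dots> = (\<Sum>i\<le>s. if m + i < n then \<phi> (s - i) (D (m + i) w) else 0)"
        by (intro sum.cong refl) (simp add: coeff_c \<phi>_def mult.commute)
      finally show ?thesis by simp
    qed
    show "exact_at m t'" if "t \<le> t'" "t' < t + (?d - 0)" for t'
      using exact that unfolding p_def by simp
  qed (use that in auto)
  obtain i where i: "i < p" "u i \<noteq> 0" using u(1) by blast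
  have "coeff (u i) l = 0" for l
  proof -
    have "\<phi> l (f i) = (\<Sum>j<p. coeff (u j) l * (if j = i then 1 else 0))"
      using i by (simp add: \<phi>_def \<kappa>_f)
    then have "\<phi> l (f i) = coeff (u i) l" using i by (simp add: if_distrib cong: if_cong)
    then show ?thesis using \<phi>_zero[OF f_V[OF i(1)]] by simp
  qed
  then show False using i by (simp add: poly_eq_iff)
qed

end

section \<open>Frames and symbolic systems\<close>

lemma sum_fun_apply: "(\<Sum>i\<in>I. f i) x = (\<Sum>i\<in>I. f i x)" for f :: "'i \<Rightarrow> 'a \<Rightarrow> 'b::ab_group_add"
  by (induction I rule: infinite_finite_induct) auto

context symbol_spaces
begin

abbreviation T_dim :: nat where "T_dim \<equiv> T.dim UNIV"

definition contract :: "'t \<Rightarrow> ('t list \<Rightarrow> 'v) \<Rightarrow> 't list \<Rightarrow> 'v"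
  where "contract x f = (\<lambda>xs. f (x # xs))"

lemma contract_apply: "contract x f xs = f (x # xs)"
  by (simp add: contract_def)

lemma contract_add: "contract x (f + g) = contract x f + contract x g"
  and contract_scale: "contract x (fscale sN c f) = fscale sN c (contract x f)"
  and contract_0: "contract x 0 = 0"
  by (auto simp: contract_def fscale_def)

lemma linear_contract: "Vector_Spaces.linear (fscale sN) (fscale sN) (contract x)"
  by (auto simp: Vector_Spaces.linear_iff G.vector_space_axioms contract_def fscale_def fun_eq_iff)

lemma subspace_dual: "D.subspace dual"
  unfolding D.subspace_def dual_def Vector_Spaces.linear_iff
  by (auto simp: fscale_def algebra_simps T.vector_space_axioms vector_space_times)

lemma dual_add: "p \<in> dual \<Longrightarrow> p (x + y) = p x + p y"
  and dual_scale: "p \<in> dual \<Longrightarrow> p (sT c x) = c * p x"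
  by (auto simp: dual_def Vector_Spaces.linear_iff)

lemma dual_sum: "p \<in> dual \<Longrightarrow> p (\<Sum>i\<in>I. f i) = (\<Sum>i\<in>I. p (f i))"
  by (induction I rule: infinite_finite_induct)
    (use dual_add[of p] dual_scale[of p 0 0] in auto)

lemma subspace_SymN: "G.subspace (SymN r V)"
  unfolding SymN_def by simp

lemma SymN_eq: "SymN r V = G.span {(\<lambda>xs. sN (power_form r p xs) v) | p v. p \<in> V}" (is "_ = G.span ?S")
proof
  have "(\<lambda>xs. sN (\<phi> xs) v) \<in> G.span ?S" if \<phi>: "\<phi> \<in> Sym r V" for \<phi> v
  proof -
    define h where "h \<phi> = (\<lambda>xs. sN (\<phi> xs) v)" for \<phi> :: "'t list \<Rightarrow> 'k"
    have h: "h (\<phi> + \<psi>) = h \<phi> + h \<psi>" "h (fscale (*) c \<phi>) = fscale sN c (h \<phi>)" "h 0 = 0" for \<phi> \<psi> c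
      by (auto simp: h_def N.scale_left_distrib fscale_def)
    have "h \<phi> \<in> G.span ?S"
      using \<phi> unfolding Sym_def
    proof (rule F.span_induct)
      show "F.subspace {\<phi>. h \<phi> \<in> G.span ?S}"
        by (simp add: F.subspace_def h G.span_add G.span_scale G.span_zero)
    qed (auto simp: h_def intro: G.span_base)
    then show ?thesis by (simp add: h_def)
  qed
  then show "SymN r V \<subseteq> G.span ?S"
    unfolding SymN_def by (intro G.span_minimal) auto
  show "G.span ?S \<subseteq> SymN r V"
    unfolding SymN_def Sym_def by (intro G.span_mono) (auto intro: F.span_base)
qed

lemma power_form_SymN: "p \<in> V \<Longrightarrow> (\<lambda>xs. sN (power_form r p xs) v) \<in> SymN r V"
  unfolding SymN_eq by (intro G.span_base) blast

lemma SymN_induct: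
  assumes "f \<in> SymN r V" and "G.subspace {f. P f}"
    and "\<And>p v. p \<in> V \<Longrightarrow> P (\<lambda>xs. sN (power_form r p xs) v)"
  shows "P f"
  using assms(1) unfolding SymN_eq
  by (rule G.span_induct) (use assms(2,3) in auto)

lemma SymN_mono: "V \<subseteq> V' \<Longrightarrow> SymN r V \<subseteq> SymN r V'"
  unfolding SymN_eq by (intro G.span_mono) blast

lemma SymN_length: "f \<in> SymN r V \<Longrightarrow> length xs \<noteq> r \<Longrightarrow> f xs = 0"
  by (erule SymN_induct) (auto simp: G.subspace_def fscale_def power_form_def)

lemma SymN_add:
  "f \<in> SymN r V \<Longrightarrow> V \<subseteq> dual \<Longrightarrow> f ((x + y) # xs) = f (x # xs) + f (y # xs)"
  by (erule SymN_induct)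
    (auto simp: G.subspace_def fscale_def power_form_def dual_add N.scale_right_distrib
      N.scale_left_distrib distrib_right subset_iff)

lemma SymN_scale:
  "f \<in> SymN r V \<Longrightarrow> V \<subseteq> dual \<Longrightarrow> f (sT c x # xs) = sN c (f (x # xs))"
  by (erule SymN_induct)
    (auto simp: G.subspace_def fscale_def power_form_def dual_scale N.scale_right_distrib
      N.scale_left_commute subset_iff mult.assoc)

lemma SymN_sum:
  assumes "f \<in> SymN r V" "V \<subseteq> dual"
  shows "f ((\<Sum>i\<in>I. x i) # xs) = (\<Sum>i\<in>I. f (x i # xs))"
proof -
  have "f (0 # xs) = 0" using SymN_scale[OF assms, of 0 0 xs] by simp
  then show ?thesis
    by (induction I rule: infinite_finite_induct) (auto simp: SymN_add[OF assms])
qed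

lemma SymN_perm: "f \<in> SymN r V \<Longrightarrow> mset xs = mset ys \<Longrightarrow> f xs = f ys"
proof (erule SymN_induct)
  assume eq: "mset xs = mset ys"
  show "sN (power_form r p xs) v = sN (power_form r p ys) v" for p v
  proof -
    have "prod_list (map p xs) = prod_list (map p ys)"
      using eq by (metis mset_map prod_mset_prod_list)
    then show ?thesis using mset_eq_length[OF eq] by (simp add: power_form_def)
  qed
qed (auto simp: G.subspace_def fscale_def)

lemma contract_commute: "f \<in> SymN r V \<Longrightarrow> contract x (contract y f) = contract y (contract x f)"
  unfolding contract_def by (intro ext SymN_perm[of f r V]) auto

lemma contract_SymN: 
  assumes "f \<in> SymN (Suc r) V" shows "contract x f \<in> SymN r V"
  using assms
proof (rule SymN_induct)
  show "G.subspace {f. contract x f \<in> SymN r V}"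
    using subspace_SymN[of r V]
    by (simp add: G.subspace_def contract_add contract_scale contract_0)
  fix p v assume "p \<in> V"
  have "contract x (\<lambda>xs. sN (power_form (Suc r) p xs) v) = fscale sN (p x) (\<lambda>xs. sN (power_form r p xs) v)"
    by (auto simp: contract_def power_form_def fscale_def)
  then show "contract x (\<lambda>xs. sN (power_form (Suc r) p xs) v) \<in> SymN r V"
    using G.subspace_scale[OF subspace_SymN power_form_SymN] \<open>p \<in> V\<close> by simp
qed

section \<open>Dual frames and the flags they define\<close>

definition dual_frame :: "(nat \<Rightarrow> 't) \<Rightarrow> (nat \<Rightarrow> 't \<Rightarrow> 'k) \<Rightarrow> bool"
  where "dual_frame e b \<longleftrightarrow> (\<forall>a<T_dim. b a \<in> dual) \<and>
    (\<forall>a<T_dim. \<forall>c<T_dim. b a (e c) = (if a = c then 1 else 0)) \<and>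
    (\<forall>x. x = (\<Sum>a<T_dim. sT (b a x) (e a)))"

lemma dual_frame_expand:
  assumes "dual_frame e b" "p \<in> dual"
  shows "p = (\<Sum>a<T_dim. fscale (*) (p (e a)) (b a))"
proof
  fix x
  have "p x = p (\<Sum>a<T_dim. sT (b a x) (e a))" using assms(1) unfolding dual_frame_def by metis
  then show "p x = (\<Sum>a<T_dim. fscale (*) (p (e a)) (b a)) x"
    using assms(2) by (simp add: dual_sum dual_scale sum_fun_apply fscale_def mult.commute)
qed

text \<open>The evaluation map \<open>\<beta>\<close> from \<open>T\<close> to coordinate vectors
  hits every unit vector: a functional separating one from its range would be a linear relation
  among the \<open>b a\<close>. The \<open>e a\<close> are preimages of the unit vectors, and they
  span \<open>T\<close> because the elements of \<open>dual\<close>, all combinations of the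
  \<open>b a\<close>, separate points.\<close>

lemma coframe_dual_frame:
  assumes "is_coframe b"
  obtains e where "dual_frame e b"
proof -
  let ?n = T_dim
  have inj: "inj_on b {..<?n}" and ind: "D.independent (b ` {..<?n})" and sp: "D.span (b ` {..<?n}) = dual"
    using assms unfolding is_coframe_def by auto
  have b_dual: "b a \<in> dual" if "a < ?n" for a
    using sp D.span_base[of "b a" "b ` {..<?n}"] that by blast
  interpret K: vector_space "fscale (*) :: 'k \<Rightarrow> (nat \<Rightarrow> 'k) \<Rightarrow> nat \<Rightarrow> 'k"
    by (rule vector_space_fscale[OF vector_space_times])
  define \<beta> where "\<beta> x = (\<lambda>a. if a < ?n then b a x else 0)" for x
  define \<delta> where "\<delta> a = (\<lambda>c. if c = a then 1 else (0::'k))" for a :: nat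
  have "K.subspace (range \<beta>)"
    unfolding K.subspace_def
  proof (intro conjI ballI allI)
    have "b a 0 = 0" if "a < ?n" for a using dual_scale[OF b_dual[OF that], of 0 0] by simp
    then have "\<beta> 0 = 0" by (auto simp: \<beta>_def)
    then show "0 \<in> range \<beta>" by (metis rangeI)
    show "v + w \<in> range \<beta>" if vw: "v \<in> range \<beta>" "w \<in> range \<beta>" for v w
    proof -
      obtain x y where "v = \<beta> x" "w = \<beta> y" using vw by blast
      then have "v + w = \<beta> (x + y)" by (auto simp: \<beta>_def dual_add[OF b_dual])
      then show ?thesis by simp
    qed
    show "fscale (*) c v \<in> range \<beta>" if v: "v \<in> range \<beta>" for c v
    proof -
      obtain x where "v = \<beta> x" using v by blast
      then have "fscale (*) c v = \<beta> (sT c x)" by (auto simp: \<beta>_def fscale_def dual_scale[OF b_dual])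
      then show ?thesis by simp
    qed
  qed
  note sub = this
  have "\<delta> a \<in> range \<beta>" if a: "a < ?n" for a
  proof (rule ccontr)
    assume "\<delta> a \<notin> range \<beta>"
    then obtain \<psi> where \<psi>: "Vector_Spaces.linear (fscale (*)) (*) \<psi>" "\<And>u. u \<in> range \<beta> \<Longrightarrow> \<psi> u = 0"
        "\<psi> (\<delta> a) = 1"
      using K.separating_functional[OF sub] by blast
    interpret \<psi>: Vector_Spaces.linear "fscale (*)" "(*)" \<psi> by (rule \<psi>(1))
    have "(\<Sum>c<?n. \<psi> (\<delta> c) * b c x) = 0" for x
    proof -
      have "\<beta> x = (\<Sum>c<?n. fscale (*) (b c x) (\<delta> c))"
        by (auto simp: \<beta>_def \<delta>_def fscale_def sum_fun_apply if_distrib cong: if_cong)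
      then have "\<psi> (\<beta> x) = (\<Sum>c<?n. b c x * \<psi> (\<delta> c))" by (simp add: \<psi>.sum \<psi>.scale)
      then show ?thesis using \<psi>(2)[of "\<beta> x"] by (simp add: mult.commute)
    qed
    then have "(\<Sum>c<?n. fscale (*) (\<psi> (\<delta> c)) (b c)) = 0"
      by (auto simp: sum_fun_apply fscale_def)
    then have "(\<Sum>p\<in>b ` {..<?n}. fscale (*) (\<psi> (\<delta> (the_inv_into {..<?n} b p))) p) = 0"
      by (simp add: sum.reindex[OF inj] the_inv_into_f_f[OF inj] cong: sum.cong_simp)
    from D.independent_sum_zero[OF _ ind this, of "b a"] a
    have "\<psi> (\<delta> a) = 0" by (simp add: the_inv_into_f_f[OF inj])
    then show False using \<psi>(3) by simp
  qed
  then have "\<exists>x. \<beta> x = \<delta> a" if "a < ?n" for a using that by (metis imageE)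
  then obtain e where "\<And>a. a < ?n \<Longrightarrow> \<beta> (e a) = \<delta> a" by metis
  then have e: "b c (e a) = (if c = a then 1 else 0)" if "a < ?n" "c < ?n" for a c
    using that by (auto simp: \<beta>_def \<delta>_def fun_eq_iff split: if_splits) metis+
  have "x = (\<Sum>a<?n. sT (b a x) (e a))" for x
  proof (rule ccontr)
    let ?y = "x - (\<Sum>a<?n. sT (b a x) (e a))"
    assume "x \<noteq> (\<Sum>a<?n. sT (b a x) (e a))"
    then have "?y \<notin> {0}" by simp
    then obtain p where p: "Vector_Spaces.linear sT (*) p" "p ?y = 1"
      using T.separating_functional[OF T.subspace_single_0] by blast
    have "p \<in> D.span (b ` {..<?n})" using p(1) sp by (simp add: dual_def)
    then have "p ?y = 0"
    proof (rule D.span_induct)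
      show "D.subspace {p. p ?y = 0}" by (auto simp: D.subspace_def fscale_def)
      fix q assume "q \<in> b ` {..<?n}"
      then obtain c where c: "c < ?n" "q = b c" by blast
      have "b c x = b c ?y + b c (\<Sum>a<?n. sT (b a x) (e a))"
        by (simp flip: dual_add[OF b_dual[OF c(1)]])
      also have "b c (\<Sum>a<?n. sT (b a x) (e a)) = (\<Sum>a<?n. b a x * (if c = a then 1 else 0))"
        using c e by (simp add: dual_sum[OF b_dual] dual_scale[OF b_dual])
      also have "\<dots> = b c x" using c by (simp add: if_distrib cong: if_cong)
      finally show "q ?y = 0" using c by simp
    qed
    then show False using p by simp
  qed
  then have "dual_frame e b" using b_dual e unfolding dual_frame_def by auto
  then show ?thesis by (rule that)
qed

lemma dual_frame_coframe:
  assumes "dual_frame e b"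
  shows "is_coframe b"
proof -
  let ?n = T_dim
  have indep: "\<forall>a\<in>{..<?n}. c a = 0" if "(\<Sum>a<?n. fscale (*) (c a) (b a)) = 0" for c
  proof
    fix a assume "a \<in> {..<?n}"
    have "0 = (\<Sum>d<?n. fscale (*) (c d) (b d)) (e a)" using that by simp
    also have "\<dots> = (\<Sum>d<?n. c d * (if d = a then 1 else 0))"
      using assms \<open>a \<in> {..<?n}\<close> by (simp add: sum_fun_apply fscale_def dual_frame_def)
    also have "\<dots> = c a" using \<open>a \<in> {..<?n}\<close> by (simp add: if_distrib cong: if_cong)
    finally show "c a = 0" by simp
  qed
  have "D.span (b ` {..<?n}) \<subseteq> dual"
    by (rule D.span_minimal[OF _ subspace_dual]) (use assms in \<open>auto simp: dual_frame_def\<close>)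
  moreover have "p \<in> D.span (b ` {..<?n})" if "p \<in> dual" for p
    by (subst dual_frame_expand[OF assms that], intro D.span_sum D.span_scale D.span_base imageI)
  ultimately show ?thesis
    using D.independent_family[of "{..<?n}" b] indep unfolding is_coframe_def by blast
qed

lemma SymN_expand:
  assumes "dual_frame e b" "f \<in> SymN r V" "V \<subseteq> dual"
  shows "f (x # xs) = (\<Sum>a<T_dim. sN (b a x) (f (e a # xs)))"
proof -
  have "f (x # xs) = f ((\<Sum>a<T_dim. sT (b a x) (e a)) # xs)"
    using assms(1) unfolding dual_frame_def by metis
  then show ?thesis using assms by (simp add: SymN_sum SymN_scale)
qed

lemma contract_zero:
  assumes "dual_frame e b" "f \<in> SymN (Suc r) dual" "\<And>a. a < T_dim \<Longrightarrow> contract (e a) f = 0"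
  shows "f = 0"
proof
  fix xs
  show "f xs = 0 xs"
  proof (cases xs)
    case Nil
    then show ?thesis using SymN_length[OF assms(2)] by simp
  next
    case (Cons x ys)
    have "f (e a # ys) = 0" if "a < T_dim" for a
      using fun_cong[OF assms(3)[OF that], of ys] by (simp add: contract_def)
    then show ?thesis using SymN_expand[OF assms(1,2) subset_refl, of x ys] Cons by simp
  qed
qed

text \<open>A tensor of positive degree is the sum over \<open>a\<close> of \<open>b a\<close>
  tensored with its contraction with \<open>e a\<close>. The operator \<open>C a\<close>, which
  prepends such a factor, does not preserve symmetry, so the spanning set lies in general outside
  \<open>SymN\<close>, as \<open>fin_dim\<close> permits.\<close>

lemma fin_dim_SymN:
  assumes "dual_frame e b" shows "G.fin_dim (SymN r dual)"
proof (induction r)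
  case 0
  obtain M where M: "finite M" "N.span M = UNIV" using finite_dim_N by blast
  define E where "E v = (\<lambda>xs::'t list. if xs = [] then v else (0::'v))" for v
  have E: "E (v + w) = E v + E w" "E (sN c v) = fscale sN c (E v)" "E 0 = 0" for v w c
    by (auto simp: E_def fscale_def)
  have "f \<in> G.span (E ` M)" if "f \<in> SymN 0 dual" for f
  proof -
    have "f [] \<in> N.span M" using M by simp
    then have "E (f []) \<in> G.span (E ` M)"
    proof (rule N.span_induct)
      show "N.subspace {v. E v \<in> G.span (E ` M)}"
        by (simp add: N.subspace_def E G.span_add G.span_scale G.span_zero)
    qed (simp add: G.span_base)
    moreover have "E (f []) = f" using SymN_length[OF that] by (auto simp: E_def)
    ultimately show ?thesis by simp
  qed
  then show ?case using M unfolding G.fin_dim_def by blast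
next
  case (Suc r)
  then obtain M where M: "finite M" "SymN r dual \<subseteq> G.span M" unfolding G.fin_dim_def by blast
  define C where "C a f xs = (case xs of [] \<Rightarrow> 0 | y # ys \<Rightarrow> sN (b a y) (f ys))"
    for a and f :: "'t list \<Rightarrow> 'v" and xs
  let ?M = "(\<lambda>(a, f). C a f) ` ({..<T_dim} \<times> M)"
  have C: "C a f \<in> G.span ?M" if "f \<in> G.span M" "a < T_dim" for a f
    using that(1)
  proof (rule G.span_induct)
    have "C a (f + f') = C a f + C a f'" "C a (fscale sN c f) = fscale sN c (C a f)" "C a 0 = 0" for f f' c
      by (auto simp: C_def fun_eq_iff fscale_def N.scale_right_distrib N.scale_left_commute split: list.split)
    then show "G.subspace {f. C a f \<in> G.span ?M}"
      by (simp add: G.subspace_def G.span_add G.span_scale G.span_zero)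
    show "C a f \<in> G.span ?M" if "f \<in> M" for f
      using that \<open>a < T_dim\<close> by (intro G.span_base) force
  qed
  have "f \<in> G.span ?M" if f: "f \<in> SymN (Suc r) dual" for f
  proof -
    have "f = (\<Sum>a<T_dim. C a (contract (e a) f))"
    proof
      fix xs show "f xs = (\<Sum>a<T_dim. C a (contract (e a) f)) xs"
      proof (cases xs)
        case Nil
        then show ?thesis using SymN_length[OF f, of "[]"] by (simp add: sum_fun_apply C_def)
      next
        case (Cons x ys)
        then show ?thesis using SymN_expand[OF assms f subset_refl, of x ys]
          by (simp add: sum_fun_apply C_def contract_def)
      qed
    qed
    moreover have "contract (e a) f \<in> G.span M" for a using contract_SymN[OF f] M by blast
    then have "C a (contract (e a) f) \<in> G.span ?M" if "a < T_dim" for a using C that by blast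
    then have "(\<Sum>a<T_dim. C a (contract (e a) f)) \<in> G.span ?M" by (intro G.span_sum) simp
    ultimately show ?thesis by metis
  qed
  then show ?case using M unfolding G.fin_dim_def by (intro exI[of _ ?M]) blast
qed

lemma flag_of_subset_dual: "dual_frame e b \<Longrightarrow> flag_of b m \<subseteq> dual"
  unfolding flag_of_def
  by (rule D.span_minimal[OF _ subspace_dual]) (auto simp: dual_frame_def)

lemma flag_of_zero:
  assumes "dual_frame e b" "p \<in> flag_of b m" "a < m" "m \<le> T_dim"
  shows "p (e a) = 0"
  using assms(2) unfolding flag_of_def
proof (rule D.span_induct)
  show "D.subspace {p. p (e a) = 0}" by (simp add: D.subspace_def fscale_def)
qed (use assms in \<open>auto simp: dual_frame_def\<close>)

text \<open>For the harder inclusion, \<open>\<rho>\<close> is the projection of \<open>T\<close>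
  along \<open>e 0\<close>, ..., \<open>e (m - 1)\<close>. Pulling back by it turns a power of
  \<open>p\<close> into a power of \<open>\<lambda>x. p (\<rho> x)\<close>, which lies in the flag,
  and fixes every tensor killed by those contractions.\<close>

lemma SymN_flag_of:
  assumes eb: "dual_frame e b" and "m \<le> T_dim"
  shows "SymN (Suc r) (flag_of b m) = {f \<in> SymN (Suc r) dual. \<forall>a<m. contract (e a) f = 0}"
proof (intro equalityI subsetI)
  fix f assume f: "f \<in> SymN (Suc r) (flag_of b m)"
  have "contract (e a) f = 0" if "a < m" for a
    using f
  proof (rule SymN_induct)
    show "G.subspace {f. contract (e a) f = 0}"
      by (simp add: G.subspace_def contract_add contract_scale contract_0)
    fix p v assume "p \<in> flag_of b m"
    then have "p (e a) = 0" using flag_of_zero[OF eb] that assms(2) by blast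
    then show "contract (e a) (\<lambda>xs. sN (power_form (Suc r) p xs) v) = 0"
      by (simp add: contract_def power_form_def fun_eq_iff)
  qed
  then show "f \<in> {f \<in> SymN (Suc r) dual. \<forall>a<m. contract (e a) f = 0}"
    using f SymN_mono[OF flag_of_subset_dual[OF eb]] by blast
next
  fix f assume "f \<in> {f \<in> SymN (Suc r) dual. \<forall>a<m. contract (e a) f = 0}"
  then have f: "f \<in> SymN (Suc r) dual" and zero: "\<And>a. a < m \<Longrightarrow> contract (e a) f = 0" by auto
  define \<rho> where "\<rho> x = x + (\<Sum>a<m. sT (- b a x) (e a))" for x
  have "(\<lambda>x. p (\<rho> x)) \<in> flag_of b m" if p: "p \<in> dual" for p
  proof -
    have "p (\<rho> x) = (\<Sum>a\<in>{m..<T_dim}. fscale (*) (p (e a)) (b a)) x" for x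
    proof -
      have "p x = (\<Sum>a<T_dim. p (e a) * b a x)"
        using fun_cong[OF dual_frame_expand[OF eb p], of x] by (simp add: sum_fun_apply fscale_def)
      also have "\<dots> = (\<Sum>a\<in>{m..<T_dim}. p (e a) * b a x) + (\<Sum>a<m. p (e a) * b a x)"
        using sum.subset_diff[of "{..<m}" "{..<T_dim}" "\<lambda>a. p (e a) * b a x"] assms(2)
        by (simp add: lessThan_minus_lessThan)
      finally have "p x = \<dots>" .
      moreover have "p (\<rho> x) = p x + (\<Sum>a<m. - b a x * p (e a))"
        by (simp only: \<rho>_def dual_add[OF p] dual_sum[OF p] dual_scale[OF p])
      ultimately show ?thesis by (simp add: sum_fun_apply fscale_def sum_negf mult.commute)
    qed
    then have "(\<lambda>x. p (\<rho> x)) = (\<Sum>a\<in>{m..<T_dim}. fscale (*) (p (e a)) (b a))" by blast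
    also have "\<dots> \<in> flag_of b m"
      unfolding flag_of_def by (intro D.span_sum D.span_scale D.span_base imageI)
    finally show ?thesis .
  qed
  note \<rho>_flag = this
  have "(\<lambda>xs. f (map \<rho> xs)) \<in> SymN (Suc r) (flag_of b m)"
    using f
  proof (rule SymN_induct)
    have "(\<lambda>xs. (f + f') (map \<rho> xs)) = (\<lambda>xs. f (map \<rho> xs)) + (\<lambda>xs. f' (map \<rho> xs))"
      "(\<lambda>xs. fscale sN c f (map \<rho> xs)) = fscale sN c (\<lambda>xs. f (map \<rho> xs))" 
      for f f' :: "'t list \<Rightarrow> 'v" and c
      by (auto simp: fscale_def)
    then show "G.subspace {f. (\<lambda>xs. f (map \<rho> xs)) \<in> SymN (Suc r) (flag_of b m)}"
      using subspace_SymN[of "Suc r" "flag_of b m"]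
      unfolding G.subspace_def mem_Collect_eq by (auto simp: zero_fun_def)
    show "(\<lambda>xs. sN (power_form (Suc r) p (map \<rho> xs)) v) \<in> SymN (Suc r) (flag_of b m)"
      if "p \<in> dual" for p v
    proof -
      have "power_form (Suc r) p (map \<rho> xs) = power_form (Suc r) (\<lambda>x. p (\<rho> x)) xs" for xs
        by (simp add: power_form_def o_def)
      then show ?thesis using power_form_SymN[OF \<rho>_flag[OF that], of "Suc r" v] by simp
    qed
  qed
  \<comment> \<open>\<open>\<rho>\<close> is removed from one argument at a time; symmetry brings
    each argument to the front, where the vanishing contractions apply.\<close>
  moreover have "f (map \<rho> xs @ ys) = f (xs @ ys)" for xs ys
  proof (induction xs arbitrary: ys)
    case (Cons x xs)
    have "f (e a # zs) = 0" if "a < m" for a zs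
      using fun_cong[OF zero[OF that], of zs] by (simp add: contract_def)
    then have "f (\<rho> x # zs) = f (x # zs)" for zs
      unfolding \<rho>_def SymN_add[OF f subset_refl] SymN_sum[OF f subset_refl]
        SymN_scale[OF f subset_refl] by simp
    then have "f (map \<rho> (x # xs) @ ys) = f (x # map \<rho> xs @ ys)" by simp
    also have "\<dots> = f (map \<rho> xs @ x # ys)" by (rule SymN_perm[OF f]) simp
    also have "\<dots> = f (xs @ x # ys)" by (rule Cons.IH)
    also have "\<dots> = f ((x # xs) @ ys)" by (rule SymN_perm[OF f]) simp
    finally show ?case .
  qed simp
  from this[of _ "[]"] have "(\<lambda>xs. f (map \<rho> xs)) = f" by simp
  ultimately show "f \<in> SymN (Suc r) (flag_of b m)" by simp
qed

section \<open>Contractions preserve a symbolic system\<close>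

lemma Sym_length: "\<phi> \<in> Sym r V \<Longrightarrow> length xs \<noteq> r \<Longrightarrow> \<phi> xs = 0"
  unfolding Sym_def
  by (erule F.span_induct) (auto simp: F.subspace_def fscale_def power_form_def)

lemma Sym_snoc:
  assumes "\<phi> \<in> Sym (Suc r) V" shows "(\<lambda>ys. \<phi> (ys @ [x])) \<in> Sym r V"
  using assms unfolding Sym_def
proof (rule F.span_induct)
  let ?S = "F.span (power_form r ` V)"
  have "(\<lambda>xs. (f + f') (xs @ [x])) = (\<lambda>xs. f (xs @ [x])) + (\<lambda>xs. f' (xs @ [x]))"
    "(\<lambda>xs. fscale (*) c f (xs @ [x])) = fscale (*) c (\<lambda>xs. f (xs @ [x]))"
    for f f' :: "'t list \<Rightarrow> 'k" and c
    by (auto simp: fscale_def)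
  then show "F.subspace {\<phi>. (\<lambda>ys. \<phi> (ys @ [x])) \<in> ?S}"
    using F.subspace_span[of "power_form r ` V"]
    unfolding F.subspace_def mem_Collect_eq by (auto simp: zero_fun_def)
  fix \<phi> assume "\<phi> \<in> power_form (Suc r) ` V"
  then obtain p where p: "p \<in> V" "\<phi> = power_form (Suc r) p" by blast
  have "(\<lambda>ys. \<phi> (ys @ [x])) = fscale (*) (p x) (power_form r p)"
    by (auto simp: p power_form_def fscale_def)
  then show "(\<lambda>ys. \<phi> (ys @ [x])) \<in> ?S"
    using p by (simp add: F.span_scale F.span_base)
qed

lemma tensor_Sym_0:
  assumes "G.subspace W" "W \<subseteq> SymN k dual" shows "tensor_Sym k W 0 \<subseteq> W"
  unfolding tensor_Sym_def
proof (rule G.span_minimal[OF _ assms(1)], clarify)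
  fix f \<phi> assume f: "f \<in> W" and \<phi>: "\<phi> \<in> Sym 0 dual"
  have "(\<lambda>xs. sN (\<phi> (drop k xs)) (f (take k xs))) = fscale sN (\<phi> []) f"
  proof
    fix xs
    show "sN (\<phi> (drop k xs)) (f (take k xs)) = fscale sN (\<phi> []) f xs"
      using Sym_length[OF \<phi>, of "drop k xs"] SymN_length[of f k dual xs] f assms(2)
      by (cases "length xs \<le> k") (auto simp: fscale_def)
  qed
  then show "(\<lambda>xs. sN (\<phi> (drop k xs)) (f (take k xs))) \<in> W"
    using G.subspace_scale[OF assms(1) f] by simp
qed

lemma tensor_Sym_snoc:
  assumes "W \<subseteq> SymN k dual" "f \<in> tensor_Sym k W (Suc r)"
  shows "(\<lambda>xs. f (xs @ [x])) \<in> tensor_Sym k W r"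
  using assms(2) unfolding tensor_Sym_def[of k W "Suc r"]
proof (rule G.span_induct)
  have "(\<lambda>xs. (f + f') (xs @ [x])) = (\<lambda>xs. f (xs @ [x])) + (\<lambda>xs. f' (xs @ [x]))"
    "(\<lambda>xs. fscale sN c f (xs @ [x])) = fscale sN c (\<lambda>xs. f (xs @ [x]))"
    for f f' :: "'t list \<Rightarrow> 'v" and c
    by (auto simp: fscale_def)
  then show "G.subspace {f. (\<lambda>xs. f (xs @ [x])) \<in> tensor_Sym k W r}"
    using G.subspace_span
    unfolding G.subspace_def mem_Collect_eq tensor_Sym_def by (auto simp: zero_fun_def)
  fix h assume "h \<in> {(\<lambda>xs. sN (\<phi> (drop k xs)) (f (take k xs))) |f \<phi>. f \<in> W \<and> \<phi> \<in> Sym (Suc r) dual}"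
  then obtain f \<phi> where f: "f \<in> W" and \<phi>: "\<phi> \<in> Sym (Suc r) dual"
    and h: "h = (\<lambda>xs. sN (\<phi> (drop k xs)) (f (take k xs)))" by blast
  have "(\<lambda>xs. h (xs @ [x])) = (\<lambda>xs. sN (\<phi> (drop k xs @ [x])) (f (take k xs)))"
  proof
    fix xs
    show "h (xs @ [x]) = sN (\<phi> (drop k xs @ [x])) (f (take k xs))"
      using Sym_length[OF \<phi>, of "[]"] SymN_length[of f k dual xs] f assms(1)
      by (cases "k \<le> length xs") (auto simp: h)
  qed
  then show "(\<lambda>xs. h (xs @ [x])) \<in> tensor_Sym k W r"
    using f Sym_snoc[OF \<phi>, of x] unfolding tensor_Sym_def by (auto intro!: G.span_base)
qed

lemma symbolic_system_subset: "symbolic_system k g \<Longrightarrow> g i \<subseteq> SymN i dual"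
  unfolding symbolic_system_def by (cases i k rule: linorder_cases) auto

lemma symbolic_system_subspace: "symbolic_system k g \<Longrightarrow> G.subspace (g i)"
  unfolding symbolic_system_def tensor_Sym_def
  by (cases i k rule: linorder_cases) (auto intro: G.subspace_inter subspace_SymN)

text \<open>In a symmetric tensor the first argument may be exchanged for the last, and filling the
  last argument affects only the symmetric factor of \<open>tensor_Sym\<close>, never the one from
  \<open>g k\<close>. The boundary \<open>i = k\<close> needs \<open>tensor_Sym_0\<close>, because
  \<open>g k\<close> is not itself given as an intersection.\<close>

lemma contract_symbolic_system:
  assumes sys: "symbolic_system k g" and f: "f \<in> g (Suc i)"
  shows "contract x f \<in> g i"
proof -
  have fS: "f \<in> SymN (Suc i) dual" using symbolic_system_subset[OF sys] f by blast
  then have cS: "contract x f \<in> SymN i dual" by (rule contract_SymN)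
  show ?thesis
  proof (cases "i < k")
    case True
    then show ?thesis using sys cS unfolding symbolic_system_def by blast
  next
    case False
    have gk: "G.subspace (g k)" "g k \<subseteq> SymN k dual" using sys unfolding symbolic_system_def by auto
    have "g (Suc i) = tensor_Sym k (g k) (Suc i - k) \<inter> SymN (Suc i) dual"
      using False sys unfolding symbolic_system_def by auto
    then have "f \<in> tensor_Sym k (g k) (Suc (i - k))" using False f by (simp add: Suc_diff_le)
    moreover have "contract x f = (\<lambda>xs. f (xs @ [x]))"
      unfolding contract_def by (intro ext SymN_perm[OF fS]) simp
    ultimately have c: "contract x f \<in> tensor_Sym k (g k) (i - k)"
      using tensor_Sym_snoc[OF gk(2)] by simp
    show ?thesis
    proof (cases "i = k")
      case True
      then show ?thesis using c tensor_Sym_0[OF gk] by auto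
    next
      case False
      then have "g i = tensor_Sym k (g k) (i - k) \<inter> SymN i dual"
        using \<open>\<not> i < k\<close> sys unfolding symbolic_system_def by auto
      then show ?thesis using c cS by blast
    qed
  qed
qed

lemma koszul_system_contract:
  assumes "symbolic_system k g" "dual_frame e b"
  shows "koszul_system (fscale sN) (\<lambda>a. contract (e a)) g m"
proof (intro koszul_system.intro koszul_system_axioms.intro G.vector_space_axioms)
  fix t a c w
  show "G.subspace (g t)" by (rule symbolic_system_subspace[OF assms(1)])
  show "G.fin_dim (g t)"
    by (rule G.fin_dim_subset[OF fin_dim_SymN[OF assms(2)] symbolic_system_subset[OF assms(1)]])
  show "Vector_Spaces.linear (fscale sN) (fscale sN) (contract (e a))" by (rule linear_contract)
  show "w \<in> g (Suc t) \<Longrightarrow> contract (e a) w \<in> g t" by (rule contract_symbolic_system[OF assms(1)])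
  show "w \<in> g t \<Longrightarrow> contract (e a) (contract (e c) w) = contract (e c) (contract (e a) w)"
    using symbolic_system_subset[OF assms(1)] contract_commute by blast
qed

section \<open>Moving one vector of a frame along a curve\<close>

definition shift_frame :: "nat \<Rightarrow> 'k \<Rightarrow> (nat \<Rightarrow> 't) \<Rightarrow> nat \<Rightarrow> 't"
  where "shift_frame m x e = e(m := \<Sum>i<T_dim - m. sT (x ^ i) (e (m + i)))"

text \<open>The new vector has coefficient \<open>x ^ 0 = 1\<close> at \<open>e m\<close>, so the
  change of frame is unipotent and its dual involves no division; hence polynomials in the coframe
  become polynomials in \<open>x\<close>.\<close>

definition shift_coframe :: "nat \<Rightarrow> 'k \<Rightarrow> (nat \<Rightarrow> 't \<Rightarrow> 'k) \<Rightarrow> nat \<Rightarrow> 't \<Rightarrow> 'k"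
  where "shift_coframe m x b a = (if m < a then b a - fscale (*) (x ^ (a - m)) (b m) else b a)"

lemma dual_frame_shift:
  assumes eb: "dual_frame e b" and m: "m < T_dim"
  shows "dual_frame (shift_frame m x e) (shift_coframe m x b)"
  unfolding dual_frame_def
proof (intro conjI allI impI)
  let ?n = T_dim
  have b_dual: "b a \<in> dual" if "a < ?n" for a using eb that by (simp add: dual_frame_def)
  have be: "b a (e c) = (if a = c then 1 else 0)" if "a < ?n" "c < ?n" for a c
    using eb that by (simp add: dual_frame_def)
  have bm: "b a (shift_frame m x e m) = (if m \<le> a then x ^ (a - m) else 0)" if "a < ?n" for a
  proof -
    have "b a (shift_frame m x e m) = (\<Sum>i<?n - m. x ^ i * (if a = m + i then 1 else 0))"
      using that be by (simp add: shift_frame_def dual_sum[OF b_dual] dual_scale[OF b_dual])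
    also have "\<dots> = (\<Sum>i<?n - m. if i = a - m \<and> m \<le> a then x ^ i else 0)"
      by (intro sum.cong) auto
    also have "\<dots> = (if m \<le> a then x ^ (a - m) else 0)"
      using that by (auto simp: sum.delta less_diff_conv2)
    finally show ?thesis .
  qed
  fix a assume a: "a < ?n"
  show "shift_coframe m x b a \<in> dual"
    using b_dual[OF a] b_dual[OF m] subspace_dual
    by (simp add: shift_coframe_def D.subspace_diff D.subspace_scale)
  fix c assume c: "c < ?n"
  show "shift_coframe m x b a (shift_frame m x e c) = (if a = c then 1 else 0)"
  proof (cases "c = m")
    case True
    then show ?thesis using bm[OF a] bm[OF m] by (auto simp: shift_coframe_def fscale_def)
  next
    case False
    then have "shift_frame m x e c = e c" by (simp add: shift_frame_def)
    then show ?thesis using False be[OF a c] be[OF m c] by (auto simp: shift_coframe_def fscale_def)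
  qed
next
  let ?n = T_dim
  fix y
  let ?e = "shift_frame m x e" and ?b = "shift_coframe m x b"
  have split: "(\<Sum>a<?n. f a) = (\<Sum>a<m. f a) + (f m + (\<Sum>a\<in>{Suc m..<?n}. f a))" for f :: "nat \<Rightarrow> 't"
    using m by (metis add.commute atLeast0LessThan sum.atLeast_Suc_lessThan sum.atLeastLessThan_concat le0 less_imp_le)
  have e_m: "?e m = e m + (\<Sum>a\<in>{Suc m..<?n}. sT (x ^ (a - m)) (e a))"
  proof -
    have "?e m = (\<Sum>i\<in>{0..<?n - m}. sT (x ^ i) (e (m + i)))" by (simp add: shift_frame_def atLeast0LessThan)
    also have "\<dots> = (\<Sum>a\<in>{m..<?n}. sT (x ^ (a - m)) (e a))"
      using sum.shift_bounds_nat_ivl[of "\<lambda>a. sT (x ^ (a - m)) (e a)" 0 m "?n - m"] m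
      by (simp add: add.commute)
    also have "\<dots> = e m + (\<Sum>a\<in>{Suc m..<?n}. sT (x ^ (a - m)) (e a))"
      using m by (simp add: sum.atLeast_Suc_lessThan)
    finally show ?thesis .
  qed
  have "(\<Sum>a<?n. sT (?b a y) (?e a)) =
      (\<Sum>a<m. sT (b a y) (e a)) + (sT (b m y) (?e m) + (\<Sum>a\<in>{Suc m..<?n}. sT (?b a y) (e a)))"
    unfolding split by (simp add: shift_coframe_def shift_frame_def)
  also have "(\<Sum>a\<in>{Suc m..<?n}. sT (?b a y) (e a)) =
      (\<Sum>a\<in>{Suc m..<?n}. sT (b a y) (e a)) - sT (b m y) (\<Sum>a\<in>{Suc m..<?n}. sT (x ^ (a - m)) (e a))"
    by (simp add: shift_coframe_def fscale_def T.scale_left_diff_distrib sum_subtractf T.scale_sum_right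
        mult.commute)
  also have "(\<Sum>a<m. sT (b a y) (e a)) + (sT (b m y) (?e m) + \<dots>) = (\<Sum>a<?n. sT (b a y) (e a))"
    unfolding split e_m by (simp add: T.scale_right_distrib)
  also have "\<dots> = y" using eb by (simp add: dual_frame_def)
  finally show "y = (\<Sum>a<?n. sT (?b a y) (?e a))" by simp
qed

lemma polynomial_shift_coframe:
  assumes "polynomial_in_coframe P"
  obtains q where "\<And>x. P (shift_coframe m x b) = poly q x"
proof -
  have "\<exists>q. \<forall>x. P (shift_coframe m x b) = poly q x"
    using assms
  proof induction
    case (const c)
    show ?case by (rule exI[of _ "[:c:]"]) simp
  next
    case (coordinate a y)
    show ?case
      by (rule exI[of _ "if m < a then [:b a y:] - monom (b m y) (a - m) else [:b a y:]"])
        (simp add: shift_coframe_def fscale_def poly_monom mult.commute)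
  next
    case (add P Q)
    then show ?case by (metis poly_add)
  next
    case (mult P Q)
    then show ?case by (metis poly_mult)
  qed
  then show ?thesis using that by blast
qed

lemma shift_coframe_0: "shift_coframe m 0 b = b"
  by (auto simp: shift_coframe_def fscale_def fun_eq_iff power_0_left)

abbreviation surj_frame where
  "surj_frame g e \<equiv> koszul_system.surj_at (\<lambda>a. contract (e a)) g"

abbreviation exact_frame where
  "exact_frame g e \<equiv> koszul_system.exact_at (\<lambda>a. contract (e a)) g T_dim"

text \<open>The induction keeps \<open>R\<close> arbitrary: regularity of the first \<open>m\<close>
  vectors up to a larger bound \<open>R'\<close> is spent to obtain regularity of
  \<open>m + 1\<close> vectors up to \<open>R\<close>.\<close>

lemma regular_frame:
  assumes sys: "symbolic_system k g"
    and exact: "\<And>e b t. dual_frame e b \<Longrightarrow> k \<le> t \<Longrightarrow> exact_frame g e 0 t"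
    and P: "polynomial_in_coframe P" and b0: "is_coframe b0" "P b0 \<noteq> 0"
    and "m \<le> T_dim"
  shows "\<exists>e b. dual_frame e b \<and> P b \<noteq> 0 \<and> (\<forall>i<m. \<forall>t. k \<le> t \<longrightarrow> t \<le> R \<longrightarrow> surj_frame g e i t)"
  using \<open>m \<le> T_dim\<close>
proof (induction m arbitrary: R)
  case 0
  then show ?case using coframe_dual_frame[OF b0(1)] b0(2) by (metis less_nat_zero_code)
next
  case (Suc m)
  \<comment> \<open>\<open>d\<close> bounds the dimension of every kernel in degrees up to
    \<open>R\<close>, so the margin required by \<open>finite_not_surjective\<close> is at most
    \<open>R' - R\<close>.\<close>
  define d where "d = Max ((\<lambda>t. G.dim (g t)) ` {..R})"
  define R' where "R' = R + 2 ^ d * Suc T_dim"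
  have m: "m < T_dim" using Suc.prems by simp
  obtain e b where eb: "dual_frame e b" "P b \<noteq> 0"
    and surj: "\<And>i t. i < m \<Longrightarrow> k \<le> t \<Longrightarrow> t \<le> R' \<Longrightarrow> surj_frame g e i t"
    using Suc.IH[of R'] Suc.prems by (metis Suc_leD)
  interpret K: koszul_system "fscale sN" "\<lambda>a. contract (e a)" g T_dim
    by (rule koszul_system_contract[OF sys eb(1)])
  \<comment> \<open>Each use of \<open>exact_at_Suc\<close> needs surjectivity in degree
    \<open>Suc t\<close>, whence the strict bound \<open>t < R'\<close>.\<close>
  have ex: "K.exact_at i t" if "i \<le> m" "k \<le> t" "t < R'" for i t
    using that
  proof (induction i)
    case 0
    then show ?case using exact[OF eb(1)] by simp
  next
    case (Suc i)
    then show ?case using K.exact_at_Suc[of i t] surj[of i "Suc t"] m by simp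
  qed
  let ?bad = "\<lambda>t. {x. \<not> K.ker_upto m t \<subseteq>
    (\<lambda>w. \<Sum>i<T_dim - m. fscale sN (x ^ i) (contract (e (m + i)) w)) ` K.ker_upto m (Suc t)}"
  have fin: "finite (?bad t)" if t: "k \<le> t" "t \<le> R" for t
  proof (rule K.finite_not_surjective[OF m])
    fix t' assume t': "t \<le> t'" "t' < t + 2 ^ G.dim (K.ker_upto m t) * Suc T_dim"
    have "G.dim (K.ker_upto m t) \<le> G.dim (g t)"
      by (rule G.dim_mono_fin_dim[OF K.fin_dim_W K.ker_upto_subset])
    also have "\<dots> \<le> d" unfolding d_def using t by (intro Max_ge) auto
    finally have "2 ^ G.dim (K.ker_upto m t) * Suc T_dim \<le> 2 ^ d * Suc T_dim"
      by (intro mult_right_mono power_increasing) auto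
    then show "K.exact_at m t'" using t t' by (intro ex) (auto simp: R'_def)
  qed
  obtain q where q: "\<And>x. P (shift_coframe m x b) = poly q x"
    using polynomial_shift_coframe[OF P] by blast
  \<comment> \<open>At \<open>x = 0\<close> the coframe is the old one, where \<open>P\<close> does
    not vanish.\<close>
  have "q \<noteq> 0" using q[of 0] eb(2) by (auto simp: shift_coframe_0)
  then have "finite ({x. poly q x = 0} \<union> (\<Union>t\<in>{k..R}. ?bad t))"
    using fin by (intro finite_UnI finite_UN_I poly_roots_finite) simp_all
  from ex_new_if_finite[OF infinite_UNIV_char_0 this]
  obtain x where "x \<notin> {x. poly q x = 0} \<union> (\<Union>t\<in>{k..R}. ?bad t)" ..
  then have x: "poly q x \<noteq> 0" "\<And>t. k \<le> t \<Longrightarrow> t \<le> R \<Longrightarrow> x \<notin> ?bad t" by auto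
  let ?e = "shift_frame m x e" and ?b = "shift_coframe m x b"
  have eb': "dual_frame ?e ?b" by (rule dual_frame_shift[OF eb(1) m])
  interpret K': koszul_system "fscale sN" "\<lambda>a. contract (?e a)" g T_dim
    by (rule koszul_system_contract[OF sys eb'])
  have sh: "?e a = e a" if "a \<noteq> m" for a using that by (simp add: shift_frame_def)
  \<comment> \<open>Kernels up to index \<open>m\<close> involve only \<open>e a\<close> with
    \<open>a < m\<close>, which do not move. Hence the earlier surjectivity survives, and
    \<open>?bad t\<close> speaks of the kernels of the new frame as well.\<close>
  have ker: "K'.ker_upto i t = K.ker_upto i t" if "i \<le> m" for i t
    using that sh by (auto simp: K'.ker_upto_def K.ker_upto_def)
  have "K'.surj_at i t" if "i < Suc m" "k \<le> t" "t \<le> R" for i t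
  proof (cases "i < m")
    case True
    then have "K.surj_at i t" using surj that by (simp add: R'_def)
    then show ?thesis using True by (simp add: K'.surj_at_def K.surj_at_def ker sh)
  next
    case False
    then have "i = m" using that by simp
    have "contract (?e m) w = (\<Sum>i<T_dim - m. fscale sN (x ^ i) (contract (e (m + i)) w))"
      if "w \<in> K.ker_upto m (Suc t)" for w
    proof -
      have "w \<in> SymN (Suc t) dual"
        using that K.ker_upto_subset symbolic_system_subset[OF sys] by blast
      then show ?thesis
        by (simp add: shift_frame_def contract_def sum_fun_apply fscale_def fun_eq_iff
            SymN_sum[OF _ subset_refl] SymN_scale[OF _ subset_refl])
    qed
    then show ?thesis using x(2)[OF that(2,3)]
      unfolding K'.surj_at_def \<open>i = m\<close> by (simp add: ker cong: image_cong_simp)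
  qed
  then show ?case using eb' q x(1) by metis
qed

end

section \<open>Exterior forms\<close>

lemma omit_Cons_0 [simp]: "omit 0 (y # ys) = ys"
  by (simp add: omit_def)

lemma omit_Cons_Suc [simp]: "omit (Suc a) (y # ys) = y # omit a ys"
  by (simp add: omit_def)

lemma wedge_Nil [simp]: "wedge p \<omega> [] = 0"
  by (simp add: wedge_def)

lemma wedge_Cons: "wedge p \<omega> (y # ys) = p y * \<omega> ys - wedge p (\<lambda>zs. \<omega> (y # zs)) ys"
  by (simp add: wedge_def sum.lessThan_Suc_shift sum_negf del: sum.lessThan_Suc)

lemma wedge_lincomb:
  "wedge p (\<lambda>zs. c * \<omega> zs - \<omega>' zs) ys = c * wedge p \<omega> ys - wedge p \<omega>' ys"
  by (simp add: wedge_def sum_subtractf sum_distrib_left algebra_simps)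

lemma wedge_add: "wedge p (\<omega> + \<omega>') = wedge p \<omega> + wedge p \<omega>'"
  by (auto simp: wedge_def sum.distrib distrib_left)

lemma wedge_scale: "wedge p (fscale (*) c \<omega>) = fscale (*) c (wedge p \<omega>)"
  by (auto simp: wedge_def fscale_def sum_distrib_left mult_ac)

lemma wedge_const_0: "wedge p (\<lambda>zs. 0) ys = 0"
  by (simp add: wedge_def)

lemma wedge_0: "wedge p 0 = 0"
  by (auto simp: wedge_def)

lemma wedge_wedge: "wedge p (wedge q \<omega>) = - wedge q (wedge p \<omega>)"
proof
  fix ys
  show "wedge p (wedge q \<omega>) ys = (- wedge q (wedge p \<omega>)) ys"
  proof (induction ys arbitrary: \<omega>)
    case (Cons y ys)
    then show ?case by (simp add: wedge_Cons wedge_lincomb)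
  qed simp
qed

lemma wedge_self: "wedge p (wedge p \<omega>) = (0 :: 't list \<Rightarrow> 'k::field_char_0)"
  using wedge_wedge[of p p \<omega>] by (auto simp: fun_eq_iff eq_neg_iff_add_eq_0)

lemma wedge_zero: "(\<And>y. y \<in> set ys \<Longrightarrow> p y = 0) \<Longrightarrow> wedge p \<omega> ys = 0"
  by (simp add: wedge_def)

lemma wedge_list_Nil: "wedge_list [] ys = (if ys = [] then 1 else 0)"
  by (simp add: wedge_list_def)

lemma wedge_list_Cons: "wedge_list (q # qs) = wedge q (wedge_list qs)"
  by (simp add: wedge_list_def)

lemma wedge_list_zero: "(\<And>q. q \<in> set qs \<Longrightarrow> q y = 0) \<Longrightarrow> wedge_list qs (y # zs) = 0"
proof (induction qs arbitrary: zs)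
  case (Cons q qs)
  then show ?case by (simp add: wedge_list_Cons wedge_Cons wedge_const_0)
qed (simp add: wedge_list_Nil)

lemma finite_chains: "finite {as \<in> chains 0 n. length as = j}"
  and card_chains: "card {as \<in> chains 0 n. length as = j} = n choose j"
proof -
  have "bij_betw set {as \<in> chains 0 n. length as = j} {A. A \<subseteq> {..<n} \<and> card A = j}"
  proof (rule bij_betwI[where g = sorted_list_of_set])
    show "set \<in> {as \<in> chains 0 n. length as = j} \<rightarrow> {A. A \<subseteq> {..<n} \<and> card A = j}"
      by (auto simp: chains_def strict_sorted_iff distinct_card)
    show "sorted_list_of_set \<in> {A. A \<subseteq> {..<n} \<and> card A = j} \<rightarrow> {as \<in> chains 0 n. length as = j}"
      using finite_subset[OF _ finite_lessThan[of n]] by (fastforce simp: chains_def)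
    show "sorted_list_of_set (set as) = as" if "as \<in> {as \<in> chains 0 n. length as = j}" for as
      using that by (auto simp: chains_def strict_sorted_iff sorted_distinct_set_unique)
    show "set (sorted_list_of_set A) = A" if "A \<in> {A. A \<subseteq> {..<n} \<and> card A = j}" for A
      using that finite_subset[OF _ finite_lessThan[of n]] by auto
  qed
  note bij = this
  have "finite {A. A \<subseteq> {..<n} \<and> card A = j}" by simp
  then show "finite {as \<in> chains 0 n. length as = j}" using bij_betw_finite[OF bij] by simp
  show "card {as \<in> chains 0 n. length as = j} = n choose j"
    using bij_betw_same_card[OF bij] n_subsets[of "{..<n}" j] by simp
qed

context symbol_spaces
begin

abbreviation chains_of :: "nat \<Rightarrow> nat list set"
  where "chains_of j \<equiv> {as \<in> chains 0 T_dim. length as = j}"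

text \<open>Compare the first indices: if \<open>a < c\<close>, then \<open>b a\<close> kills every
  argument; if \<open>a > c\<close>, every factor kills \<open>e c\<close>; if they agree, only the
  first term of the expansion along \<open>e c\<close> is left.\<close>

lemma wedge_list_frame:
  assumes "dual_frame e b" "as \<in> chains m T_dim" "cs \<in> chains m' T_dim"
  shows "wedge_list (map b as) (map e cs) = (if as = cs then 1 else 0)"
  using assms(2,3)
proof (induction as arbitrary: cs m m')
  case Nil
  then show ?case by (simp add: wedge_list_Nil)
next
  case (Cons a as)
  have be: "b a (e c) = (if a = c then 1 else 0)" if "a < T_dim" "c < T_dim" for a c
    using assms(1) that by (simp add: dual_frame_def)
  show ?case
  proof (cases cs)
    case Nil
    then show ?thesis by (simp add: wedge_list_Cons)
  next
    case cs: (Cons c cs')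
    have bnd: "a < T_dim" "c < T_dim" "\<And>i. i \<in> set as \<Longrightarrow> a < i \<and> i < T_dim"
      "\<And>i. i \<in> set cs' \<Longrightarrow> c < i \<and> i < T_dim"
      using Cons.prems cs by (auto simp: chains_def)
    show ?thesis
    proof (cases "a < c")
      case True
      have "wedge (b a) (wedge_list (map b as)) (map e cs) = 0"
        using True bnd be cs by (intro wedge_zero) force
      then show ?thesis using True cs by (simp add: wedge_list_Cons)
    next
      case False
      have "wedge_list (map b as) (e c # zs) = 0" for zs
        using False bnd be by (intro wedge_list_zero) force
      then have "wedge_list (map b (a # as)) (map e cs) = b a (e c) * wedge_list (map b as) (map e cs')"
        by (simp add: cs wedge_list_Cons wedge_Cons) (simp add: wedge_def)
      also have "\<dots> = (if a # as = cs then 1 else 0)"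
        using Cons.IH[of "Suc a" cs' "Suc c"] Cons.prems be[of a c] bnd by (simp add: cs)
      finally show ?thesis .
    qed
  qed
qed

lemma wedge_list_Ext: "dual_frame e b \<Longrightarrow> as \<in> chains_of j \<Longrightarrow> wedge_list (map b as) \<in> Ext j"
  unfolding Ext_def
  by (intro F.span_base CollectI exI[of _ "map b as"]) (auto simp: chains_def dual_frame_def)

text \<open>Insertion of \<open>b a\<close> into its sorted place: anticommutation moves it past
  smaller indices, and a repeated factor gives zero. The lower bound \<open>m\<close> is raised in
  the induction so that the factor \<open>b c\<close> can be put back in front.\<close>

lemma wedge_coframe_span:
  assumes "as \<in> chains m T_dim" "m \<le> a" "a < T_dim"
  shows "wedge (b a) (wedge_list (map b as))
    \<in> F.span {wedge_list (map b ds) | ds. ds \<in> chains m T_dim \<and> length ds = Suc (length as)}"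
  using assms(1,2)
proof (induction as arbitrary: m)
  case Nil
  then show ?case using assms(3)
    by (intro F.span_base CollectI exI[of _ "[a]"]) (simp add: wedge_list_Cons)
next
  case (Cons c cs)
  let ?S = "{wedge_list (map b ds) | ds. ds \<in> chains m T_dim \<and> length ds = Suc (length (c # cs))}"
  consider "a < c" | "a = c" | "c < a" by linarith
  then show ?case
  proof cases
    case 1
    then show ?thesis using Cons.prems assms(3)
      by (intro F.span_base CollectI exI[of _ "a # c # cs"]) (simp add: wedge_list_Cons)
  next
    case 2
    then have "wedge (b a) (wedge_list (map b (c # cs))) = 0"
      by (simp only: list.map wedge_list_Cons wedge_self)
    then show ?thesis by (simp only: F.span_zero)
  next
    case 3
    have "wedge (b a) (wedge_list (map b cs))
      \<in> F.span {wedge_list (map b ds) | ds. ds \<in> chains (Suc c) T_dim \<and> length ds = Suc (length cs)}"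
      using Cons.prems 3 by (intro Cons.IH) auto
    then have "wedge (b c) (wedge (b a) (wedge_list (map b cs))) \<in> F.span ?S"
    proof (rule F.span_induct)
      show "F.subspace {\<omega>. wedge (b c) \<omega> \<in> F.span ?S}"
        by (simp add: F.subspace_def wedge_add wedge_scale wedge_0 F.span_add F.span_scale F.span_zero)
      fix \<omega> assume "\<omega> \<in> {wedge_list (map b ds) | ds. ds \<in> chains (Suc c) T_dim \<and> length ds = Suc (length cs)}"
      then obtain ds where "\<omega> = wedge_list (map b ds)" "ds \<in> chains (Suc c) T_dim" "length ds = Suc (length cs)"
        by blast
      then show "wedge (b c) \<omega> \<in> F.span ?S" using Cons.prems
        by (intro F.span_base CollectI exI[of _ "c # ds"]) (simp add: wedge_list_Cons)
    qed
    moreover have "wedge (b a) (wedge_list (map b (c # cs))) = - wedge (b c) (wedge (b a) (wedge_list (map b cs)))"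
      unfolding list.map wedge_list_Cons by (rule wedge_wedge)
    ultimately show ?thesis by (simp only: F.span_neg)
  qed
qed

lemma wedge_sum_left: "wedge (\<Sum>a\<in>A. fscale (*) (c a) (q a)) \<omega> = (\<Sum>a\<in>A. fscale (*) (c a) (wedge (q a) \<omega>))"
  for q :: "'i \<Rightarrow> 't \<Rightarrow> 'k"
proof
  fix ys
  have "wedge (\<Sum>a\<in>A. fscale (*) (c a) (q a)) \<omega> ys =
      (\<Sum>l<length ys. \<Sum>a\<in>A. c a * ((- 1) ^ l * q a (ys ! l) * \<omega> (omit l ys)))"
    unfolding wedge_def sum_fun_apply fscale_def sum_distrib_left sum_distrib_right
    by (intro sum.cong refl) (simp only: mult_ac)
  also have "\<dots> = (\<Sum>a\<in>A. \<Sum>l<length ys. c a * ((- 1) ^ l * q a (ys ! l) * \<omega> (omit l ys)))"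
    by (rule sum.swap)
  also have "\<dots> = (\<Sum>a\<in>A. fscale (*) (c a) (wedge (q a) \<omega>)) ys"
    by (simp add: sum_fun_apply fscale_def wedge_def sum_distrib_left)
  finally show "wedge (\<Sum>a\<in>A. fscale (*) (c a) (q a)) \<omega> ys = (\<Sum>a\<in>A. fscale (*) (c a) (wedge (q a) \<omega>)) ys" .
qed

lemma Ext_subset_span:
  assumes eb: "dual_frame e b"
  shows "Ext j \<subseteq> F.span ((\<lambda>as. wedge_list (map b as)) ` chains_of j)"
proof -
  have "wedge_list qs \<in> F.span ((\<lambda>as. wedge_list (map b as)) ` chains_of (length qs))"
    if "set qs \<subseteq> dual" for qs
    using that
  proof (induction qs)
    case Nil
    then show ?case by (intro F.span_base image_eqI[of _ _ "[]"]) auto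
  next
    case (Cons q qs)
    let ?S = "F.span ((\<lambda>as. wedge_list (map b as)) ` chains_of (length (q # qs)))"
    have "wedge_list qs \<in> F.span ((\<lambda>as. wedge_list (map b as)) ` chains_of (length qs))"
      using Cons by simp
    then have "wedge (b a) (wedge_list qs) \<in> ?S" if "a < T_dim" for a
    proof (rule F.span_induct)
      show "F.subspace {\<omega>. wedge (b a) \<omega> \<in> ?S}"
        by (simp add: F.subspace_def wedge_add wedge_scale wedge_0 F.span_add F.span_scale F.span_zero)
      fix \<omega> assume "\<omega> \<in> (\<lambda>as. wedge_list (map b as)) ` chains_of (length qs)"
      then obtain as where as: "as \<in> chains 0 T_dim" "length as = length qs" "\<omega> = wedge_list (map b as)"
        by blast
      have "{wedge_list (map b ds) | ds. ds \<in> chains 0 T_dim \<and> length ds = Suc (length as)} =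
          (\<lambda>as. wedge_list (map b as)) ` chains_of (length (q # qs))"
        using as by auto
      then show "wedge (b a) \<omega> \<in> ?S"
        using wedge_coframe_span[OF as(1) le0 that, of b] as by simp
    qed
    then have "(\<Sum>a<T_dim. fscale (*) (q (e a)) (wedge (b a) (wedge_list qs))) \<in> ?S"
      by (intro F.span_sum F.span_scale) simp
    moreover have q: "q = (\<Sum>a<T_dim. fscale (*) (q (e a)) (b a))"
      using Cons.prems by (intro dual_frame_expand[OF eb]) simp
    have "wedge q (wedge_list qs) = (\<Sum>a<T_dim. fscale (*) (q (e a)) (wedge (b a) (wedge_list qs)))"
      by (rule trans[OF arg_cong[OF q, of "\<lambda>q. wedge q (wedge_list qs)"] wedge_sum_left])
    ultimately show ?case by (simp only: wedge_list_Cons)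
  qed
  then show ?thesis unfolding Ext_def
    by (intro F.span_minimal F.subspace_span) auto
qed

lemma Ext_expand:
  assumes eb: "dual_frame e b" and "\<omega> \<in> Ext j"
  shows "\<omega> ys = (\<Sum>as\<in>chains_of j. \<omega> (map e as) * wedge_list (map b as) ys)"
proof -
  have "\<omega> \<in> F.span ((\<lambda>as. wedge_list (map b as)) ` chains_of j)"
    using Ext_subset_span[OF eb] assms(2) by (rule subsetD)
  then show ?thesis
  proof (rule F.span_induct)
    show "F.subspace {\<omega>. \<omega> ys = (\<Sum>as\<in>chains_of j. \<omega> (map e as) * wedge_list (map b as) ys)}"
      by (simp add: F.subspace_def fscale_def distrib_right sum.distrib sum_distrib_left mult.assoc)
    fix \<omega> assume "\<omega> \<in> (\<lambda>as. wedge_list (map b as)) ` chains_of j"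
    then obtain cs where cs: "cs \<in> chains_of j" "\<omega> = wedge_list (map b cs)" by blast
    have "(\<Sum>as\<in>chains_of j. \<omega> (map e as) * wedge_list (map b as) ys) =
        (\<Sum>as\<in>chains_of j. if as = cs then wedge_list (map b as) ys else 0)"
      using cs by (intro sum.cong) (auto simp: wedge_list_frame[OF eb])
    then show "\<omega> ys = (\<Sum>as\<in>chains_of j. \<omega> (map e as) * wedge_list (map b as) ys)"
      using cs by (simp add: finite_chains)
  qed
qed

lemma tensor_Ext_expand:
  assumes eb: "dual_frame e b" and "h \<in> tensor_Ext W j"
  shows "h xs ys = (\<Sum>as\<in>chains_of j. sN (wedge_list (map b as) ys) (h xs (map e as)))"
  using assms(2) unfolding tensor_Ext_def
proof (rule C.span_induct)
  show "C.subspace {h. h xs ys = (\<Sum>as\<in>chains_of j. sN (wedge_list (map b as) ys) (h xs (map e as)))}"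
    by (simp add: C.subspace_def fscale_def N.scale_right_distrib sum.distrib N.scale_sum_right
        mult.commute)
  fix h assume "h \<in> {tensor_form f \<omega> | f \<omega>. f \<in> W \<and> \<omega> \<in> Ext j}"
  then obtain f \<omega> where h: "h = tensor_form f \<omega>" and \<omega>: "\<omega> \<in> Ext j" by blast
  show "h xs ys = (\<Sum>as\<in>chains_of j. sN (wedge_list (map b as) ys) (h xs (map e as)))"
    using arg_cong[OF Ext_expand[OF eb \<omega>, of ys], of "\<lambda>c. sN c (f xs)"]
    by (simp add: h tensor_form_def N.scale_sum_left mult.commute)
qed

lemma tensor_Ext_slice:
  assumes W: "G.subspace W" and "h \<in> tensor_Ext W j"
  shows "(\<lambda>xs. h xs ys) \<in> W"
  using assms(2) unfolding tensor_Ext_def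
proof (rule C.span_induct)
  have "(\<lambda>xs. (h + h') xs ys) = (\<lambda>xs. h xs ys) + (\<lambda>xs. h' xs ys)"
    "(\<lambda>xs. fscale (fscale sN) c h xs ys) = fscale sN c (\<lambda>xs. h xs ys)"
    for h h' :: "'t list \<Rightarrow> 't list \<Rightarrow> 'v" and c
    by (auto simp: fscale_def)
  then show "C.subspace {h. (\<lambda>xs. h xs ys) \<in> W}"
    using W unfolding C.subspace_def G.subspace_def mem_Collect_eq by (auto simp: zero_fun_def)
  fix h assume "h \<in> {tensor_form f \<omega> | f \<omega>. f \<in> W \<and> \<omega> \<in> Ext j}"
  then obtain f \<omega> where h: "h = tensor_form f \<omega>" and f: "f \<in> W" by blast
  have "(\<lambda>xs. h xs ys) = fscale sN (\<omega> ys) f" by (auto simp: h tensor_form_def fscale_def)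
  then show "(\<lambda>xs. h xs ys) \<in> W" using G.subspace_scale[OF W f] by simp
qed

lemma tensor_form_in: "f \<in> W \<Longrightarrow> \<omega> \<in> Ext j \<Longrightarrow> tensor_form f \<omega> \<in> tensor_Ext W j"
  unfolding tensor_Ext_def by (intro C.span_base) blast

lemma subspace_tensor_Ext: "C.subspace (tensor_Ext W j)"
  unfolding tensor_Ext_def by simp

text \<open>The inverse of reading off the coefficients \<open>h xs (map e as)\<close>; it turns
  Koszul cochains into elements of the Spencer complex.\<close>

definition assemble :: "(nat \<Rightarrow> 't \<Rightarrow> 'k) \<Rightarrow> nat \<Rightarrow> (nat list \<Rightarrow> 't list \<Rightarrow> 'v) \<Rightarrow> 't list \<Rightarrow> 't list \<Rightarrow> 'v"
  where "assemble b j c = (\<Sum>as\<in>chains_of j. tensor_form (c as) (wedge_list (map b as)))"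

lemma assemble_in:
  assumes "dual_frame e b" "\<And>as. as \<in> chains_of j \<Longrightarrow> c as \<in> W"
  shows "assemble b j c \<in> tensor_Ext W j"
  unfolding assemble_def
  using assms by (intro C.subspace_sum[OF subspace_tensor_Ext] tensor_form_in wedge_list_Ext) auto

lemma assemble_frame:
  assumes "dual_frame e b" "as \<in> chains_of j"
  shows "assemble b j c xs (map e as) = c as xs"
proof -
  have "assemble b j c xs (map e as) =
      (\<Sum>cs\<in>chains_of j. sN (wedge_list (map b cs) (map e as)) (c cs xs))"
    by (simp add: assemble_def sum_fun_apply tensor_form_def)
  also have "\<dots> = (\<Sum>cs\<in>chains_of j. if cs = as then c cs xs else 0)"
    using assms(2) by (intro sum.cong) (auto simp: wedge_list_frame[OF assms(1)])
  also have "\<dots> = c as xs" using assms(2) by (simp add: finite_chains)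
  finally show ?thesis .
qed

lemma tensor_Ext_eqI:
  assumes "dual_frame e b" "h \<in> tensor_Ext W j" "h' \<in> tensor_Ext W' j"
    and "\<And>as xs. as \<in> chains_of j \<Longrightarrow> h xs (map e as) = h' xs (map e as)"
  shows "h = h'"
proof (intro ext)
  fix xs ys
  show "h xs ys = h' xs ys"
    unfolding tensor_Ext_expand[OF assms(1,2), of xs ys] tensor_Ext_expand[OF assms(1,3), of xs ys]
    using assms(4) by (intro sum.cong) simp_all
qed

lemma dim_tensor_Ext:
  assumes eb: "dual_frame e b" and W: "G.subspace W" "G.fin_dim W"
  shows "C.dim (tensor_Ext W j) = (T_dim choose j) * G.dim W" (is ?dim)
    and "C.fin_dim (tensor_Ext W j)" (is ?fin)
proof -
  obtain B where B: "finite B" "B \<subseteq> W" "G.independent B" "W \<subseteq> G.span B" "card B = G.dim W"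
    by (rule G.fin_dim_basis[OF W(2)])
  let ?I = "chains_of j \<times> B"
  define F where "F = (\<lambda>(as, w). tensor_form w (wedge_list (map b as)))"
  have finI: "finite ?I" using B(1) finite_chains by simp
  have F_in: "F ` ?I \<subseteq> tensor_Ext W j"
    using B(2) wedge_list_Ext[OF eb] by (auto simp: F_def intro!: tensor_form_in)
  have in_span: "tensor_Ext W j \<subseteq> C.span (F ` ?I)"
  proof
    fix h assume h: "h \<in> tensor_Ext W j"
    have "tensor_form w (wedge_list (map b as)) \<in> C.span (F ` ?I)" if "as \<in> chains_of j" "w \<in> W" for as w
    proof -
      obtain u where u: "w = (\<Sum>v\<in>B. fscale sN (u v) v)"
        using \<open>w \<in> W\<close> B(4) G.span_finite[OF B(1)] by auto
      have "tensor_form w (wedge_list (map b as)) = (\<Sum>v\<in>B. fscale (fscale sN) (u v) (F (as, v)))"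
        unfolding u
        by (auto simp: tensor_form_def F_def sum_fun_apply fscale_def N.scale_sum_right mult.commute
            intro!: ext)
      then show ?thesis
        using \<open>as \<in> chains_of j\<close>
        by (simp only:) (intro C.span_sum C.span_scale C.span_base imageI SigmaI)
    qed
    then have "assemble b j (\<lambda>as xs. h xs (map e as)) \<in> C.span (F ` ?I)"
      unfolding assemble_def using tensor_Ext_slice[OF W(1) h] by (intro C.span_sum) simp
    moreover have "assemble b j (\<lambda>as xs. h xs (map e as)) = h"
      using tensor_Ext_slice[OF W(1) h]
      by (intro tensor_Ext_eqI[OF eb assemble_in[OF eb] h] assemble_frame[OF eb])
    ultimately show "h \<in> C.span (F ` ?I)" by simp
  qed
  have "C.dim (tensor_Ext W j) = card ?I"
  proof (rule C.dim_family[OF finI _ F_in in_span])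
    fix c assume 0: "(\<Sum>i\<in>?I. fscale (fscale sN) (c i) (F i)) = 0"
    show "\<forall>i\<in>?I. c i = 0"
    proof
      fix i assume "i \<in> ?I"
      then obtain as w where i: "i = (as, w)" "as \<in> chains_of j" "w \<in> B" by blast
      have "(\<Sum>v\<in>B. fscale sN (c (as, v)) v) = 0"
      proof
        fix xs
        have "0 = (\<Sum>i\<in>?I. fscale (fscale sN) (c i) (F i)) xs (map e as)" using 0 by simp
        also have "\<dots> = (\<Sum>cs\<in>chains_of j. \<Sum>v\<in>B.
            sN (c (cs, v)) (sN (wedge_list (map b cs) (map e as)) (v xs)))"
          by (simp add: sum_fun_apply fscale_def F_def tensor_form_def sum.cartesian_product)
             (simp add: case_prod_beta')
        also have "\<dots> = (\<Sum>cs\<in>chains_of j. if cs = as then \<Sum>v\<in>B. sN (c (cs, v)) (v xs) else 0)"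
          using i(2) by (intro sum.cong) (auto simp: wedge_list_frame[OF eb])
        also have "\<dots> = (\<Sum>v\<in>B. sN (c (as, v)) (v xs))" using i(2) by (simp add: finite_chains)
        finally show "(\<Sum>v\<in>B. fscale sN (c (as, v)) v) xs = 0 xs"
          by (simp add: sum_fun_apply fscale_def)
      qed
      from G.independent_sum_zero[OF B(1,3) this i(3)] show "c i = 0" by (simp add: i)
    qed
  qed
  then show ?dim using B(5) by (simp add: card_cartesian_product card_chains)
  show ?fin unfolding C.fin_dim_def using finI in_span by (intro exI[of _ "F ` ?I"]) simp
qed

lemma spencer_delta_add: "spencer_delta (f + h) = spencer_delta f + spencer_delta h"
  by (intro ext) (simp add: spencer_delta_def N.scale_right_distrib sum.distrib)

lemma spencer_delta_scale:
  "spencer_delta (fscale (fscale sN) c f) = fscale (fscale sN) c (spencer_delta f)"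
  by (intro ext)
    (simp add: spencer_delta_def fscale_def N.scale_sum_right mult_ac)

lemma linear_spencer_delta:
  "Vector_Spaces.linear (fscale (fscale sN)) (fscale (fscale sN)) spencer_delta"
  by (simp add: Vector_Spaces.linear_iff C.vector_space_axioms spencer_delta_add spencer_delta_scale)


section \<open>The Spencer complex in a frame\<close>

text \<open>Both sides are the same alternating sum, peeled off at its first index. The weight
  depends on \<open>length xs\<close>; it becomes a constant scalar only for values of one fixed
  degree, which later arguments get from \<open>SymN_length\<close>.\<close>

lemma spencer_delta_frame:
  assumes sys: "symbolic_system k g" and eb: "dual_frame e b"
  shows "spencer_delta f xs (map e as) = sN (of_nat (Suc (length xs)))
    (koszul_system.koszul (\<lambda>a. contract (e a)) (\<lambda>as xs. f xs (map e as)) as xs)"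
proof -
  interpret K: koszul_system "fscale sN" "\<lambda>a. contract (e a)" g T_dim
    by (rule koszul_system_contract[OF sys eb])
  have "(\<Sum>a<length (map e as). sN ((- 1) ^ a) (f (map e as ! a # xs) (omit a (map e as)))) =
      K.koszul (\<lambda>as xs. f xs (map e as)) as xs"
  proof (induction as arbitrary: f)
    case (Cons a as)
    let ?f = "\<lambda>xs zs. f xs (e a # zs)"
    have "(\<Sum>i<length (map e (a # as)). sN ((- 1) ^ i) (f (map e (a # as) ! i # xs) (omit i (map e (a # as))))) =
        f (e a # xs) (map e as) -
        (\<Sum>i<length (map e as). sN ((- 1) ^ i) (?f (map e as ! i # xs) (omit i (map e as))))"
      by (simp add: sum.lessThan_Suc_shift sum_negf del: sum.lessThan_Suc)
    also have "\<dots> = f (e a # xs) (map e as) - K.koszul (\<lambda>as xs. ?f xs (map e as)) as xs"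
      by (simp only: Cons[of ?f])
    also have "\<dots> = K.koszul (\<lambda>as xs. f xs (map e as)) (a # as) xs"
      unfolding K.koszul.simps minus_apply contract_apply list.map ..
    finally show ?case .
  qed simp
  then show ?thesis by (simp add: spencer_delta_def)
qed

text \<open>The differential becomes a sum of elementary tensors, contraction with
  \<open>e a\<close> paired with exterior multiplication by \<open>b a\<close>, so membership in the
  next space of the complex can be checked termwise.\<close>

lemma spencer_delta_tensor_form:
  assumes eb: "dual_frame e b" and w: "w \<in> SymN (Suc i) dual"
  shows "spencer_delta (tensor_form w \<omega>) =
    (\<Sum>a<T_dim. tensor_form (fscale sN (of_nat (Suc i)) (contract (e a) w)) (wedge (b a) \<omega>))"
proof (intro ext)
  fix xs ys
  show "spencer_delta (tensor_form w \<omega>) xs ys =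
    (\<Sum>a<T_dim. tensor_form (fscale sN (of_nat (Suc i)) (contract (e a) w)) (wedge (b a) \<omega>)) xs ys"
  proof (cases "length xs = i")
    case False
    then have "w (x # xs) = 0" for x using SymN_length[OF w] by simp
    then show ?thesis
      by (simp add: spencer_delta_def tensor_form_def sum_fun_apply contract_def fscale_def)
  next
    case True
    have "(\<Sum>l<length ys. sN ((- 1) ^ l) (tensor_form w \<omega> (ys ! l # xs) (omit l ys))) =
        (\<Sum>l<length ys. \<Sum>a<T_dim. sN ((- 1) ^ l * b a (ys ! l) * \<omega> (omit l ys)) (w (e a # xs)))"
    proof (intro sum.cong refl)
      fix l
      have "w (ys ! l # xs) = (\<Sum>a<T_dim. sN (b a (ys ! l)) (w (e a # xs)))"
        by (rule SymN_expand[OF eb w subset_refl])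
      then show "sN ((- 1) ^ l) (tensor_form w \<omega> (ys ! l # xs) (omit l ys)) =
          (\<Sum>a<T_dim. sN ((- 1) ^ l * b a (ys ! l) * \<omega> (omit l ys)) (w (e a # xs)))"
        by (simp add: tensor_form_def N.scale_sum_right mult_ac)
    qed
    also have "\<dots> = (\<Sum>a<T_dim. sN (wedge (b a) \<omega> ys) (w (e a # xs)))"
      unfolding wedge_def N.scale_sum_left by (rule sum.swap)
    finally have eq: "(\<Sum>l<length ys. sN ((- 1) ^ l) (tensor_form w \<omega> (ys ! l # xs) (omit l ys))) = \<dots>" .
    show ?thesis
      unfolding spencer_delta_def eq unfolding sum_fun_apply N.scale_sum_right True
      by (simp add: tensor_form_def contract_apply fscale_def mult.commute)
  qed
qed

lemma spencer_delta_in: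
  assumes sys: "symbolic_system k g" and eb: "dual_frame e b" and f: "f \<in> tensor_Ext (g (Suc i)) j"
  shows "spencer_delta f \<in> tensor_Ext (g i) (Suc j)"
  using f unfolding tensor_Ext_def[of "g (Suc i)"]
proof (rule C.span_induct)
  have "spencer_delta 0 = 0"
    using spencer_delta_scale[of 0 0] by simp
  then show "C.subspace {f. spencer_delta f \<in> tensor_Ext (g i) (Suc j)}"
    using subspace_tensor_Ext[of "g i" "Suc j"]
    by (simp add: C.subspace_def spencer_delta_add spencer_delta_scale)
  fix f assume "f \<in> {tensor_form w \<omega> | w \<omega>. w \<in> g (Suc i) \<and> \<omega> \<in> Ext j}"
  then obtain w \<omega> where f: "f = tensor_form w \<omega>" and w: "w \<in> g (Suc i)" and \<omega>: "\<omega> \<in> Ext j" by blast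
  have w_Sym: "w \<in> SymN (Suc i) dual" using symbolic_system_subset[OF sys] w by (rule subsetD)
  have "tensor_form (fscale sN (of_nat (Suc i)) (contract (e a) w)) (wedge (b a) \<omega>) \<in> tensor_Ext (g i) (Suc j)"
    if "a < T_dim" for a
  proof (rule tensor_form_in)
    show "fscale sN (of_nat (Suc i)) (contract (e a) w) \<in> g i"
      by (rule G.subspace_scale[OF symbolic_system_subspace[OF sys] contract_symbolic_system[OF sys w]])
    show "wedge (b a) \<omega> \<in> Ext (Suc j)"
      using \<omega> unfolding Ext_def[of j]
    proof (rule F.span_induct)
      show "F.subspace {\<omega>. wedge (b a) \<omega> \<in> Ext (Suc j)}"
        by (simp add: F.subspace_def wedge_add wedge_scale wedge_0 F.span_add F.span_scale F.span_zero Ext_def)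
      fix \<omega> assume "\<omega> \<in> {wedge_list qs | qs. length qs = j \<and> set qs \<subseteq> dual}"
      then obtain qs where "\<omega> = wedge_list qs" "length qs = j" "set qs \<subseteq> dual" by blast
      then show "wedge (b a) \<omega> \<in> Ext (Suc j)"
        unfolding Ext_def using eb that
        by (intro F.span_base CollectI exI[of _ "b a # qs"]) (simp add: wedge_list_Cons dual_frame_def)
    qed
  qed
  then show "spencer_delta f \<in> tensor_Ext (g i) (Suc j)"
    unfolding f spencer_delta_tensor_form[OF eb w_Sym]
    by (intro C.subspace_sum[OF subspace_tensor_Ext]) simp
qed

lemma spencer_delta_degree_0:
  assumes sys: "symbolic_system k g" and f: "f \<in> tensor_Ext (g 0) j"
  shows "spencer_delta f = 0"
proof (intro ext)
  fix xs ys
  have "f (x # xs) zs = 0" for x zs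
  proof -
    have "(\<lambda>xs. f xs zs) \<in> SymN 0 dual"
      using tensor_Ext_slice[OF symbolic_system_subspace[OF sys] f] symbolic_system_subset[OF sys] by blast
    from SymN_length[OF this, of "x # xs"] show ?thesis by simp
  qed
  then show "spencer_delta f xs ys = 0 xs ys" by (simp add: spencer_delta_def)
qed

text \<open>The factor \<open>Suc (length xs)\<close> can be cancelled in characteristic 0, and an
  element of \<open>tensor_Ext\<close> is determined by its values on the chains of the
  frame.\<close>

lemma spencer_delta_eq_0_iff:
  assumes sys: "symbolic_system k g" and eb: "dual_frame e b" and f: "f \<in> tensor_Ext (g (Suc i)) j"
  shows "spencer_delta f = 0 \<longleftrightarrow>
    (\<forall>as\<in>chains_of (Suc j). koszul_system.koszul (\<lambda>a. contract (e a)) (\<lambda>as xs. f xs (map e as)) as = 0)"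
    (is "_ \<longleftrightarrow> (\<forall>as\<in>_. ?K as = 0)")
proof
  assume 0: "spencer_delta f = 0"
  have "?K as xs = 0" for as xs
  proof -
    have "sN (of_nat (Suc (length xs))) (?K as xs) = 0"
      using spencer_delta_frame[OF sys eb, of f xs as] 0 by simp
    then show ?thesis by (simp del: of_nat_Suc)
  qed
  then show "\<forall>as\<in>chains_of (Suc j). ?K as = 0" by (simp add: fun_eq_iff)
next
  assume 0: "\<forall>as\<in>chains_of (Suc j). ?K as = 0"
  show "spencer_delta f = 0"
  proof (rule tensor_Ext_eqI[OF eb spencer_delta_in[OF sys eb f] C.subspace_0[OF subspace_tensor_Ext]])
    show "spencer_delta f xs (map e as) = 0 xs (map e as)" if "as \<in> chains_of (Suc j)" for as xs
      using 0 that by (simp only: spencer_delta_frame[OF sys eb]) simp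
  qed
qed

lemma spencer_delta_spencer_delta:
  assumes sys: "symbolic_system k g" and eb: "dual_frame e b" and f: "f \<in> tensor_Ext (g (Suc i)) j"
  shows "spencer_delta (spencer_delta f) = 0"
\<comment> \<open>For \<open>i = 0\<close> the second differential starts in degree 0, where it
  vanishes identically; the Koszul criterion applies only from degree 1 on.\<close>
proof (cases i)
  case 0
  then show ?thesis using spencer_delta_degree_0[OF sys] spencer_delta_in[OF sys eb f] by simp
next
  case (Suc l)
  interpret K: koszul_system "fscale sN" "\<lambda>a. contract (e a)" g T_dim
    by (rule koszul_system_contract[OF sys eb])
  let ?c = "\<lambda>as xs. f xs (map e as)"
  have c: "?c as \<in> g (Suc i)" for as
    by (rule tensor_Ext_slice[OF symbolic_system_subspace[OF sys] f])
  have df: "(\<lambda>xs. spencer_delta f xs (map e as)) = fscale sN (of_nat (Suc i)) (K.koszul ?c as)"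
    if "as \<in> chains 0 T_dim" for as
  proof
    fix xs
    have "K.koszul ?c as \<in> g i"
      by (rule K.koszul_mem[OF K.subspace_W K.D_in_W that c]) auto
    then have "K.koszul ?c as \<in> SymN i dual" using symbolic_system_subset[OF sys] by blast
    from SymN_length[OF this, of xs]
    show "spencer_delta f xs (map e as) = fscale sN (of_nat (Suc i)) (K.koszul ?c as) xs"
      by (cases "length xs = i") (simp_all add: spencer_delta_frame[OF sys eb] fscale_def)
  qed
  have "K.koszul (\<lambda>as xs. spencer_delta f xs (map e as)) as = 0" if as: "as \<in> chains_of (Suc (Suc j))" for as
  proof -
    have as': "as \<in> chains 0 T_dim" using as by simp
    have "K.koszul (\<lambda>as xs. spencer_delta f xs (map e as)) as =
        K.koszul (\<lambda>as. fscale sN (of_nat (Suc i)) (K.koszul ?c as)) as"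
      by (rule K.koszul_cong[OF as']) (rule df)
    also have "\<dots> = fscale sN (of_nat (Suc i)) (K.koszul (K.koszul ?c) as)"
      by (rule K.koszul_scale[OF as'])
    also have "K.koszul (K.koszul ?c) as = 0" by (rule K.koszul_koszul[OF as' c])
    finally show ?thesis by (simp only: G.scale_zero_right)
  qed
  then show ?thesis
    using spencer_delta_eq_0_iff[OF sys eb, of "spencer_delta f" l "Suc j"] spencer_delta_in[OF sys eb f] Suc
    by simp
qed

section \<open>Cocycles, coboundaries and involutivity\<close>

lemma subspace_cocycles: "C.subspace (cocycles g i j)"
proof -
  have "spencer_delta 0 = 0" using spencer_delta_scale[of 0 0] by simp
  then show ?thesis using subspace_tensor_Ext[of "g i" j]
    unfolding cocycles_def C.subspace_def
    by (simp add: spencer_delta_add spencer_delta_scale)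
qed

lemma subspace_coboundaries: "C.subspace (coboundaries g i j)"
proof (cases j)
  case 0
  then show ?thesis by (simp add: coboundaries_def C.subspace_single_0)
next
  case (Suc j')
  interpret P: vector_space_pair "fscale (fscale sN) :: 'k \<Rightarrow> ('t list \<Rightarrow> 't list \<Rightarrow> 'v) \<Rightarrow> _"
    "fscale (fscale sN) :: 'k \<Rightarrow> ('t list \<Rightarrow> 't list \<Rightarrow> 'v) \<Rightarrow> _"
    by (intro vector_space_pair.intro C.vector_space_axioms)
  show ?thesis
    unfolding coboundaries_def Suc
    using P.linear_subspace_image[OF linear_spencer_delta subspace_tensor_Ext] by simp
qed

lemma coboundaries_subset_cocycles:
  assumes sys: "symbolic_system k g" and eb: "dual_frame e b"
  shows "coboundaries g i j \<subseteq> cocycles g i j"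
proof (cases j)
  case 0
  then show ?thesis using C.subspace_0[OF subspace_cocycles] by (simp add: coboundaries_def)
next
  case (Suc j')
  then show ?thesis
    using spencer_delta_in[OF sys eb] spencer_delta_spencer_delta[OF sys eb]
    by (auto simp: coboundaries_def cocycles_def)
qed

lemma involutive_cocycles:
  assumes sys: "symbolic_system k g" and eb: "dual_frame e b" and inv: "involutive k g"
    and "i \<noteq> k - 1" "i + j > 0"
  shows "cocycles g i j = coboundaries g i j"
proof
  have coh: "quotient_space (cocycles g i j) (coboundaries g i j) = {coboundaries g i j}"
    using inv assms(4,5) unfolding involutive_def cohomology_def by blast
  show "cocycles g i j \<subseteq> coboundaries g i j"
  proof
    fix z assume "z \<in> cocycles g i j"
    then have "(+) z ` coboundaries g i j \<in> quotient_space (cocycles g i j) (coboundaries g i j)"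
      unfolding quotient_space_def by (rule imageI)
    then have "(+) z ` coboundaries g i j = coboundaries g i j"
      unfolding coh by simp
    then show "z \<in> coboundaries g i j"
      using C.subspace_0[OF subspace_coboundaries, of g i j] by (metis add.right_neutral imageI)
  qed
qed (rule coboundaries_subset_cocycles[OF sys eb])

text \<open>As \<open>t \<ge> k\<close> and \<open>k \<ge> 1\<close>, the position differs from
  \<open>k - 1\<close>, so involutivity makes cocycles exact; \<open>assemble\<close> and the
  reading off of coefficients carry this over to cochains.\<close>

lemma exact_frame:
  assumes sys: "symbolic_system k g" and eb: "dual_frame e b" and inv: "involutive k g"
    and "k \<ge> 1" "k \<le> t"
  shows "exact_frame g e 0 t"
proof -
  interpret K: koszul_system "fscale sN" "\<lambda>a. contract (e a)" g T_dim
    by (rule koszul_system_contract[OF sys eb])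
  have K0: "K.ker_upto 0 t = g t" for t by (simp add: K.ker_upto_def)
  obtain s where t: "t = Suc s" using assms(4,5) by (cases t) auto
  show ?thesis
    unfolding K.exact_at_def K0
  proof (intro allI impI)
    fix j c
    assume c: "\<forall>as\<in>chains 0 T_dim. length as = Suc j \<longrightarrow> c as \<in> g t"
      and closed: "\<forall>as\<in>chains 0 T_dim. length as = Suc (Suc j) \<longrightarrow> K.koszul c as = 0"
    let ?f = "assemble b (Suc j) c"
    have f: "?f \<in> tensor_Ext (g t) (Suc j)" using c by (intro assemble_in[OF eb]) simp
    have f_c: "(\<lambda>xs. ?f xs (map e as)) = c as" if "as \<in> chains 0 T_dim" "length as = Suc j" for as
      using assemble_frame[OF eb, of as "Suc j" c] that by (intro ext) simp
    have "K.koszul (\<lambda>as xs. ?f xs (map e as)) as = 0" if "as \<in> chains_of (Suc (Suc j))" for as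
    proof -
      have as: "as \<in> chains 0 T_dim" "length as = Suc (Suc j)" using that by auto
      have "K.koszul (\<lambda>as xs. ?f xs (map e as)) as = K.koszul c as"
        by (rule K.koszul_cong[OF as(1)]) (use as(2) in \<open>auto intro: f_c\<close>)
      then show ?thesis using closed as by simp
    qed
    then have "spencer_delta ?f = 0"
      using spencer_delta_eq_0_iff[OF sys eb f[unfolded t]] by blast
    then have "?f \<in> cocycles g t (Suc j)" using f by (simp add: cocycles_def)
    also have "cocycles g t (Suc j) = coboundaries g t (Suc j)"
      using assms(4,5) by (intro involutive_cocycles[OF sys eb inv]) auto
    finally obtain \<eta> where \<eta>: "\<eta> \<in> tensor_Ext (g (Suc t)) j" "?f = spencer_delta \<eta>"
      by (auto simp: coboundaries_def)
    \<comment> \<open>From degree \<open>Suc t\<close> the Spencer differential is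
      \<open>Suc t\<close> times the Koszul one, so the primitive is rescaled.\<close>
    define c' where "c' as = fscale sN (of_nat (Suc t)) (\<lambda>xs. \<eta> xs (map e as))" for as
    have \<eta>_g: "(\<lambda>xs. \<eta> xs (map e as)) \<in> g (Suc t)" for as
      by (rule tensor_Ext_slice[OF symbolic_system_subspace[OF sys] \<eta>(1)])
    have "c' as \<in> g (Suc t)" for as
      unfolding c'_def by (rule G.subspace_scale[OF symbolic_system_subspace[OF sys] \<eta>_g])
    moreover have "K.koszul c' as = c as" if as: "as \<in> chains 0 T_dim" "length as = Suc j" for as
    proof
      fix xs
      let ?k = "K.koszul (\<lambda>as xs. \<eta> xs (map e as)) as"
      have "?k \<in> g t"
        by (rule K.koszul_mem[OF K.subspace_W K.D_in_W as(1) \<eta>_g]) auto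
      then have k: "?k xs = 0" if "length xs \<noteq> t"
        using SymN_length[OF _ that] symbolic_system_subset[OF sys] by blast
      have "K.koszul c' as xs = sN (of_nat (Suc t)) (?k xs)"
        unfolding c'_def K.koszul_scale[OF as(1)] by (simp add: fscale_def)
      also have "\<dots> = sN (of_nat (Suc (length xs))) (?k xs)" using k by (cases "length xs = t") auto
      also have "\<dots> = ?f xs (map e as)" unfolding \<eta>(2) by (rule spencer_delta_frame[OF sys eb, symmetric])
      also have "\<dots> = c as xs" using fun_cong[OF f_c[OF as], of xs] .
      finally show "K.koszul c' as xs = c as xs" .
    qed
    ultimately show "\<exists>c'. (\<forall>as\<in>chains 0 T_dim. length as = j \<longrightarrow> c' as \<in> g (Suc t)) \<and>
        (\<forall>as\<in>chains 0 T_dim. length as = Suc j \<longrightarrow> K.koszul c' as = c as)" by blast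
  qed
qed

end

section \<open>Hilbert functions\<close>

text \<open>The coefficient of \<open>z^t\<close> in the product of \<open>(1 - z)^n\<close> and its
  inverse, obtained as the Vandermonde convolution for \<open>n\<close> and
  \<open>- n\<close>.\<close>

lemma alternating_multichoose_sum:
  assumes "1 \<le> t" "1 \<le> n"
  shows "(\<Sum>j\<le>t. (- 1) ^ j * int (n choose j) * int ((t - j + n - 1) choose (n - 1))) = 0"
proof -
  have "(\<Sum>j\<le>t. (- 1) ^ j * real (n choose j) * real ((t - j + n - 1) choose (n - 1))) =
      (- 1) ^ t * (\<Sum>j\<le>t. (real n gchoose j) * ((- real n) gchoose (t - j)))"
    unfolding sum_distrib_left
  proof (rule sum.cong[OF refl])
    fix j assume j: "j \<in> {..t}"
    have "(- real n) gchoose (t - j) = (- 1) ^ (t - j) * ((real n + real (t - j) - 1) gchoose (t - j))"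
      by (rule gbinomial_minus)
    also have "real n + real (t - j) - 1 = real (t - j + n - 1)" using assms by (simp add: of_nat_diff)
    also have "real (t - j + n - 1) gchoose (t - j) = real ((t - j + n - 1) choose (t - j))"
      by (rule binomial_gbinomial[symmetric])
    also have "(t - j + n - 1) choose (t - j) = (t - j + n - 1) choose (n - 1)"
      using assms by (subst binomial_symmetric) auto
    finally have m: "(- real n) gchoose (t - j) = (- 1) ^ (t - j) * real ((t - j + n - 1) choose (n - 1))" .
    have "(- 1) ^ t * (- 1) ^ (t - j) = (- 1 :: real) ^ j"
      using j by (simp add: minus_one_power_iff)
    then have "(- 1) ^ j * real (n choose j) * real ((t - j + n - 1) choose (n - 1)) =
        ((- 1) ^ t * (- 1) ^ (t - j)) * real (n choose j) * real ((t - j + n - 1) choose (n - 1))"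
      by simp
    then show "(- 1) ^ j * real (n choose j) * real ((t - j + n - 1) choose (n - 1)) =
        (- 1) ^ t * ((real n gchoose j) * ((- real n) gchoose (t - j)))"
      unfolding m binomial_gbinomial by (simp only: mult_ac)
  qed
  also have "(\<Sum>j\<le>t. (real n gchoose j) * ((- real n) gchoose (t - j))) = 0"
    using gbinomial_Vandermonde[of "real n" "- real n" t] assms by (cases t) (simp_all add: atLeast0AtMost)
  finally have "real_of_int (\<Sum>j\<le>t. (- 1) ^ j * int (n choose j) * int ((t - j + n - 1) choose (n - 1))) = 0"
    by simp
  then show ?thesis by (simp only: of_int_eq_0_iff)
qed

text \<open>The term \<open>j = 0\<close> has coefficient 1, so the relations determine
  \<open>d t\<close> from smaller degrees, and \<open>alternating_multichoose_sum\<close> supplies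
  the solution. The cutoff \<open>m\<close> is there because the relations will hold only below the
  order of the system.\<close>

lemma multichoose_unique:
  fixes d :: "nat \<Rightarrow> int"
  assumes "1 \<le> n" and "\<And>t. 1 \<le> t \<Longrightarrow> t \<le> m \<Longrightarrow> (\<Sum>j\<le>t. (- 1) ^ j * int (n choose j) * d (t - j)) = 0"
    and "t \<le> m"
  shows "d t = d 0 * int ((t + n - 1) choose (n - 1))"
  using assms(3)
proof (induction t rule: less_induct)
  case (less t)
  show ?case
  proof (cases "t = 0")
    case True
    then show ?thesis using assms(1) by simp
  next
    case False
    let ?a = "\<lambda>t. int ((t + n - 1) choose (n - 1))"
    have split: "(\<Sum>j\<le>t. f j) = f 0 + (\<Sum>j\<in>{1..t}. f j)" for f :: "nat \<Rightarrow> int"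
      by (simp add: atMost_atLeast0 sum.atLeast_Suc_atMost)
    have "(\<Sum>j\<in>{1..t}. (- 1) ^ j * int (n choose j) * d (t - j)) =
        (\<Sum>j\<in>{1..t}. (- 1) ^ j * int (n choose j) * (d 0 * ?a (t - j)))"
    proof (rule sum.cong[OF refl])
      fix j assume "j \<in> {1..t}"
      then have "t - j < t" "t - j \<le> m" using less.prems by auto
      from less.IH[OF this] show "(- 1) ^ j * int (n choose j) * d (t - j) =
          (- 1) ^ j * int (n choose j) * (d 0 * ?a (t - j))" by (simp only:)
    qed
    also have "\<dots> = d 0 * (\<Sum>j\<in>{1..t}. (- 1) ^ j * int (n choose j) * ?a (t - j))"
      by (simp add: sum_distrib_left mult_ac)
    also have "(\<Sum>j\<in>{1..t}. (- 1) ^ j * int (n choose j) * ?a (t - j)) = - ?a t"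
      using alternating_multichoose_sum[of t n] False assms(1) unfolding split by simp
    finally show ?thesis
      using assms(2)[of t] False less.prems unfolding split by simp
  qed
qed

text \<open>\<open>\<kappa> i r\<close> stands for the dimension of the \<open>i\<close>-th kernel
  in degree \<open>k + r\<close>. The hypothesis \<open>start\<close> is \<open>step\<close> with
  the value \<open>s (Suc i)\<close> placed at \<open>r = -1\<close>; Pascal's rule carries the
  double induction, downwards in \<open>i\<close> and upwards in \<open>r\<close>.\<close>

lemma iterated_summation:
  fixes \<kappa> :: "nat \<Rightarrow> nat \<Rightarrow> int"
  assumes top: "\<And>r. \<kappa> n r = 0"
    and start: "\<And>i. i < n \<Longrightarrow> \<kappa> i 0 = s (Suc i) + \<kappa> (Suc i) 0"
    and step: "\<And>i r. i < n \<Longrightarrow> r < R \<Longrightarrow> \<kappa> i (Suc r) = \<kappa> (Suc i) (Suc r) + \<kappa> i r"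
    and "i \<le> n" "r \<le> R"
  shows "\<kappa> i r = (\<Sum>j = Suc i..n. s j * int ((r + j - Suc i) choose (j - Suc i)))"
  using assms(4,5)
proof (induction "n - i" arbitrary: i r)
  case 0
  then show ?case using top by simp
next
  case (Suc m)
  have i: "i < n" using Suc.hyps(2) by simp
  have m: "m = n - Suc i" using Suc.hyps(2) by simp
  have split: "(\<Sum>j = Suc i..n. f j) = f (Suc i) + (\<Sum>j = Suc (Suc i)..n. f j)" for f :: "nat \<Rightarrow> int"
    using i by (simp add: sum.atLeast_Suc_atMost)
  note IH = Suc.hyps(1)[OF m]
  show ?case
    using Suc.prems(2)
  proof (induction r)
    case 0
    have "\<kappa> (Suc i) 0 = (\<Sum>j = Suc (Suc i)..n. s j)"
      using IH[of 0] i by simp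
    then show ?case using start[OF i] unfolding split by simp
  next
    case (Suc r)
    have "\<kappa> i (Suc r) = \<kappa> (Suc i) (Suc r) + \<kappa> i r" using step[OF i] Suc.prems by simp
    also have "\<kappa> (Suc i) (Suc r) =
        (\<Sum>j = Suc (Suc i)..n. s j * int ((Suc r + j - Suc (Suc i)) choose (j - Suc (Suc i))))"
      using IH[of "Suc r"] Suc.prems i by simp
    also have "\<kappa> i r = s (Suc i) + (\<Sum>j = Suc (Suc i)..n. s j * int ((r + j - Suc i) choose (j - Suc i)))"
      using Suc.IH Suc.prems unfolding split by simp
    also have "(\<Sum>j = Suc (Suc i)..n. s j * int ((Suc r + j - Suc (Suc i)) choose (j - Suc (Suc i)))) +
        (s (Suc i) + (\<Sum>j = Suc (Suc i)..n. s j * int ((r + j - Suc i) choose (j - Suc i)))) =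
        s (Suc i) + (\<Sum>j = Suc (Suc i)..n. s j * int ((Suc r + j - Suc i) choose (j - Suc i)))"
    proof -
      have "s j * int ((Suc r + j - Suc (Suc i)) choose (j - Suc (Suc i))) +
          s j * int ((r + j - Suc i) choose (j - Suc i)) =
          s j * int ((Suc r + j - Suc i) choose (j - Suc i))" if "j \<in> {Suc (Suc i)..n}" for j
      proof -
        have "Suc (Suc i) \<le> j" using that by simp
        then obtain l where l: "j = Suc (Suc i) + l" by (auto dest: le_Suc_ex)
        show ?thesis by (simp add: l distrib_left)
      qed
      then show ?thesis by (simp add: sum.distrib[symmetric])
    qed
    finally show ?case unfolding split by simp
  qed
qed

text \<open>With \<open>x\<close>, \<open>z\<close> and \<open>\<beta>\<close> the dimensions of the
  spaces, cocycles and coboundaries, rank-nullity along the complex telescopes up to the last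
  boundary term.\<close>

lemma alternating_sum_shift:
  fixes x z \<beta> :: "nat \<Rightarrow> int"
  assumes "\<And>j. j \<le> t \<Longrightarrow> x j = z j + \<beta> (Suc j)" "\<beta> 0 = 0"
  shows "(\<Sum>j\<le>t. (- 1) ^ j * x j) = (\<Sum>j\<le>t. (- 1) ^ j * (z j - \<beta> j)) + (- 1) ^ t * \<beta> (Suc t)"
  using assms by (induction t) (auto simp: algebra_simps)

section \<open>Euler characteristics and dimensions of the cohomology\<close>

context symbol_spaces
begin

lemma euler_characteristic:
  assumes sys: "symbolic_system k g" and eb: "dual_frame e b"
  shows "(\<Sum>j\<le>t. (- 1) ^ j * int (T_dim choose j) * int (G.dim (g (t - j)))) =
    (\<Sum>j\<le>t. (- 1) ^ j * int (cohomology_dim g (t - j) j))"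
proof -
  interpret P: vector_space_pair "fscale (fscale sN) :: 'k \<Rightarrow> ('t list \<Rightarrow> 't list \<Rightarrow> 'v) \<Rightarrow> _"
    "fscale (fscale sN) :: 'k \<Rightarrow> ('t list \<Rightarrow> 't list \<Rightarrow> 'v) \<Rightarrow> _"
    by (intro vector_space_pair.intro C.vector_space_axioms)
  interpret K: koszul_system "fscale sN" "\<lambda>a. contract (e a)" g T_dim
    by (rule koszul_system_contract[OF sys eb])
  note dim_g = dim_tensor_Ext[OF eb K.subspace_W K.fin_dim_W]
  define x where "x j = int (C.dim (tensor_Ext (g (t - j)) j))" for j
  define z where "z j = int (C.dim (cocycles g (t - j) j))" for j
  \<comment> \<open>The complex of total degree \<open>t\<close> ends at \<open>j = t\<close>.
    Beyond it \<open>t - j\<close> would be truncated to 0 and name an unrelated space, so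
    \<open>\<beta>\<close> is set to 0 there.\<close>
  define \<beta> where "\<beta> j = (if j \<le> t then int (C.dim (coboundaries g (t - j) j)) else 0)" for j
  have "x j = z j + \<beta> (Suc j)" if "j \<le> t" for j
  proof (cases "j = t")
    case True
    then have "cocycles g (t - j) j = tensor_Ext (g (t - j)) j"
      using spencer_delta_degree_0[OF sys] by (auto simp: cocycles_def)
    then show ?thesis using True by (simp add: x_def z_def \<beta>_def)
  next
    case False
    then have "Suc (t - Suc j) = t - j" using that by simp
    then have "coboundaries g (t - Suc j) (Suc j) = spencer_delta ` tensor_Ext (g (t - j)) j"
      by (simp add: coboundaries_def)
    then show ?thesis
      using P.rank_nullity[OF linear_spencer_delta subspace_tensor_Ext dim_g(2)] False that
      by (simp add: x_def z_def \<beta>_def cocycles_def)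
  qed
  moreover have "\<beta> 0 = 0"
    using C.dim_le_card'[of "{}"] C.dim_span[of "{}"] by (simp add: \<beta>_def coboundaries_def)
  ultimately have "(\<Sum>j\<le>t. (- 1) ^ j * x j) = (\<Sum>j\<le>t. (- 1) ^ j * (z j - \<beta> j))"
    using alternating_sum_shift[of t x z \<beta>] by (simp add: \<beta>_def)
  moreover have "z j - \<beta> j = int (cohomology_dim g (t - j) j)" if "j \<le> t" for j
  proof -
    have "C.fin_dim (cocycles g (t - j) j)"
      by (rule C.fin_dim_subset[OF dim_g(2)]) (auto simp: cocycles_def)
    from C.quotient_dim_eq[OF subspace_cocycles this subspace_coboundaries
        coboundaries_subset_cocycles[OF sys eb]] that
    show ?thesis by (simp add: z_def \<beta>_def cohomology_dim_def)
  qed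
  ultimately show ?thesis by (simp add: x_def dim_g(1) mult.assoc)
qed

lemma cohomology_dim_eq_0:
  assumes sys: "symbolic_system k g" and eb: "dual_frame e b"
    and "cocycles g i j \<subseteq> coboundaries g i j"
  shows "cohomology_dim g i j = 0"
proof -
  interpret K: koszul_system "fscale sN" "\<lambda>a. contract (e a)" g T_dim
    by (rule koszul_system_contract[OF sys eb])
  have "C.fin_dim (cocycles g i j)"
    by (rule C.fin_dim_subset[OF dim_tensor_Ext(2)[OF eb K.subspace_W K.fin_dim_W]])
      (auto simp: cocycles_def)
  moreover have "cocycles g i j = coboundaries g i j"
    using assms(3) coboundaries_subset_cocycles[OF sys eb] by blast
  ultimately show ?thesis
    using C.quotient_dim_eq[OF subspace_cocycles _ subspace_coboundaries, of g i j g i j]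
    by (simp add: cohomology_dim_def)
qed

text \<open>A tensor of positive degree whose contractions all vanish is zero. This settles the
  position \<open>(k - 1, 0)\<close> for \<open>k \<ge> 2\<close>, about which involutivity says
  nothing.\<close>

lemma cocycles_Suc_0:
  assumes sys: "symbolic_system k g" and eb: "dual_frame e b"
  shows "cocycles g (Suc i) 0 \<subseteq> {0}"
proof
  interpret K: koszul_system "fscale sN" "\<lambda>a. contract (e a)" g T_dim
    by (rule koszul_system_contract[OF sys eb])
  fix f assume "f \<in> cocycles g (Suc i) 0"
  then have f: "f \<in> tensor_Ext (g (Suc i)) 0" and "spencer_delta f = 0" by (auto simp: cocycles_def)
  then have K0: "K.koszul (\<lambda>as xs. f xs (map e as)) as = 0" if "as \<in> chains_of (Suc 0)" for as
    using spencer_delta_eq_0_iff[OF sys eb f] that by blast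
  have c0: "contract (e a) (\<lambda>xs. f xs []) = 0" if "a < T_dim" for a
    using K0[of "[a]"] that by simp
  have "(\<lambda>xs. f xs []) \<in> SymN (Suc i) dual"
    using tensor_Ext_slice[OF K.subspace_W f] symbolic_system_subset[OF sys] by blast
  from contract_zero[OF eb this c0] have "(\<lambda>xs. f xs []) = 0" .
  moreover have "chains_of 0 = {[]}" by auto
  ultimately have "f xs ys = 0" for xs ys
    unfolding tensor_Ext_expand[OF eb f, of xs ys] by (simp add: fun_eq_iff)
  then have "f = 0" by (intro ext) simp
  then show "f \<in> {0}" by simp
qed

lemma dim_degree_0: "G.dim (SymN 0 dual) = N.dim UNIV"
proof -
  interpret P: vector_space_pair sN "fscale sN :: 'k \<Rightarrow> ('t list \<Rightarrow> 'v) \<Rightarrow> _"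
    by (intro vector_space_pair.intro N.vector_space_axioms G.vector_space_axioms)
  define E where "E v = (\<lambda>xs::'t list. if xs = [] then v else (0::'v))" for v
  have E: "Vector_Spaces.linear sN (fscale sN) E"
    unfolding Vector_Spaces.linear_iff
    by (intro conjI allI N.vector_space_axioms G.vector_space_axioms) (auto simp: E_def fscale_def)
  have "E ` UNIV = SymN 0 dual"
  proof
    have "E v = (\<lambda>xs. sN (power_form 0 (\<lambda>x. 0) xs) v)" for v
      by (auto simp: E_def power_form_def)
    moreover have "(\<lambda>x. 0) \<in> dual" using D.subspace_0[OF subspace_dual] by (simp add: zero_fun_def)
    ultimately show "E ` UNIV \<subseteq> SymN 0 dual" using power_form_SymN by auto
    show "SymN 0 dual \<subseteq> E ` UNIV"
    proof
      fix f assume "f \<in> SymN 0 dual"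
      then have "f = E (f [])" using SymN_length by (auto simp: E_def)
      then show "f \<in> E ` UNIV" by blast
    qed
  qed
  moreover have "{v \<in> UNIV. E v = 0} = {0}" by (auto simp: E_def fun_eq_iff)
  moreover have "N.dim {0} = 0" using N.dim_le_card'[of "{}"] N.dim_span[of "{}"] by simp
  moreover have "N.fin_dim UNIV" using finite_dim_N unfolding N.fin_dim_def by blast
  ultimately show ?thesis
    using P.rank_nullity[OF E N.subspace_UNIV] by simp
qed

text \<open>One frame is regular up to degree \<open>k + R\<close> and has a coframe satisfying the
  genericity condition: the Cartan characters are read off from its kernels in degree
  \<open>k\<close> and propagated to higher degrees by rank-nullity.\<close>

lemma hilbert_function:
  assumes sys: "symbolic_system k g" and inv: "involutive k g" and "k \<ge> 1"
    and s: "cartan_characters k g s" and "r \<le> R"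
  shows "int (G.dim (g (k + r))) = (\<Sum>j = 1..T_dim. s j * int ((r + j - 1) choose (j - 1)))"
proof -
  obtain P b0 where P: "polynomial_in_coframe P" "is_coframe b0" "P b0 \<noteq> 0"
    and char: "\<And>b. is_coframe b \<Longrightarrow> P b \<noteq> 0 \<Longrightarrow> \<forall>i\<in>{1..T_dim}.
      s i = int (G.dim (g k \<inter> SymN k (flag_of b (i - 1)))) - int (G.dim (g k \<inter> SymN k (flag_of b i)))"
    using s unfolding cartan_characters_def for_generic_flag_def by blast
  have "\<exists>e b. dual_frame e b \<and> P b \<noteq> 0 \<and>
      (\<forall>i<T_dim. \<forall>t. k \<le> t \<longrightarrow> t \<le> k + R \<longrightarrow> surj_frame g e i t)"
    by (rule regular_frame[OF sys _ P order_refl]) (rule exact_frame[OF sys _ inv \<open>k \<ge> 1\<close>])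
  then obtain e b where eb: "dual_frame e b" "P b \<noteq> 0"
    and surj: "\<And>i t. i < T_dim \<Longrightarrow> k \<le> t \<Longrightarrow> t \<le> k + R \<Longrightarrow> surj_frame g e i t"
    by blast
  interpret P: vector_space_pair "fscale sN :: 'k \<Rightarrow> ('t list \<Rightarrow> 'v) \<Rightarrow> _"
    "fscale sN :: 'k \<Rightarrow> ('t list \<Rightarrow> 'v) \<Rightarrow> _"
    by (intro vector_space_pair.intro G.vector_space_axioms)
  interpret K: koszul_system "fscale sN" "\<lambda>a. contract (e a)" g T_dim
    by (rule koszul_system_contract[OF sys eb(1)])
  obtain k' where k': "k = Suc k'" using \<open>k \<ge> 1\<close> by (cases k) auto
  define \<kappa> where "\<kappa> i r = int (G.dim (K.ker_upto i (k + r)))" for i r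
  have ker_k: "g k \<inter> SymN k (flag_of b i) = K.ker_upto i k" if "i \<le> T_dim" for i
    unfolding k' SymN_flag_of[OF eb(1) that] K.ker_upto_def
    using symbolic_system_subset[OF sys, of "Suc k'"] by auto
  have "\<kappa> 0 r = (\<Sum>j = Suc 0..T_dim. s j * int ((r + j - Suc 0) choose (j - Suc 0)))"
  proof (rule iterated_summation[where R = R])
    show "\<kappa> T_dim r = 0" for r
    proof -
      have "K.ker_upto T_dim (k + r) \<subseteq> {0}"
        using contract_zero[OF eb(1), of _ "k' + r"] symbolic_system_subset[OF sys, of "k + r"]
        unfolding K.ker_upto_def by (auto simp: k')
      then have "K.ker_upto T_dim (k + r) \<subseteq> G.span {}" by simp
      then show ?thesis using G.dim_le_card[of _ "{}"] by (simp add: \<kappa>_def)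
    qed
    show "\<kappa> i 0 = s (Suc i) + \<kappa> (Suc i) 0" if "i < T_dim" for i
    proof -
      have "s (Suc i) = int (G.dim (g k \<inter> SymN k (flag_of b i))) - int (G.dim (g k \<inter> SymN k (flag_of b (Suc i))))"
        using char[OF dual_frame_coframe[OF eb(1)] eb(2)] that by force
      then show ?thesis using that by (simp add: ker_k \<kappa>_def)
    qed
    \<comment> \<open>Regularity makes the contraction with \<open>e i\<close> map the
      \<open>i\<close>-th kernel in degree \<open>k + r + 1\<close> onto the one in degree
      \<open>k + r\<close>; what it kills is the next kernel.\<close>
    show "\<kappa> i (Suc r) = \<kappa> (Suc i) (Suc r) + \<kappa> i r" if "i < T_dim" "r < R" for i r
    proof -
      let ?V = "K.ker_upto i (Suc (k + r))"
      have "contract (e i) ` ?V = K.ker_upto i (k + r)"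
        using surj[of i "k + r"] that K.D_in_ker_upto[of i i] unfolding K.surj_at_def by auto
      moreover have "{w \<in> ?V. contract (e i) w = 0} = K.ker_upto (Suc i) (Suc (k + r))"
        by (auto simp: K.ker_upto_Suc)
      ultimately show ?thesis
        using P.rank_nullity[OF linear_contract K.subspace_ker_upto K.fin_dim_ker_upto,
            of i "Suc (k + r)" "e i"] that
        by (simp add: \<kappa>_def)
    qed
  qed (use assms in auto)
  moreover have "K.ker_upto 0 (k + r) = g (k + r)" by (simp add: K.ker_upto_def)
  ultimately show ?thesis by (simp add: \<kappa>_def)
qed

lemma involutive_euler:
  assumes sys: "symbolic_system k g" and eb: "dual_frame e b" and inv: "involutive k g"
    and "k \<ge> 1" "t \<ge> 1"
  shows "(\<Sum>j\<le>t. (- 1) ^ j * int (T_dim choose j) * int (G.dim (g (t - j)))) =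
    (if k \<le> t then (- 1) ^ (t + 1 - k) * int (cohomology_dim g (k - 1) (t + 1 - k)) else 0)"
proof -
  let ?H = "\<lambda>j. (- 1) ^ j * int (cohomology_dim g (t - j) j)"
  have zero: "?H j = 0" if "j \<le> t" "\<not> (k \<le> t \<and> j = t + 1 - k)" for j
  proof (cases "t - j = k - 1")
    case True
    \<comment> \<open>Outside the exceptional position, \<open>t - j = k - 1\<close> leaves only
      \<open>t = k - 1\<close>.\<close>
    then have "j = 0" using that \<open>k \<ge> 1\<close> by auto
    obtain i where "t = Suc i" using \<open>t \<ge> 1\<close> by (cases t) auto
    then have "cohomology_dim g t 0 = 0"
      using cocycles_Suc_0[OF sys eb, of i]
      by (intro cohomology_dim_eq_0[OF sys eb]) (simp add: coboundaries_def)
    then show ?thesis using \<open>j = 0\<close> by simp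
  next
    case False
    have "cohomology_dim g (t - j) j = 0"
      using involutive_cocycles[OF sys eb inv False] that \<open>t \<ge> 1\<close>
      by (intro cohomology_dim_eq_0[OF sys eb]) simp
    then show ?thesis by simp
  qed
  have "(\<Sum>j\<le>t. ?H j) = (if k \<le> t then ?H (t + 1 - k) else 0)"
  proof (cases "k \<le> t")
    case True
    then have "(\<Sum>j\<le>t. ?H j) = (\<Sum>j\<in>{t + 1 - k}. ?H j)"
      using zero \<open>k \<ge> 1\<close> by (intro sum.mono_neutral_right) auto
    then show ?thesis using True by simp
  next
    case False
    then show ?thesis using zero by (simp add: sum.neutral)
  qed
  moreover have "t - (t + 1 - k) = k - 1" if "k \<le> t" using that \<open>k \<ge> 1\<close> by simp
  ultimately show ?thesis using euler_characteristic[OF sys eb, of t] by (cases "k \<le> t") simp_all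
qed

lemma cohomology_dim_0_0:
  assumes sys: "symbolic_system k g" and eb: "dual_frame e b" and "k \<ge> 1"
  shows "cohomology_dim g 0 0 = N.dim UNIV"
proof -
  have "g 0 = SymN 0 dual" using sys \<open>k \<ge> 1\<close> unfolding symbolic_system_def by auto
  then show ?thesis using euler_characteristic[OF sys eb, of 0] dim_degree_0 by simp
qed

text \<open>In total degree \<open>k - 1 + l\<close>, the index \<open>i\<close> of the Euler sum
  belongs to degree \<open>k - 1 + l - i\<close>. So \<open>i < l\<close> meets the Cartan
  characters and \<open>i \<ge> l\<close> the full symmetric powers, the origin of the two inner
  sums.\<close>

lemma cohomology_dim_formula:
  assumes sys: "symbolic_system k g" and eb: "dual_frame e b" and inv: "involutive k g"
    and k: "k \<ge> 1" and s: "cartan_characters k g s" and l: "1 \<le> l" "l \<le> T_dim"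
  shows "int (cohomology_dim g (k - 1) l) =
      (- 1) ^ l * (\<Sum>j = 1..T_dim. s j *
        (\<Sum>i = 0..l - 1. (- 1) ^ i * int (T_dim choose i) * int ((l + j - i - 2) choose (j - 1)))) +
      (- 1) ^ l * int (N.dim UNIV) *
        (\<Sum>i = l..T_dim. (- 1) ^ i * int (T_dim choose i) *
          int ((k + l + T_dim - i - 2) choose (T_dim - 1)))"
proof -
  let ?n = T_dim and ?t = "k - 1 + l"
  define d where "d t = int (G.dim (g t))" for t
  have "g 0 = SymN 0 dual" using sys k unfolding symbolic_system_def by auto
  then have d0: "d 0 = int (N.dim UNIV)" by (simp add: d_def dim_degree_0)
  have low: "d t = d 0 * int ((t + ?n - 1) choose (?n - 1))" if "t < k" for t
  proof (rule multichoose_unique[where m = "k - 1"])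
    show "(\<Sum>j\<le>t. (- 1) ^ j * int (?n choose j) * d (t - j)) = 0" if "1 \<le> t" "t \<le> k - 1" for t
      using involutive_euler[OF sys eb inv k, of t] that k by (simp add: d_def)
  qed (use l that in auto)
  have high: "d (k + r) = (\<Sum>j = 1..?n. s j * int ((r + j - 1) choose (j - 1)))" for r
    unfolding d_def by (rule hilbert_function[OF sys inv k s order_refl])
  let ?f = "\<lambda>j. (- 1) ^ j * int (?n choose j) * d (?t - j)"
  let ?A = "\<lambda>j. \<Sum>i = 0..l - 1. (- 1) ^ i * int (?n choose i) * int ((l + j - i - 2) choose (j - 1))"
  let ?b = "\<lambda>i. (- 1) ^ i * int (?n choose i) * int ((k + l + ?n - i - 2) choose (?n - 1))"
  have "k \<le> ?t" "?t \<ge> 1" "?t + 1 - k = l" using k l by auto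
  then have euler: "(\<Sum>j\<le>?t. ?f j) = (- 1) ^ l * int (cohomology_dim g (k - 1) l)"
    using involutive_euler[OF sys eb inv k, of ?t] by (simp add: d_def)
  have "{..?t} = {0..l - 1} \<union> {l..?t}" using l by auto
  then have "(\<Sum>j\<le>?t. ?f j) = (\<Sum>j = 0..l - 1. ?f j) + (\<Sum>j = l..?t. ?f j)"
    using l by (simp add: sum.union_disjoint)
  also have "(\<Sum>i = 0..l - 1. ?f i) = (\<Sum>j = 1..?n. s j * ?A j)"
  proof -
    have "(\<Sum>i = 0..l - 1. ?f i) = (\<Sum>i = 0..l - 1. \<Sum>j = 1..?n.
        s j * ((- 1) ^ i * int (?n choose i) * int ((l + j - i - 2) choose (j - 1))))"
    proof (rule sum.cong[OF refl])
      fix i assume i: "i \<in> {0..l - 1}"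
      then have "d (?t - i) = d (k + (l - 1 - i))" using k l by simp
      also have "\<dots> = (\<Sum>j = 1..?n. s j * int ((l + j - i - 2) choose (j - 1)))"
        unfolding high
      proof (rule sum.cong[OF refl])
        fix j assume "j \<in> {1..?n}"
        \<comment> \<open>No subtraction is truncated, as \<open>i \<le> l - 1\<close> and
          \<open>j \<ge> 1\<close>.\<close>
        then have "l - 1 - i + j - 1 = l + j - i - 2" using i l by auto
        then show "s j * int ((l - 1 - i + j - 1) choose (j - 1)) = s j * int ((l + j - i - 2) choose (j - 1))"
          by (simp only:)
      qed
      finally have "d (?t - i) = (\<Sum>j = 1..?n. s j * int ((l + j - i - 2) choose (j - 1)))" .
      then show "?f i = (\<Sum>j = 1..?n.
          s j * ((- 1) ^ i * int (?n choose i) * int ((l + j - i - 2) choose (j - 1))))"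
        by (simp only: sum_distrib_left mult.left_commute)
    qed
    also have "\<dots> = (\<Sum>j = 1..?n. s j * ?A j)"
      unfolding sum_distrib_left by (rule sum.swap)
    finally show ?thesis .
  qed
  also have "(\<Sum>i = l..?t. ?f i) = d 0 * (\<Sum>i = l..?n. ?b i)"
  proof -
    have "(\<Sum>i = l..?t. ?f i) = (\<Sum>i = l..?t. d 0 * ?b i)"
    proof (rule sum.cong[OF refl])
      fix i assume i: "i \<in> {l..?t}"
      then have "?t - i < k" and eq: "?t - i + ?n - 1 = k + l + ?n - i - 2" using k l by auto
      from low[OF this(1)] have "d (?t - i) = d 0 * int ((k + l + ?n - i - 2) choose (?n - 1))"
        unfolding eq .
      then show "?f i = d 0 * ?b i" by (simp only: mult.left_commute)
    qed
    \<comment> \<open>The ranges ending in \<open>?t\<close> and in \<open>?n\<close> are compared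
      inside a common larger one: for \<open>?t < i \<le> ?n\<close> the last binomial has upper
      entry below \<open>?n - 1\<close>, and for \<open>i > ?n\<close> the first binomial
      vanishes.\<close>
    also have "\<dots> = (\<Sum>i = l..?t + ?n. d 0 * ?b i)"
    proof (rule sum.mono_neutral_left)
      show "\<forall>i\<in>{l..?t + ?n} - {l..?t}. d 0 * ?b i = 0"
      proof
        fix i assume i: "i \<in> {l..?t + ?n} - {l..?t}"
        show "d 0 * ?b i = 0"
        proof (cases "i \<le> ?n")
          case True
          then have "k + l + ?n - i - 2 < ?n - 1" using i k l by auto
          then show ?thesis by (simp add: binomial_eq_0)
        next
          case False
          then show ?thesis by (simp add: binomial_eq_0)
        qed
      qed
    qed auto
    also have "\<dots> = (\<Sum>i = l..?n. d 0 * ?b i)"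
      by (rule sum.mono_neutral_right) (auto simp: binomial_eq_0)
    finally show ?thesis by (simp only: sum_distrib_left)
  qed
  finally have "(- 1) ^ l * int (cohomology_dim g (k - 1) l) =
      (\<Sum>j = 1..?n. s j * ?A j) + d 0 * (\<Sum>i = l..?n. ?b i)"
    unfolding euler .
  then have "(- 1) ^ l * ((- 1) ^ l * int (cohomology_dim g (k - 1) l)) =
      (- 1) ^ l * ((\<Sum>j = 1..?n. s j * ?A j) + d 0 * (\<Sum>i = l..?n. ?b i))"
    by (rule arg_cong)
  moreover have "(- 1) ^ l * ((- 1) ^ l * x) = x" for x :: int
    by (simp add: minus_one_power_iff)
  ultimately show ?thesis by (simp only: d0 distrib_left mult.assoc)
qed

end

theorem proposition1:
  fixes sT :: "'k::field_char_0 \<Rightarrow> 't::ab_group_add \<Rightarrow> 't"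
    and sN :: "'k \<Rightarrow> 'v::ab_group_add \<Rightarrow> 'v"
    and g :: "nat \<Rightarrow> ('t list \<Rightarrow> 'v) set"
    and k n :: nat
    and s :: "nat \<Rightarrow> int"
    and h :: "nat \<Rightarrow> nat"
  assumes "symbol_spaces sT sN"
    and "vector_space.dim sT (UNIV :: 't set) = n"
    and "k \<ge> 1"
    and "symbol_spaces.symbolic_system sT sN k g"
    and "symbol_spaces.involutive sT sN k g"
    and "s 0 = int (vector_space.dim sN (UNIV :: 'v set))"
    and "symbol_spaces.cartan_characters sT sN k g s"
    and "h 0 = symbol_spaces.cohomology_dim sT sN g 0 0"
    and "\<And>i. i \<in> {1..n} \<Longrightarrow> h i = symbol_spaces.cohomology_dim sT sN g (k - 1) i"
  shows "int (h 0) = s 0 \<and>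
    (\<forall>l\<in>{1..n}. int (h l) =
      (- 1) ^ l * (\<Sum>j = 1..n. s j *
        (\<Sum>i = 0..l - 1. (- 1) ^ i * int (n choose i) * int ((l + j - i - 2) choose (j - 1)))) +
      (- 1) ^ l * s 0 *
        (\<Sum>i = l..n. (- 1) ^ i * int (n choose i) * int ((k + l + n - i - 2) choose (n - 1))))"
proof -
  interpret symbol_spaces sT sN by (rule assms(1))
  \<comment> \<open>The nonempty open set behind the Cartan characters already contains a coframe,
    which supplies the frame needed throughout.\<close>
  obtain b0 where "is_coframe b0"
    using assms(7) unfolding cartan_characters_def for_generic_flag_def by blast
  then obtain e where eb: "dual_frame e b0" by (rule coframe_dual_frame)
  have "int (h 0) = s 0"
    using cohomology_dim_0_0[OF assms(4) eb assms(3)] assms(6,8) by simp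
  moreover have "int (h l) =
      (- 1) ^ l * (\<Sum>j = 1..n. s j *
        (\<Sum>i = 0..l - 1. (- 1) ^ i * int (n choose i) * int ((l + j - i - 2) choose (j - 1)))) +
      (- 1) ^ l * s 0 *
        (\<Sum>i = l..n. (- 1) ^ i * int (n choose i) * int ((k + l + n - i - 2) choose (n - 1)))"
    if "l \<in> {1..n}" for l
    using cohomology_dim_formula[OF assms(4) eb assms(5,3,7), of l] that assms(9)[OF that]
    unfolding assms(2,6) by simp
  ultimately show ?thesis by blast
qed

end
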